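(* Let $X$ be a time-homogeneous Markov process with state space $S_\Delta$ and let $m\ge2$ be an even number. Then $X$ is an $m$-polynomial process if and only if the following condition holds: $\mathcal{P}_m$ lies in the domain $\mathcal{D}_{\mathcal{G}}$ of the extended generator, i.e. for all $f\in\mathcal{P}_m$ and $x\in S_\Delta$ the process $M^f_t=f(X_t)-f(x)-\int_0^t\mathcal{G}f(X_s)\,ds$, $t\ge 0$, is a $(\mathcal{F}_t,\mathbb{P}_x)$-local martingale, and $\mathcal{G}(\mathcal{P}_k)\subset\mathcal{P}_k$ for all $k\in\{0,1,\ldots,m\}$.
   Context: Setting. $S\subseteq\mathbb{R}^n$ is closed with Borel $\sigma$-algebra $\mathcal{S}$; $\Delta\notin S$ is an adjoined cemetery point, $S_\Delta=S\cup\{\Delta\}$, $\mathcal{S}_\Delta=\sigma(\mathcal{S},\{\Delta\})$. Convention: $f(\Delta)=0$ for every function $f$ considered on $S$. $(p_t)_{t\ge0}$ is a time-homogeneous Markov transition function on $S_\Delta$ (measurability and Chapman–Kolmogorov) with $p_0(x,\cdot)=\delta_x$, $p_t(x,\{\Delta\})=1-p_t(x,S)$ for $x\in S$, and $p_t(\Delta,\{\Delta\})=1$. The semigroup is $P_tf(x)=\int_S f(\xi)\,p_t(x,d\xi)$, $x\in S_\Delta$, for all Borel $f:S_\Delta\to\mathbb{R}$ for which the integral is well defined. $\Omega$ is the space of càdlàg functions $\omega:\mathbb{R}_+\to S_\Delta$ such that each of $\omega(t-)=\Delta$ and $\omega(t)=\Delta$ implies $\omega(s)=\Delta$ for all $s\ge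 t$; $X_t(\omega)=\omega(t)$ is the coordinate process; $(\mathcal{F}_t)$ is a right continuous filtration containing the filtration generated by $X$, $\mathcal{F}=\bigvee_t\mathcal{F}_t$. For each $x\in S_\Delta$ there is a probability measure $\mathbb{P}_x$ on $(\Omega,\mathcal{F})$ under which $X$ is Markov relative to $(\mathcal{F}_t)$ with semigroup $(P_t)$ and initial value $x$: $\mathbb{E}_x[f(X_{t+s})|\mathcal{F}_s]=P_tf(X_s)$, $\mathbb{P}_x$-a.s., for all $s,t\ge0$ and all Borel $f:S_\Delta\to\mathbb{R}$ with $\mathbb{E}_x[|f(X_t)|]<\infty$ for all $t\ge0$, $x\in S$. Polynomials. $\mathcal{P}_k$ is the finite-dimensional vector space of functions on $S_\Delta$ that on $S$ are restrictions of real polynomials on $\mathbb{R}^n$ of degree at most $k$ and that vanish at $\Delta$. $m$-polynomial. $X$ is called $m$-polynomial if for all $k\in\{0,\ldots,m\}$, all $f\in\mathcal{P}_k$ and $t\ge0$ the map $x\mapsto P_tf(x)$ belongs to $\mathcal{P}_k$ (it is implicitly required that $P_t|f|(x)<\infty$ for all $f\in\mathcal{P}_m$, $x\in S_\Delta$, $t\ge0$), and $t\mapsto P_tf(x)$ is continuous at $t=0$ for all $f\in\mathcal{P}_m$. Extended generator. $\mathcal{G}$ with domain $\mathcal{D}_\mathcal{G}$: $\mathcal{D}_\mathcal{G}$ consists of those Borel $f:S_\Delta\to\mathbb{R}$ for which there is a function $\mathcal{G}f$ such that $M^f_t:=f(X_t)-f(x)-\int_0^t\mathcal{G}f(X_s)\,ds$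 is well defined and a $(\mathcal{F}_t,\mathbb{P}_x)$-local martingale for every $x\in S_\Delta$. *)

theory Defs
  imports "HOL-Probability.Probability"
begin

section \<open>State space and path space\<close>

text \<open>
  The state space with cemetery is modelled in \<open>(real^'n) option\<close>: the point \<open>x\<close> of \<open>S\<close> is
  \<open>Some x\<close> and the cemetery is \<open>None\<close>. It carries the topology of the one-point compactification
  of \<open>S\<close> (\<open>None\<close> is isolated iff \<open>S\<close> is compact), so that a path can reach the cemetery by a
  jump as well as by explosion. Values \<open>Some x\<close> with \<open>x\<close> outside \<open>S\<close> and, throughout, negative
  times play no role.
\<close>

type_synonym 'n state = "(real^'n) option"
type_synonym 'n path = "real \<Rightarrow> 'n state"

definition states :: "(real^'n) set \<Rightarrow> 'n state set" where
  "states S = insert None (Some ` S)"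

definition state_top :: "(real^'n) set \<Rightarrow> 'n state topology" where
  "state_top S = Alexandroff_compactification (top_of_set S)"

definition state_algebra :: "(real^'n) set \<Rightarrow> 'n state measure" where
  "state_algebra S =
     sigma (states S) (insert {None} ((`) Some ` sets (restrict_space borel S)))"

definition cadlag :: "'b topology \<Rightarrow> (real \<Rightarrow> 'b) \<Rightarrow> bool" where
  "cadlag T w \<longleftrightarrow>
     (\<forall>t\<ge>0. limitin T w (w t) (at_right t)) \<and>
     (\<forall>t>0. \<exists>l. limitin T w l (at_left t))"

definition path_space :: "(real^'n) set \<Rightarrow> 'n path set" where
  "path_space S = {\<omega> \<in> {0..} \<rightarrow>\<^sub>E states S.
     cadlag (state_top S) \<omega> \<and>
     (\<forall>t>0. limitin (state_top S) \<omega> None (at_left t) \<longrightarrow> (\<forall>s\<ge>t. \<omega> s = None)) \<and>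
     (\<forall>t\<ge>0. \<omega> t = None \<longrightarrow> (\<forall>s\<ge>t. \<omega> s = None))}"

section \<open>Functions and semigroup\<close>

text \<open>Every function considered vanishes at the cemetery.\<close>

definition borel_functions :: "(real^'n) set \<Rightarrow> ('n state \<Rightarrow> real) set" where
  "borel_functions S = {f \<in> borel_measurable (state_algebra S). f None = 0}"

definition poly_eval :: "nat \<Rightarrow> (('n \<Rightarrow> nat) \<Rightarrow> real) \<Rightarrow> real^'n \<Rightarrow> real" where
  "poly_eval k c x = (\<Sum>\<alpha> | (\<Sum>i\<in>UNIV. \<alpha> i) \<le> k. c \<alpha> * (\<Prod>i\<in>UNIV. (x $ i) ^ \<alpha> i))"

text \<open>The index set of the preceding sum is finite, so the sum is not vacuous.\<close>

lemma finite_multi_indices: "finite {\<alpha> :: 'n::finite \<Rightarrow> nat. (\<Sum>i\<in>UNIV. \<alpha> i) \<le> k}"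
proof (rule finite_subset)
  show "{\<alpha>. (\<Sum>i\<in>UNIV. \<alpha> i) \<le> k} \<subseteq> (UNIV :: 'n set) \<rightarrow>\<^sub>E {..k}"
  proof
    fix \<alpha> :: "'n \<Rightarrow> nat" assume "\<alpha> \<in> {\<alpha>. (\<Sum>i\<in>UNIV. \<alpha> i) \<le> k}"
    moreover have "\<alpha> i \<le> (\<Sum>i\<in>UNIV. \<alpha> i)" for i
      by (rule member_le_sum) auto
    ultimately show "\<alpha> \<in> UNIV \<rightarrow>\<^sub>E {..k}"
      by (auto intro: order_trans)
  qed
  show "finite ((UNIV :: 'n set) \<rightarrow>\<^sub>E {..k})"
    by (intro finite_PiE) auto
qed

definition poly_space :: "(real^'n) set \<Rightarrow> nat \<Rightarrow> ('n state \<Rightarrow> real) set" where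
  "poly_space S k = {f. f None = 0 \<and> (\<exists>c. \<forall>x\<in>S. f (Some x) = poly_eval k c x)}"

text \<open>\<open>p t x\<close> is the transition measure \<open>p\<^sub>t(x,\<cdot>)\<close>.\<close>

definition semigroup_op ::
    "(real^'n) set \<Rightarrow> (real \<Rightarrow> 'n state \<Rightarrow> 'n state measure) \<Rightarrow> real \<Rightarrow>
     ('n state \<Rightarrow> real) \<Rightarrow> 'n state \<Rightarrow> real" where
  "semigroup_op S p t f x = (LINT \<xi>:Some ` S|p t x. f \<xi>)"

section \<open>The Markov process\<close>

locale transition_function =
  fixes S :: "(real^'n) set"
    and p :: "real \<Rightarrow> 'n state \<Rightarrow> 'n state measure"
  assumes kernel: "t \<ge> 0 \<Longrightarrow> p t \<in> state_algebra S \<rightarrow>\<^sub>M subprob_algebra (state_algebra S)"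
    and initial: "x \<in> states S \<Longrightarrow> p 0 x = return (state_algebra S) x"
    and killing: "t \<ge> 0 \<Longrightarrow> y \<in> S \<Longrightarrow>
      emeasure (p t (Some y)) {None} = 1 - emeasure (p t (Some y)) (Some ` S)"
    and absorbing: "t \<ge> 0 \<Longrightarrow> emeasure (p t None) {None} = 1"
    and chapman_kolmogorov: "s \<ge> 0 \<Longrightarrow> t \<ge> 0 \<Longrightarrow> x \<in> states S \<Longrightarrow> A \<in> sets (state_algebra S) \<Longrightarrow>
      emeasure (p (s + t) x) A = (\<integral>\<^sup>+ z. emeasure (p t z) A \<partial>p s x)"

text \<open>
  \<open>F\<close> is the filtration and \<open>P x\<close> the law of the coordinate process started at \<open>x\<close>.
  The library's \<open>filtration\<close> is indexed by all of \<open>real\<close>; a filtration on the nonnegative half-line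
  can be continued by \<open>F t = F 0\<close> for \<open>t < 0\<close>.
\<close>

locale markov_process =
  transition_function S p + filtration "path_space S" F
  for S :: "(real^'n) set"
    and p :: "real \<Rightarrow> 'n state \<Rightarrow> 'n state measure"
    and F :: "real \<Rightarrow> 'n path measure"
    and P :: "'n state \<Rightarrow> 'n path measure" +
  assumes closed_S: "closed S"
    and right_continuous: "t \<ge> 0 \<Longrightarrow> sets (F t) = (\<Inter>u\<in>{t<..}. sets (F u))"
    and adapted: "0 \<le> s \<Longrightarrow> s \<le> t \<Longrightarrow> (\<lambda>\<omega>. \<omega> s) \<in> F t \<rightarrow>\<^sub>M state_algebra S"
    and prob: "x \<in> states S \<Longrightarrow> prob_space (P x)"
    and space_P: "x \<in> states S \<Longrightarrow> space (P x) = path_space S"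
    and sets_P: "x \<in> states S \<Longrightarrow> sets (P x) = sigma_sets (path_space S) (\<Union>t\<in>{0..}. sets (F t))"
    and start: "x \<in> states S \<Longrightarrow> AE \<omega> in P x. \<omega> 0 = x"
    and markov: "x \<in> states S \<Longrightarrow> s \<ge> 0 \<Longrightarrow> t \<ge> 0 \<Longrightarrow> f \<in> borel_functions S \<Longrightarrow>
      (\<And>u y. u \<ge> 0 \<Longrightarrow> y \<in> S \<Longrightarrow> integrable (P (Some y)) (\<lambda>\<omega>. f (\<omega> u))) \<Longrightarrow>
      AE \<omega> in P x. real_cond_exp (P x) (F s) (\<lambda>\<omega>. f (\<omega> (t + s))) \<omega> = semigroup_op S p t f (\<omega> s)"

definition polynomial_process ::
    "nat \<Rightarrow> (real^'n) set \<Rightarrow> (real \<Rightarrow> 'n state \<Rightarrow> 'n state measure) \<Rightarrow> bool" where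
  "polynomial_process m S p \<longleftrightarrow>
     (\<forall>f\<in>poly_space S m. \<forall>x\<in>states S. \<forall>t\<ge>0. (\<integral>\<^sup>+\<xi>\<in>Some ` S. ennreal \<bar>f \<xi>\<bar> \<partial>p t x) < \<infinity>) \<and>
     (\<forall>k\<in>{0..m}. \<forall>f\<in>poly_space S k. \<forall>t\<ge>0. semigroup_op S p t f \<in> poly_space S k) \<and>
     (\<forall>f\<in>poly_space S m. \<forall>x\<in>states S.
        continuous (at 0 within {0..}) (\<lambda>t. semigroup_op S p t f x))"

section \<open>Local martingales and the extended generator\<close>

definition martingale ::
    "'w measure \<Rightarrow> (real \<Rightarrow> 'w measure) \<Rightarrow> (real \<Rightarrow> 'w \<Rightarrow> real) \<Rightarrow> bool" where
  "martingale Q F M \<longleftrightarrow>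
     (\<forall>t\<ge>0. M t \<in> borel_measurable (F t) \<and> integrable Q (M t)) \<and>
     (AE \<omega> in Q. cadlag euclidean (\<lambda>t. M t \<omega>)) \<and>
     (\<forall>s\<ge>0. \<forall>t\<ge>s. AE \<omega> in Q. real_cond_exp Q (F s) (M t) \<omega> = M s \<omega>)"

text \<open>
  The localizing stopping times take values in \<open>[0,\<infinity>]\<close>; the library's \<open>stopping_time\<close> would
  force them to have the index type \<open>real\<close> of the filtration.
\<close>

definition local_martingale ::
    "'w measure \<Rightarrow> (real \<Rightarrow> 'w measure) \<Rightarrow> (real \<Rightarrow> 'w \<Rightarrow> real) \<Rightarrow> bool" where
  "local_martingale Q F M \<longleftrightarrow>
     (\<forall>t\<ge>0. M t \<in> borel_measurable (F t)) \<and>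
     (AE \<omega> in Q. cadlag euclidean (\<lambda>t. M t \<omega>)) \<and>
     (\<exists>\<tau> :: nat \<Rightarrow> 'w \<Rightarrow> ennreal.
        (\<forall>n. \<forall>t\<ge>0. Measurable.pred (F t) (\<lambda>\<omega>. \<tau> n \<omega> \<le> ennreal t)) \<and>
        (AE \<omega> in Q. incseq (\<lambda>n. \<tau> n \<omega>) \<and> (\<lambda>n. \<tau> n \<omega>) \<longlonglongrightarrow> \<infinity>) \<and>
        (\<forall>n. martingale Q F (\<lambda>t \<omega>. M (enn2real (min (ennreal t) (\<tau> n \<omega>))) \<omega>)))"

definition generator_process ::
    "('n state \<Rightarrow> real) \<Rightarrow> ('n state \<Rightarrow> real) \<Rightarrow> 'n state \<Rightarrow> real \<Rightarrow> 'n path \<Rightarrow> real" where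
  "generator_process f g x t \<omega> = f (\<omega> t) - f x - (LINT s:{0..t}|lborel. g (\<omega> s))"

text \<open>
  \<open>f\<close> determines its image under the extended generator only up to a set of potential zero, so
  the generator is a relation; \<open>(f, g)\<close> belongs to its graph iff \<open>g\<close> is a version of that image.
\<close>

definition generator_graph ::
    "(real^'n) set \<Rightarrow> (real \<Rightarrow> 'n path measure) \<Rightarrow> ('n state \<Rightarrow> 'n path measure) \<Rightarrow>
     (('n state \<Rightarrow> real) \<times> ('n state \<Rightarrow> real)) set" where
  "generator_graph S F P = {(f, g). f \<in> borel_functions S \<and>
     (\<forall>x\<in>states S.
        (AE \<omega> in P x. \<forall>t\<ge>0. set_integrable lborel {0..t} (\<lambda>s. g (\<omega> s))) \<and>
        local_martingale (P x) F (generator_process f g x))}"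

definition generator_domain ::
    "(real^'n) set \<Rightarrow> (real \<Rightarrow> 'n path measure) \<Rightarrow> ('n state \<Rightarrow> 'n path measure) \<Rightarrow>
     ('n state \<Rightarrow> real) set" where
  "generator_domain S F P = Domain (generator_graph S F P)"

definition extended_generator ::
    "(real^'n) set \<Rightarrow> (real \<Rightarrow> 'n path measure) \<Rightarrow> ('n state \<Rightarrow> 'n path measure) \<Rightarrow>
     (('n state \<Rightarrow> real) \<Rightarrow> ('n state \<Rightarrow> real)) \<Rightarrow> bool" where
  "extended_generator S F P G \<longleftrightarrow>
     (\<forall>f\<in>generator_domain S F P. (f, G f) \<in> generator_graph S F P)"

end

theory Submission
  imports Defs
begin

text \<open>
  Everything is reduced to Dynkin's formula \<open>P\<^sub>t f = f + \<integral>\<^sub>0\<^sup>t P\<^sub>s g ds\<close> for polynomials \<open>f\<close>, \<open>g\<close>, with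
  \<open>\<phi> = 1 + \<Sum>\<^sub>i x\<^sub>i\<^sup>m\<close> as weight function.

  If the process is \<open>m\<close>-polynomial, \<open>P\<close> is a continuous semigroup on a finite dimensional space, hence
  has an everywhere defined generator there. By the Markov property Dynkin's formula makes \<open>M\<^sup>f\<close> a
  martingale; for small \<open>r\<close> one has \<open>\<phi> \<le> 2 P\<^sub>r \<phi>\<close>, and the resulting maximal inequality rules out
  explosion, so that \<open>M\<^sup>f\<close> has cadlag paths.

  Conversely, weighting the local martingale \<open>M\<^sup>\<phi>\<close> with \<open>exp (- C t)\<close> shows \<open>P\<^sub>t \<phi> \<le> exp (C t) \<phi>\<close>, and then
  \<open>E (\<phi> (X\<^sub>\<tau>); \<tau> \<le> t)\<close> is bounded over all stopping times \<open>\<tau>\<close>. For a polynomial \<open>q\<close> of degree at most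
  \<open>m / 2\<close> this makes the values of \<open>q\<close> at the localizing times uniformly integrable, so that
  Dynkin's formula holds for \<open>q\<close>. As \<open>m\<close> is even, \<open>\<phi>\<close> is a sum of squares of such \<open>q\<close>, and Jensen's
  inequality gives \<open>\<phi> \<le> K P\<^sub>r \<phi>\<close> for bounded \<open>r\<close>. Hence \<open>E (\<phi> (X\<^sub>\<tau>); \<tau> \<le> t) \<le> K E (\<phi> (X\<^sub>t); \<tau> \<le> t)\<close>, which
  tends to zero along a localizing sequence and yields Dynkin's formula in degree \<open>m\<close>. Iterating the
  formula expresses \<open>P\<^sub>t f\<close> as the exponential series of the generator.
\<close>

section \<open>Polynomials on the state space\<close>

text \<open>The difficulty sits in the top degree. A local martingale speaks about localizing times
  only, and in degree \<open>m\<close> there are no higher moments that would make the values at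
  these times uniformly integrable. Polynomials of degree at most \<open>m / 2\<close> have squares
  dominated by \<open>\<phi>\<close>, and these squares carry the information back to degree
  \<open>m\<close>. Gronwall's lemma is not at hand, because moments are not known to be finite; the
  exponential weight is therefore integrated pathwise, before expectations are taken. Only the
  simple Markov property is assumed, so stopping times are rounded up to a finite grid, and the grid
  is removed by right continuity and Fatou's lemma. Polynomials are treated as functions on
  \<open>states S\<close>: if S lies in an algebraic set, different coefficients give the same
  function, and values at finitely many states serve as coordinates. Explosion is a question of path
  regularity: a path running off to infinity converges to \<open>None\<close> in
  \<open>state_top S\<close>, but a polynomial along it need not have a left limit.\<close>

lemma poly_eval_linear:
  "poly_eval k (\<lambda>\<alpha>. a * c \<alpha> + b * d \<alpha>) x = a * poly_eval k c x + b * poly_eval k d x"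
  by (simp add: poly_eval_def sum_distrib_left sum.distrib algebra_simps)

lemma poly_spaceD_None: "f \<in> poly_space S k \<Longrightarrow> f None = 0"
  by (simp add: poly_space_def)

lemma poly_space_zero: "(\<lambda>_. 0) \<in> poly_space S k"
proof -
  have "poly_eval k (\<lambda>_. 0) x = 0" for x :: "real^'n" by (simp add: poly_eval_def)
  then show ?thesis unfolding poly_space_def by (auto intro!: exI[of _ "\<lambda>_. 0"])
qed

lemma poly_space_combo:
  assumes "f \<in> poly_space S k" "g \<in> poly_space S k"
  shows "(\<lambda>x. a * f x + b * g x) \<in> poly_space S k"
proof -
  from assms obtain c d where "\<forall>x\<in>S. f (Some x) = poly_eval k c x" "\<forall>x\<in>S. g (Some x) = poly_eval k d x"
    by (auto simp: poly_space_def)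
  then have "\<forall>x\<in>S. a * f (Some x) + b * g (Some x) = poly_eval k (\<lambda>\<alpha>. a * c \<alpha> + b * d \<alpha>) x"
    by (simp add: poly_eval_linear)
  then show ?thesis using assms by (auto simp: poly_space_def)
qed

lemma poly_space_add: "f \<in> poly_space S k \<Longrightarrow> g \<in> poly_space S k \<Longrightarrow> (\<lambda>x. f x + g x) \<in> poly_space S k"
  using poly_space_combo[of f S k g 1 1] by simp

lemma poly_space_scale: "f \<in> poly_space S k \<Longrightarrow> (\<lambda>x. a * f x) \<in> poly_space S k"
  using poly_space_combo[of f S k f a 0] by simp

lemma poly_space_sum:
  assumes "\<And>j. j \<in> T \<Longrightarrow> f j \<in> poly_space S k"
  shows "(\<lambda>x. \<Sum>j\<in>T. a j * f j x) \<in> poly_space S k"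
  using assms by (induction T rule: infinite_finite_induct)
    (auto intro!: poly_space_zero poly_space_add poly_space_scale)

text \<open>Membership restricts only the values on \<open>states S\<close>. Hence a function may be
  replaced by any expansion that is valid there.\<close>

lemma poly_space_cong:
  assumes "f \<in> poly_space S k" "\<And>x. x \<in> states S \<Longrightarrow> g x = f x"
  shows "g \<in> poly_space S k"
  using assms by (auto simp: poly_space_def states_def)

lemma poly_space_mono:
  assumes "j \<le> k"
  shows "poly_space S j \<subseteq> poly_space (S :: (real^'n) set) k"
proof
  fix f :: "'n state \<Rightarrow> real" assume "f \<in> poly_space S j"
  then obtain c where c: "f None = 0" "\<forall>x\<in>S. f (Some x) = poly_eval j c x"
    by (auto simp: poly_space_def)
  let ?d = "\<lambda>\<alpha> :: 'n \<Rightarrow> nat. if (\<Sum>i\<in>UNIV. \<alpha> i) \<le> j then c \<alpha> else 0"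
  have "poly_eval j c x = poly_eval k ?d x" for x
    unfolding poly_eval_def using assms
    by (intro sum.mono_neutral_cong_left finite_multi_indices) auto
  then show "f \<in> poly_space S k" using c by (auto simp: poly_space_def intro!: exI[of _ ?d])
qed

text \<open>These functions span \<open>poly_space S k\<close> on \<open>states S\<close>, but they
  may be linearly dependent there, so coefficients are not canonical.\<close>

definition monom_fun :: "('n::finite \<Rightarrow> nat) \<Rightarrow> 'n state \<Rightarrow> real" where
  "monom_fun \<alpha> = case_option 0 (\<lambda>y. \<Prod>i\<in>UNIV. (y $ i) ^ \<alpha> i)"

lemma monom_fun_simps [simp]:
  "monom_fun \<alpha> None = 0" "monom_fun \<alpha> (Some y) = (\<Prod>i\<in>UNIV. (y $ i) ^ \<alpha> i)"
  by (auto simp: monom_fun_def)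

lemma monom_fun_in_poly_space:
  assumes "(\<Sum>i\<in>UNIV. \<alpha> i) \<le> k"
  shows "monom_fun \<alpha> \<in> poly_space S k"
proof -
  have "monom_fun \<alpha> (Some x) = poly_eval k (\<lambda>\<beta>. if \<beta> = \<alpha> then 1 else 0) x" for x
  proof -
    have "poly_eval k (\<lambda>\<beta>. if \<beta> = \<alpha> then 1 else 0) x
        = (\<Sum>\<beta> | (\<Sum>i\<in>UNIV. \<beta> i) \<le> k. if \<beta> = \<alpha> then (\<Prod>i\<in>UNIV. (x $ i) ^ \<beta> i) else 0)"
      unfolding poly_eval_def by (intro sum.cong) auto
    then show ?thesis using assms by (simp add: sum.delta finite_multi_indices)
  qed
  then show ?thesis by (auto simp: poly_space_def)
qed

lemma poly_space_monom_expansion: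
  assumes "f \<in> poly_space S k"
  shows "\<exists>c. \<forall>x\<in>states S. f x = (\<Sum>\<alpha> | (\<Sum>i\<in>UNIV. \<alpha> i) \<le> k. c \<alpha> * monom_fun \<alpha> x)"
proof -
  from assms obtain c where "f None = 0" "\<forall>x\<in>S. f (Some x) = poly_eval k c x"
    by (auto simp: poly_space_def)
  then show ?thesis by (intro exI[of _ c]) (auto simp: states_def poly_eval_def)
qed

text \<open>The index \<open>None\<close> stands for the constant 1. This makes the weight a single
  sum over \<open>'n option\<close> and, for an exponent \<open>2 * k\<close>, a sum of squares of
  functions of degree k.\<close>

definition coord_power :: "nat \<Rightarrow> 'n::finite option \<Rightarrow> 'n state \<Rightarrow> real" where
  "coord_power k j = case_option 0 (\<lambda>y. case j of None \<Rightarrow> 1 | Some i \<Rightarrow> (y $ i) ^ k)"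

lemma coord_power_in_poly_space: "coord_power k j \<in> poly_space (S :: (real^'n) set) k"
proof (cases j)
  case None
  have "coord_power k j = monom_fun (\<lambda>_ :: 'n. 0)"
    by (rule ext) (simp add: coord_power_def monom_fun_def None)
  then show ?thesis using monom_fun_in_poly_space[of "\<lambda>_ :: 'n. 0" k] by simp
next
  case (Some i)
  have *: "(\<Prod>l\<in>UNIV. (y $ l) ^ (if l = i then k else 0)) = (y $ i) ^ k" for y :: "real^'n"
  proof -
    have "(\<Prod>l\<in>UNIV. (y $ l) ^ (if l = i then k else 0)) = (\<Prod>l\<in>UNIV. if l = i then (y $ l) ^ k else 1)"
      by (intro prod.cong) auto
    then show ?thesis by simp
  qed
  have "coord_power k j = monom_fun (\<lambda>l. if l = i then k else 0)"
    by (rule ext) (simp add: coord_power_def monom_fun_def Some * split: option.split)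
  then show ?thesis using monom_fun_in_poly_space[of "\<lambda>l. if l = i then k else 0" k] by simp
qed

lemma poly_space_continuous:
  assumes "f \<in> poly_space S k"
  shows "continuous_on S (\<lambda>y. f (Some y))"
proof -
  from assms obtain c where "\<forall>x\<in>S. f (Some x) = poly_eval k c x"
    by (auto simp: poly_space_def)
  moreover have "continuous_on S (poly_eval k c)"
    unfolding poly_eval_def by (intro continuous_intros)
  ultimately show ?thesis by (metis continuous_on_cong)
qed

lemma space_state_algebra [simp]: "space (state_algebra S) = states S"
  and sets_state_algebra: "sets (state_algebra S) =
    sigma_sets (states S) (insert {None} ((`) Some ` sets (restrict_space borel S)))"
proof -
  have "insert {None} ((`) Some ` sets (restrict_space borel S)) \<subseteq> Pow (states S)"
    using sets.sets_into_space[of _ "restrict_space borel S"]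
    by (auto simp: states_def space_restrict_space)
  then show "space (state_algebra S) = states S"
    "sets (state_algebra S) = sigma_sets (states S) (insert {None} ((`) Some ` sets (restrict_space borel S)))"
    unfolding state_algebra_def by (auto simp: space_measure_of sets_measure_of)
qed

lemma cemetery_sets [measurable]: "{None} \<in> sets (state_algebra S)"
  by (auto simp: sets_state_algebra)

lemma Some_S_sets [measurable]: "Some ` S \<in> sets (state_algebra S)"
proof -
  have "S \<in> sets (restrict_space borel S)"
    using sets.top[of "restrict_space borel S"] by (simp add: space_restrict_space)
  then show ?thesis by (auto simp: sets_state_algebra)
qed

text \<open>A preimage is the \<open>Some\<close>-image of a Borel subset of S, possibly with the
  cemetery added, and both are generators of the algebra.\<close>

lemma borel_measurable_state_algebraI:
  assumes "(\<lambda>y. f (Some y)) \<in> borel_measurable (restrict_space borel S)"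
  shows "f \<in> borel_measurable (state_algebra S)"
proof (rule measurableI)
  fix A :: "'b set" assume A: "A \<in> sets borel"
  have *: "{y \<in> S. f (Some y) \<in> A} \<in> sets (restrict_space borel S)"
    using measurable_sets[OF assms A] by (simp add: vimage_def Int_def space_restrict_space conj_commute)
  have eq: "f -` A \<inter> space (state_algebra S)
      = Some ` {y \<in> S. f (Some y) \<in> A} \<union> (if f None \<in> A then {None} else {})"
    by (auto simp: states_def)
  have "Some ` {y \<in> S. f (Some y) \<in> A} \<in> sets (state_algebra S)"
    using * unfolding sets_state_algebra by (auto intro: sigma_sets.Basic)
  then show "f -` A \<inter> space (state_algebra S) \<in> sets (state_algebra S)"
    unfolding eq by (intro sets.Un) (auto simp: cemetery_sets)
qed auto

lemma poly_space_borel: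
  assumes "f \<in> poly_space S k"
  shows "f \<in> borel_functions S"
proof -
  have "(\<lambda>y. f (Some y)) \<in> borel_measurable (restrict_space borel S)"
    using poly_space_continuous[OF assms] by (rule borel_measurable_continuous_on_restrict)
  then show ?thesis using poly_spaceD_None[OF assms]
    by (simp add: borel_functions_def borel_measurable_state_algebraI)
qed

section \<open>Growth of polynomials and the weight function\<close>

text \<open>The lower bound 1 makes powers increase with the exponent, so that one power dominates
  all monomials of lower degree.\<close>

definition radius :: "real^'n \<Rightarrow> real" where
  "radius y = max 1 (infnorm y)"

lemma radius_ge_1: "1 \<le> radius y" by (simp add: radius_def)

lemma component_le_radius: "\<bar>y $ i\<bar> \<le> radius y"
  unfolding radius_def using component_le_infnorm_cart[of y i] by simp

lemma radius_pow_mono: "j \<le> k \<Longrightarrow> radius y ^ j \<le> radius y ^ k"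
  by (intro power_increasing radius_ge_1)

lemma monom_le_radius:
  assumes "(\<Sum>i\<in>UNIV. \<alpha> i) \<le> k"
  shows "\<bar>\<Prod>i\<in>UNIV. (y $ i) ^ \<alpha> i\<bar> \<le> radius y ^ k"
proof -
  have "\<bar>\<Prod>i\<in>UNIV. (y $ i) ^ \<alpha> i\<bar> = (\<Prod>i\<in>UNIV. \<bar>y $ i\<bar> ^ \<alpha> i)"
    by (simp add: abs_prod power_abs)
  also have "\<dots> \<le> (\<Prod>i\<in>UNIV. radius y ^ \<alpha> i)"
    by (intro prod_mono conjI power_mono component_le_radius) auto
  also have "\<dots> = radius y ^ (\<Sum>i\<in>UNIV. \<alpha> i)"
    by (simp add: power_sum)
  also have "\<dots> \<le> radius y ^ k" by (intro radius_pow_mono assms)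
  finally show ?thesis .
qed

lemma poly_space_growth:
  assumes "f \<in> poly_space S k"
  shows "\<exists>C\<ge>0. \<forall>y\<in>S. \<bar>f (Some y)\<bar> \<le> C * radius y ^ k"
proof -
  from assms obtain c where c: "\<forall>x\<in>S. f (Some x) = poly_eval k c x"
    by (auto simp: poly_space_def)
  let ?C = "\<Sum>\<alpha> | (\<Sum>i\<in>UNIV. \<alpha> i) \<le> k. \<bar>c \<alpha>\<bar>"
  have "\<bar>poly_eval k c y\<bar> \<le> ?C * radius y ^ k" for y
    unfolding poly_eval_def sum_distrib_right
    by (rule sum_abs[THEN order_trans], intro sum_mono)
      (auto simp: abs_mult intro!: mult_left_mono monom_le_radius)
  then show ?thesis using c by (intro exI[of _ ?C]) (auto intro: sum_nonneg)
qed

text \<open>For even \<open>m\<close> this element of \<open>poly_space S m\<close> dominates all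
  others up to a constant. Being a polynomial itself, it can be inserted into the semigroup and the
  generator.\<close>

definition power_weight :: "nat \<Rightarrow> 'n::finite state \<Rightarrow> real" where
  "power_weight m = case_option 0 (\<lambda>y. 1 + (\<Sum>i\<in>UNIV. (y $ i) ^ m))"

lemma power_weight_simps [simp]:
  "power_weight m None = 0" "power_weight m (Some y) = 1 + (\<Sum>i\<in>UNIV. (y $ i) ^ m)"
  by (auto simp: power_weight_def)

lemma power_weight_sum: "power_weight m x = (\<Sum>j\<in>UNIV. coord_power m j x)"
  by (cases x) (auto simp: coord_power_def UNIV_option_conv sum.reindex)

lemma power_weight_in_poly_space: "power_weight m \<in> poly_space S m"
proof -
  have "(\<lambda>x. \<Sum>j\<in>UNIV. 1 * coord_power m j x) \<in> poly_space S m"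
    by (intro poly_space_sum coord_power_in_poly_space)
  then show ?thesis by (rule poly_space_cong) (simp add: power_weight_sum)
qed

lemma coord_power_square: "(coord_power k j x)\<^sup>2 = coord_power (2 * k) j x"
  by (simp add: coord_power_def power_mult[symmetric] mult.commute split: option.split)

lemma power_weight_squares: "power_weight (2 * k) x = (\<Sum>j\<in>UNIV. (coord_power k j x)\<^sup>2)"
  by (simp add: power_weight_sum coord_power_square)

lemma power_weight_ge_1: "even m \<Longrightarrow> 1 \<le> power_weight m (Some y)"
  by (simp add: sum_nonneg zero_le_power_eq)

lemma power_weight_nonneg: "even m \<Longrightarrow> 0 \<le> power_weight m x"
  by (cases x) (auto simp: zero_le_power_eq intro!: add_nonneg_nonneg sum_nonneg)

text \<open>The maximum norm is attained at a coordinate, whose even power is one of the summands;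
  the summand 1 covers the unit ball.\<close>

lemma radius_pow_le_power_weight:
  assumes "even m"
  shows "radius (y :: real^'n) ^ m \<le> power_weight m (Some y)"
proof (cases "infnorm y \<le> 1")
  case True
  then show ?thesis using power_weight_ge_1[OF assms, of y] by (simp add: radius_def)
next
  case False
  obtain i where i: "infnorm y = \<bar>y $ i\<bar>"
  proof -
    have "{\<bar>y $ i\<bar> |i. i \<in> UNIV} = range (\<lambda>i. \<bar>y $ i\<bar>)" by auto
    then have "infnorm y = Max (range (\<lambda>i. \<bar>y $ i\<bar>))"
      by (simp add: infnorm_cart cSup_eq_Max)
    moreover have "Max (range (\<lambda>i. \<bar>y $ i\<bar>)) \<in> range (\<lambda>i. \<bar>y $ i\<bar>)" by (rule Max_in) auto
    ultimately show ?thesis using that by (metis (no_types, lifting) imageE)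
  qed
  have "radius y ^ m = (y $ i) ^ m"
    using False i assms by (simp add: radius_def power_even_abs)
  also have "\<dots> \<le> (\<Sum>i\<in>UNIV. (y $ i) ^ m)"
    using assms by (intro member_le_sum) (auto simp: zero_le_power_eq)
  finally show ?thesis by simp
qed

lemma poly_space_le_power_weight:
  assumes "f \<in> poly_space S k" "k \<le> m" "even m"
  shows "\<exists>C\<ge>0. \<forall>x\<in>states S. \<bar>f x\<bar> \<le> C * power_weight m x"
proof -
  obtain C where C: "C \<ge> 0" "\<forall>y\<in>S. \<bar>f (Some y)\<bar> \<le> C * radius y ^ k"
    using poly_space_growth[OF assms(1)] by blast
  have "\<bar>f x\<bar> \<le> C * power_weight m x" if x: "x \<in> states S" for x
  proof (cases x)
    case None then show ?thesis using poly_spaceD_None[OF assms(1)] by simp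
  next
    case (Some y)
    then have "y \<in> S" using x by (auto simp: states_def)
    then have "\<bar>f x\<bar> \<le> C * radius y ^ k" using C Some by auto
    also have "\<dots> \<le> C * power_weight m x"
      unfolding Some by (intro mult_left_mono C order_trans[OF radius_pow_mono[OF assms(2)]]
          radius_pow_le_power_weight assms)
    finally show ?thesis .
  qed
  then show ?thesis using C by blast
qed

text \<open>Used with k at most half of \<open>m\<close>: moments of \<open>\<phi>\<close> then
  control second moments, the source of uniform integrability and of the Jensen estimates.\<close>

lemma poly_space_square_le_power_weight:
  assumes "f \<in> poly_space S k" "2 * k \<le> m" "even m"
  shows "\<exists>C\<ge>0. \<forall>x\<in>states S. (f x)\<^sup>2 \<le> C * power_weight m x"
proof -
  obtain C where C: "C \<ge> 0" "\<forall>y\<in>S. \<bar>f (Some y)\<bar> \<le> C * radius y ^ k"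
    using poly_space_growth[OF assms(1)] by blast
  have "(f x)\<^sup>2 \<le> C\<^sup>2 * power_weight m x" if x: "x \<in> states S" for x
  proof (cases x)
    case None then show ?thesis using poly_spaceD_None[OF assms(1)] by simp
  next
    case (Some y)
    then have "y \<in> S" using x by (auto simp: states_def)
    then have "\<bar>f x\<bar> \<le> \<bar>C * radius y ^ k\<bar>" using C Some by auto
    then have "(f x)\<^sup>2 \<le> (C * radius y ^ k)\<^sup>2" by (simp add: abs_le_square_iff)
    also have "\<dots> = C\<^sup>2 * radius y ^ (2 * k)" by (simp add: power_mult_distrib mult.commute flip: power_mult)
    also have "\<dots> \<le> C\<^sup>2 * power_weight m x"
      unfolding Some by (intro mult_left_mono order_trans[OF radius_pow_mono[OF assms(2)]]
          radius_pow_le_power_weight assms) auto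
    finally show ?thesis .
  qed
  then show ?thesis by (intro exI[of _ "C\<^sup>2"]) auto
qed

section \<open>Paths, laws and the Markov property\<close>

text \<open>Open subsets of S stay open in the compactification, so near a point of S convergence is
  the usual one and continuity on S suffices.\<close>

lemma limitin_state_top_Some:
  assumes lim: "limitin (state_top S) w (Some y) Fl" and f: "continuous_on S (\<lambda>y. f (Some y))"
  shows "((\<lambda>s. f (w s) :: real) \<longlongrightarrow> f (Some y)) Fl"
proof (rule topological_tendstoI)
  fix U :: "real set" assume U: "open U" "f (Some y) \<in> U"
  have yS: "y \<in> S" using lim by (auto simp: limitin_def state_top_def)
  define V where "V = S \<inter> (\<lambda>y. f (Some y)) -` U"
  have "openin (top_of_set S) V"
    unfolding V_def using f U(1) by (rule continuous_openin_preimage_gen)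
  then have "openin (state_top S) (Some ` V)" by (simp add: state_top_def)
  moreover have "Some y \<in> Some ` V" using yS U by (auto simp: V_def)
  ultimately have "eventually (\<lambda>s. w s \<in> Some ` V) Fl"
    using lim by (simp add: limitin_def)
  then show "eventually (\<lambda>s. f (w s) \<in> U) Fl"
    by eventually_elim (auto simp: V_def)
qed

lemma path_in_states: "\<omega> \<in> path_space S \<Longrightarrow> 0 \<le> t \<Longrightarrow> \<omega> t \<in> states S"
  by (auto simp: path_space_def PiE_def)

lemma path_absorbed: "\<omega> \<in> path_space S \<Longrightarrow> 0 \<le> t \<Longrightarrow> \<omega> t = None \<Longrightarrow> t \<le> s \<Longrightarrow> \<omega> s = None"
  by (auto simp: path_space_def)

text \<open>A polynomial need not be continuous at \<open>None\<close> in
  \<open>state_top S\<close>. Right continuity at the cemetery comes from absorption: the path is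
  constant from there on.\<close>

lemma path_right_continuous:
  assumes w: "\<omega> \<in> path_space S" and t: "0 \<le> t" and f: "f \<in> poly_space S k"
  shows "((\<lambda>s. f (\<omega> s)) \<longlongrightarrow> f (\<omega> t)) (at_right t)"
proof (cases "\<omega> t")
  case None
  have "eventually (\<lambda>s. f (\<omega> s) = 0) (at_right t)"
    using eventually_at_right_less[of t]
    by eventually_elim (use path_absorbed[OF w t None] poly_spaceD_None[OF f] in auto)
  then show ?thesis using None poly_spaceD_None[OF f] by (simp add: tendsto_eventually)
next
  case (Some y)
  have "limitin (state_top S) \<omega> (Some y) (at_right t)"
    using w t Some by (auto simp: path_space_def cadlag_def)
  then show ?thesis unfolding Some by (rule limitin_state_top_Some) (rule poly_space_continuous[OF f])
qed

text \<open>Makes the complement of a sublevel set a neighbourhood of \<open>None\<close>. Sublevel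
  sets are bounded because a positive even power dominates the radius.\<close>

lemma compact_power_weight_sublevel:
  fixes S :: "(real^'n) set"
  assumes "closed S" "even m" "m > 0"
  shows "compact {y\<in>S. power_weight m (Some y) \<le> c}"
proof -
  have "continuous_on S (\<lambda>y. power_weight m (Some y))"
    by (rule poly_space_continuous[OF power_weight_in_poly_space])
  then have "closed (S \<inter> (\<lambda>y. power_weight m (Some y)) -` {..c})"
    by (rule continuous_closed_preimage) (auto simp: assms)
  moreover have "S \<inter> (\<lambda>y. power_weight m (Some y)) -` {..c} = {y\<in>S. power_weight m (Some y) \<le> c}"
    by auto
  ultimately have "closed {y\<in>S. power_weight m (Some y) \<le> c}" by metis
  moreover have "norm y \<le> real CARD('n) * c" if "power_weight m (Some y) \<le> c" for y :: "real^'n"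
  proof -
    have "radius y \<le> radius y ^ m"
      using radius_pow_mono[of 1 m y] assms by simp
    also have "\<dots> \<le> c" using radius_pow_le_power_weight[OF assms(2), of y] that by linarith
    finally have r: "radius y \<le> c" .
    have "norm y \<le> (\<Sum>i\<in>UNIV. \<bar>y $ i\<bar>)" by (rule norm_le_l1_cart)
    also have "\<dots> \<le> (\<Sum>i\<in>(UNIV :: 'n set). c)"
      using component_le_radius[of y] r by (intro sum_mono) (meson order_trans)
    finally show ?thesis by simp
  qed
  then have "bounded {y\<in>S. power_weight m (Some y) \<le> c}" unfolding bounded_iff by blast
  ultimately show ?thesis using compact_eq_bounded_closed by blast
qed

text \<open>A left limit in S is harmless. If the left limit is \<open>None\<close> and
  \<open>\<phi>\<close> stays bounded before t, the path cannot have come from infinity, hence was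
  absorbed strictly before t and f vanishes along it.\<close>

lemma path_left_limit:
  assumes S: "closed S" and w: "\<omega> \<in> path_space S" and t: "0 < t" and f: "f \<in> poly_space S k"
    and m: "even m" "m > 0" and b: "\<And>s. 0 \<le> s \<Longrightarrow> s < t \<Longrightarrow> power_weight m (\<omega> s) \<le> c"
  shows "\<exists>l. ((\<lambda>s. f (\<omega> s)) \<longlongrightarrow> l) (at_left t)"
proof -
  obtain l where l: "limitin (state_top S) \<omega> l (at_left t)"
    using w t by (auto simp: path_space_def cadlag_def)
  show ?thesis
  proof (cases l)
    case (Some y)
    show ?thesis
      using limitin_state_top_Some[OF l[unfolded Some], of f] poly_space_continuous[OF f] by blast
  next
    case None
    let ?K = "{y\<in>S. power_weight m (Some y) \<le> c}"
    have K: "compact ?K" by (rule compact_power_weight_sublevel[OF S m])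
    then have "closedin (top_of_set S) ?K"
      by (intro closed_subset compact_imp_closed) auto
    then have "openin (state_top S) (insert None (Some ` (S - ?K)))"
      using K unfolding state_top_def openin_Alexandroff_compactification
      by (intro disjI2 exI[of _ ?K]) (auto simp: compactin_subtopology)
    then have "eventually (\<lambda>s. \<omega> s \<in> insert None (Some ` (S - ?K))) (at_left t)"
      using l None unfolding limitin_def by blast
    moreover have pos: "eventually (\<lambda>s. s \<in> {0<..<t}) (at_left t)"
      using eventually_at_left_real[OF t] .
    \<comment> \<open>Near t the path lies outside the sublevel set, while \<open>\<phi>\<close> is
      at most c before t; only the cemetery itself is left.\<close>
    ultimately have "eventually (\<lambda>s. \<omega> s = None \<and> s \<in> {0<..<t}) (at_left t)"
    proof eventually_elim
      case (elim s)
      then have "power_weight m (\<omega> s) \<le> c" using b by auto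
      then show ?case using elim by auto
    qed
    then obtain s where s: "\<omega> s = None" "s \<in> {0<..<t}"
      using eventually_happens'[OF trivial_limit_at_left_real] by blast
    have "s < t" using s by auto
    have "eventually (\<lambda>r. f (\<omega> r) = 0) (at_left t)"
      using eventually_at_left_real[OF \<open>s < t\<close>]
    proof eventually_elim
      case (elim r)
      then show ?case using path_absorbed[OF w _ s(1), of r] s poly_spaceD_None[OF f] by auto
    qed
    then show ?thesis by (blast intro: tendsto_eventually)
  qed
qed

lemma borel_functionsD: "f \<in> borel_functions S \<Longrightarrow> f \<in> borel_measurable (state_algebra S)"
  "f \<in> borel_functions S \<Longrightarrow> f None = 0"
  by (auto simp: borel_functions_def)

section \<open>Measurability in time and path\<close>

context markov_process
begin

lemma None_in_states [simp]: "None \<in> states S" and Some_in_states [simp]: "Some y \<in> states S \<longleftrightarrow> y \<in> S"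
  by (auto simp: states_def)

lemma sets_F_subset: "x \<in> states S \<Longrightarrow> 0 \<le> t \<Longrightarrow> A \<in> sets (F t) \<Longrightarrow> A \<in> sets (P x)"
  by (auto simp: sets_P)

lemma subalgebra_F: "x \<in> states S \<Longrightarrow> 0 \<le> t \<Longrightarrow> subalgebra (P x) (F t)"
  using sets_F_subset by (auto simp: subalgebra_def space_P space_F)

lemma measurable_F_P: "x \<in> states S \<Longrightarrow> 0 \<le> t \<Longrightarrow> f \<in> F t \<rightarrow>\<^sub>M N \<Longrightarrow> f \<in> P x \<rightarrow>\<^sub>M N"
  by (rule measurable_from_subalg[OF subalgebra_F])

lemma coordinate_measurable [measurable]:
  "x \<in> states S \<Longrightarrow> 0 \<le> t \<Longrightarrow> (\<lambda>\<omega>. \<omega> t) \<in> P x \<rightarrow>\<^sub>M state_algebra S"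
  by (rule measurable_F_P[OF _ _ adapted]) auto

lemma observable_measurable_F:
  "f \<in> borel_functions S \<Longrightarrow> 0 \<le> s \<Longrightarrow> s \<le> t \<Longrightarrow> (\<lambda>\<omega>. f (\<omega> s)) \<in> borel_measurable (F t)"
  by (rule measurable_compose[OF adapted borel_functionsD(1)])

lemma observable_measurable:
  "f \<in> borel_functions S \<Longrightarrow> x \<in> states S \<Longrightarrow> 0 \<le> t \<Longrightarrow> (\<lambda>\<omega>. f (\<omega> t)) \<in> borel_measurable (P x)"
  by (rule measurable_compose[OF coordinate_measurable borel_functionsD(1)])

lemma cond_exp_locale: "x \<in> states S \<Longrightarrow> 0 \<le> t \<Longrightarrow> sigma_finite_subalgebra (P x) (F t)"
  using prob subalgebra_F
  by (intro finite_measure_subalgebra_is_sigma_finite)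
    (auto simp: finite_measure_subalgebra_def finite_measure_subalgebra_axioms_def prob_space_def)

text \<open>An adapted right continuous process is progressively measurable. Clamping time to
  \<open>{0..t}\<close> expresses this as measurability on the product with all of
  \<open>borel\<close>, where negative times would carry no information.\<close>

lemma progressively_measurable:
  assumes f: "f \<in> poly_space S k" and t: "0 \<le> t"
  shows "(\<lambda>(s, \<omega>). f (\<omega> (min t (max 0 s)))) \<in> borel_measurable (borel \<Otimes>\<^sub>M F t)"
proof -
  \<comment> \<open>Time is rounded to a grid point strictly to its right: the \<open>+ 1\<close>
    gives convergence along \<open>at_right\<close>, where paths are continuous, and
    \<open>min t\<close> keeps every evaluation in \<open>F t\<close>.\<close>
  define r :: "nat \<Rightarrow> real \<Rightarrow> real" where
    "r n s = min t ((of_int \<lfloor>real (Suc n) * max 0 s\<rfloor> + 1) / real (Suc n))" for n s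
  have meas: "(\<lambda>(s, \<omega>). f (\<omega> (r n s))) \<in> borel_measurable (borel \<Otimes>\<^sub>M F t)" for n
  proof -
    have *: "(\<lambda>x. f (snd x (min t ((of_int i + 1) / real (Suc n))))) \<in> borel_measurable (borel \<Otimes>\<^sub>M F t)"
      if "i \<ge> 0" for i :: int
      using that t
      by (intro measurable_compose[OF measurable_snd observable_measurable_F[OF poly_space_borel[OF f]]]) auto
    \<comment> \<open>Composition over a countable index asks for measurability at every integer,
      hence \<open>max 0 i\<close>.\<close>
    have "(\<lambda>x. f (snd x (min t ((of_int (max 0 i) + 1) / real (Suc n))))) \<in> borel_measurable (borel \<Otimes>\<^sub>M F t)"
      for i :: int by (rule *) simp
    moreover have "(\<lambda>x. \<lfloor>real (Suc n) * max 0 (fst x)\<rfloor>) \<in> borel \<Otimes>\<^sub>M F t \<rightarrow>\<^sub>M count_space UNIV"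
      by measurable
    ultimately have "(\<lambda>x. f (snd x (min t ((of_int (max 0 \<lfloor>real (Suc n) * max 0 (fst x)\<rfloor>) + 1) / real (Suc n)))))
        \<in> borel_measurable (borel \<Otimes>\<^sub>M F t)"
      by (rule measurable_compose_countable)
    then show ?thesis by (simp add: r_def case_prod_unfold)
  qed
  show ?thesis
  proof (rule borel_measurable_LIMSEQ_real[OF _ meas])
    fix x :: "real \<times> 'n path" assume "x \<in> space (borel \<Otimes>\<^sub>M F t)"
    then obtain s \<omega> where x: "x = (s, \<omega>)" and w: "\<omega> \<in> path_space S"
      by (auto simp: space_pair_measure space_F)
    let ?s = "max 0 s"
    have "(\<lambda>n. f (\<omega> (r n s))) \<longlonglongrightarrow> f (\<omega> (min t ?s))"
    proof (cases "t \<le> ?s")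
      case True
      have "r n s = t" for n
      proof -
        have "real (Suc n) * ?s \<le> of_int \<lfloor>real (Suc n) * ?s\<rfloor> + 1" by linarith
        then have "?s \<le> (of_int \<lfloor>real (Suc n) * ?s\<rfloor> + 1) / real (Suc n)"
          by (subst pos_le_divide_eq) (simp_all only: mult.commute of_nat_0_less_iff zero_less_Suc)
        with True have "t \<le> (of_int \<lfloor>real (Suc n) * ?s\<rfloor> + 1) / real (Suc n)" by (rule order_trans)
        then show ?thesis by (simp only: r_def min_absorb1)
      qed
      then show ?thesis using True by (simp add: min_absorb1)
    next
      case False
      have lo: "?s < r n s" for n
      proof -
        have "real (Suc n) * ?s < of_int \<lfloor>real (Suc n) * ?s\<rfloor> + 1" by linarith
        then have "?s < (of_int \<lfloor>real (Suc n) * ?s\<rfloor> + 1) / real (Suc n)"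
          by (subst pos_less_divide_eq) (simp_all only: mult.commute of_nat_0_less_iff zero_less_Suc)
        then show ?thesis using False by (simp only: r_def min_less_iff_conj not_le simp_thms)
      qed
      have hi: "r n s \<le> ?s + 1 / real (Suc n)" for n
      proof -
        have "(of_int \<lfloor>real (Suc n) * ?s\<rfloor> + 1) / real (Suc n) \<le> (real (Suc n) * ?s + 1) / real (Suc n)"
          by (intro divide_right_mono add_mono) auto
        also have "\<dots> = ?s + 1 / real (Suc n)" by (simp add: field_simps)
        finally show ?thesis unfolding r_def by (rule min.coboundedI2)
      qed
      have "(\<lambda>n. r n s) \<longlonglongrightarrow> ?s"
      proof (rule tendsto_sandwich)
        show "eventually (\<lambda>n. ?s \<le> r n s) sequentially" using lo by (auto intro!: always_eventually less_imp_le)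
        show "eventually (\<lambda>n. r n s \<le> ?s + 1 / real (Suc n)) sequentially" using hi by auto
        show "(\<lambda>n. ?s + 1 / real (Suc n)) \<longlonglongrightarrow> ?s"
          using tendsto_add[OF tendsto_const LIMSEQ_inverse_real_of_nat] by (simp add: inverse_eq_divide)
      qed simp
      then have "filterlim (\<lambda>n. r n s) (at_right ?s) sequentially"
        unfolding filterlim_at using lo less_imp_neq[OF lo, symmetric] by (auto intro!: always_eventually)
      then have "(\<lambda>n. f (\<omega> (r n s))) \<longlonglongrightarrow> f (\<omega> ?s)"
        using filterlim_compose[OF path_right_continuous[OF w max.cobounded1 f]] by blast
      moreover have "min t ?s = ?s" using False by linarith
      ultimately show ?thesis by simp
    qed
    then show "(\<lambda>n. case x of (s, \<omega>) \<Rightarrow> f (\<omega> (r n s)))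
        \<longlonglongrightarrow> (case x of (s, \<omega>) \<Rightarrow> f (\<omega> (min t (max 0 s))))"
      by (simp add: x)
  qed
qed

lemma measurable_pair_F_P:
  assumes x: "x \<in> states S" and t: "0 \<le> t" and h: "h \<in> borel \<Otimes>\<^sub>M F t \<rightarrow>\<^sub>M N"
  shows "h \<in> borel \<Otimes>\<^sub>M P x \<rightarrow>\<^sub>M N"
proof -
  have "(\<lambda>z. (fst z, snd z)) \<in> borel \<Otimes>\<^sub>M P x \<rightarrow>\<^sub>M borel \<Otimes>\<^sub>M F t"
    by (intro measurable_Pair measurable_fst measurable_compose[OF measurable_snd]
        measurable_F_P[OF x t]) auto
  from measurable_compose[OF this h] show ?thesis by simp
qed

lemma jointly_measurable:
  assumes f: "f \<in> poly_space S k" and t: "0 \<le> t" and x: "x \<in> states S"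
  shows "(\<lambda>(s, \<omega>). f (\<omega> (min t (max 0 s)))) \<in> borel_measurable (borel \<Otimes>\<^sub>M P x)"
  by (rule measurable_pair_F_P[OF x t progressively_measurable[OF f t]])

section \<open>Transition laws and the Markov property\<close>

lemma start_None: "AE \<omega> in P None. \<forall>t\<ge>0. \<omega> t = None"
  using start[OF None_in_states] AE_space
proof eventually_elim
  case (elim \<omega>)
  then have "\<omega> \<in> path_space S" by (simp add: space_P)
  then show ?case using path_absorbed[of \<omega> S 0] elim by auto
qed

text \<open>The Markov property is available only for functions vanishing at the cemetery, so test
  sets have \<open>None\<close> removed.\<close>

lemma indicator_borel_function:
  assumes "A \<in> sets (state_algebra S)"
  shows "indicator (A - {None}) \<in> borel_functions S"
proof -
  have "A - {None} \<in> sets (state_algebra S)" using assms cemetery_sets by (rule sets.Diff)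
  then show ?thesis by (auto simp: borel_functions_def)
qed

lemma sets_p [measurable_cong]: "x \<in> states S \<Longrightarrow> 0 \<le> t \<Longrightarrow> sets (p t x) = sets (state_algebra S)"
  using measurable_space[OF kernel, of t x] by (intro sets_kernel[OF kernel]) auto

lemma space_p: "x \<in> states S \<Longrightarrow> 0 \<le> t \<Longrightarrow> space (p t x) = states S"
  using sets_eq_imp_space_eq[OF sets_p] by auto

lemma subprob_p: "x \<in> states S \<Longrightarrow> 0 \<le> t \<Longrightarrow> subprob_space (p t x)"
  using measurable_space[OF kernel, of t x] by (auto simp: space_subprob_algebra)

text \<open>\<open>killing\<close> speaks of starting points in S. At the cemetery, the
  subprobability bound leaves no mass for S once \<open>{None}\<close> has mass 1.\<close>

lemma p_total_mass:
  assumes x: "x \<in> states S" and t: "0 \<le> t"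
  shows "emeasure (p t x) {None} = 1 - emeasure (p t x) (Some ` S)"
proof (cases x)
  case (Some y) then show ?thesis using killing[OF t] x by auto
next
  case None
  interpret subprob_space "p t None" using subprob_p[OF None_in_states t] .
  have "emeasure (p t None) {None} + emeasure (p t None) (Some ` S) = emeasure (p t None) ({None} \<union> Some ` S)"
    using sets_p[OF None_in_states t] cemetery_sets Some_S_sets by (intro plus_emeasure) auto
  also have "\<dots> \<le> 1"
    using emeasure_space_le_1 emeasure_space[of "p t None"] order_trans by blast
  finally have "1 + emeasure (p t None) (Some ` S) \<le> 1 + 0" using absorbing[OF t] by simp
  then have "emeasure (p t None) (Some ` S) = 0"
    unfolding ennreal_add_left_cancel_le by auto
  then show ?thesis using absorbing[OF t] None by simp
qed

lemma semigroup_op_integral: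
  assumes x: "x \<in> states S" and t: "0 \<le> t" and f: "f None = 0"
  shows "semigroup_op S p t f x = integral\<^sup>L (p t x) f"
  unfolding semigroup_op_def set_lebesgue_integral_def
proof (intro Bochner_Integration.integral_cong refl)
  fix z assume "z \<in> space (p t x)"
  then show "indicator (Some ` S) z *\<^sub>R f z = f z"
    using f by (auto simp: space_p[OF x t] states_def)
qed

text \<open>The Markov property at time 0, where the starting point is almost surely x, identifies
  both measures on sets that avoid \<open>None\<close>. The mass of the cemetery is then the
  complement to 1 on either side.\<close>

lemma law_eq_transition:
  assumes x: "x \<in> states S" and t: "0 \<le> t"
  shows "distr (P x) (state_algebra S) (\<lambda>\<omega>. \<omega> t) = p t x"
proof (rule measure_eqI)
  interpret prob_space "P x" using prob[OF x] .
  interpret px: subprob_space "p t x" using subprob_p[OF x t] .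
  interpret c: sigma_finite_subalgebra "P x" "F 0" using cond_exp_locale[OF x] by simp
  have X [measurable]: "(\<lambda>\<omega>. \<omega> t) \<in> P x \<rightarrow>\<^sub>M state_algebra S" using coordinate_measurable[OF x t] .
  let ?D = "distr (P x) (state_algebra S) (\<lambda>\<omega>. \<omega> t)"
  interpret D: prob_space ?D by (rule prob_space_distr) simp
  show "sets ?D = sets (p t x)" using sets_p[OF x t] by simp
  have alive: "emeasure ?D (A - {None}) = emeasure (p t x) (A - {None})"
    if A: "A \<in> sets (state_algebra S)" for A
  proof -
    let ?B = "A - {None}" and ?f = "indicator (A - {None}) :: 'n state \<Rightarrow> real"
    have B: "?B \<in> sets (state_algebra S)" using A cemetery_sets by (rule sets.Diff)
    have f: "?f \<in> borel_functions S" by (rule indicator_borel_function[OF A])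
    have int: "integrable (P z) (\<lambda>\<omega>. ?f (\<omega> u))" if "u \<ge> 0" "z \<in> states S" for u z
    proof -
      interpret z: prob_space "P z" using prob that by auto
      show ?thesis
        by (rule z.integrable_const_bound[where B = 1])
          (use observable_measurable[OF f that(2,1)] in \<open>auto intro!: AE_I2 simp: indicator_def\<close>)
    qed
    have "AE \<omega> in P x. real_cond_exp (P x) (F 0) (\<lambda>\<omega>. ?f (\<omega> (t + 0))) \<omega> = semigroup_op S p t ?f (\<omega> 0)"
      using int by (intro markov x t f) auto
    then have "AE \<omega> in P x. real_cond_exp (P x) (F 0) (\<lambda>\<omega>. ?f (\<omega> t)) \<omega> = semigroup_op S p t ?f x"
      using start[OF x] by eventually_elim simp
    then have "integral\<^sup>L (P x) (real_cond_exp (P x) (F 0) (\<lambda>\<omega>. ?f (\<omega> t))) = semigroup_op S p t ?f x"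
      by (subst integral_cong_AE[where g = "\<lambda>_. semigroup_op S p t ?f x"]) (auto simp: prob_space)
    then have "(\<integral>\<omega>. ?f (\<omega> t) \<partial>P x) = integral\<^sup>L (p t x) ?f"
      using c.real_cond_exp_int(2)[OF int[OF t x]] semigroup_op_integral[OF x t, of ?f] by simp
    moreover have "(\<integral>\<omega>. ?f (\<omega> t) \<partial>P x) = integral\<^sup>L ?D ?f"
      by (intro integral_distr[symmetric] X) (use B in auto)
    ultimately have "measure ?D ?B = measure (p t x) ?B"
      using B sets.sets_into_space[OF B] by (simp add: space_p[OF x t] Int_absorb2 sets_p[OF x t])
    then show ?thesis
      by (simp add: D.emeasure_eq_measure px.emeasure_eq_measure)
  qed
  have states: "states S - {None} = Some ` S" by (auto simp: states_def)
  have "emeasure ?D {None} = emeasure ?D (space ?D - Some ` S)"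
    by (rule arg_cong[where f = "emeasure ?D"]) (auto simp: states_def)
  also have "\<dots> = 1 - emeasure ?D (Some ` S)"
    using Some_S_sets D.emeasure_space_1 by (subst emeasure_compl) (simp_all del: space_distr)
  also have "\<dots> = emeasure (p t x) {None}"
    using alive[OF sets.top[of "state_algebra S"]] states p_total_mass[OF x t] by simp
  finally have dead: "emeasure ?D {None} = emeasure (p t x) {None}" .
  fix A assume "A \<in> sets ?D"
  then have A: "A \<in> sets (state_algebra S)" by simp
  have B: "A - {None} \<in> sets (state_algebra S)" using A cemetery_sets by (rule sets.Diff)
  show "emeasure ?D A = emeasure (p t x) A"
  proof (cases "None \<in> A")
    case False then show ?thesis using alive[OF A] by simp
  next
    case True
    then have eq: "A = (A - {None}) \<union> {None}" by auto
    have "emeasure ?D A = emeasure ?D (A - {None}) + emeasure ?D {None}"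
      by (subst eq, intro plus_emeasure[symmetric]) (use B cemetery_sets in auto)
    also have "\<dots> = emeasure (p t x) (A - {None}) + emeasure (p t x) {None}"
      using alive[OF A] dead by simp
    also have "\<dots> = emeasure (p t x) A"
      by (subst (2) eq, intro plus_emeasure) (use B cemetery_sets sets_p[OF x t] in auto)
    finally show ?thesis .
  qed
qed

lemma semigroup_op_expectation:
  assumes x: "x \<in> states S" and t: "0 \<le> t" and f: "f \<in> borel_functions S"
  shows "semigroup_op S p t f x = (\<integral>\<omega>. f (\<omega> t) \<partial>P x)"
  unfolding semigroup_op_integral[of x t f, OF x t borel_functionsD(2)[OF f]] law_eq_transition[OF x t, symmetric]
  by (rule integral_distr[OF coordinate_measurable[OF x t] borel_functionsD(1)[OF f]])

lemma nn_integral_kernel: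
  assumes x: "x \<in> states S" and t: "0 \<le> t" and f: "f \<in> borel_functions S"
  shows "(\<integral>\<^sup>+\<xi>\<in>Some ` S. ennreal \<bar>f \<xi>\<bar> \<partial>p t x) = (\<integral>\<^sup>+\<omega>. ennreal \<bar>f (\<omega> t)\<bar> \<partial>P x)"
proof -
  have "(\<integral>\<^sup>+\<xi>\<in>Some ` S. ennreal \<bar>f \<xi>\<bar> \<partial>p t x) = (\<integral>\<^sup>+\<xi>. ennreal \<bar>f \<xi>\<bar> \<partial>p t x)"
    using borel_functionsD(2)[OF f]
    by (intro nn_integral_cong) (auto simp: space_p[OF x t] states_def)
  also have "\<dots> = (\<integral>\<^sup>+\<omega>. ennreal \<bar>f (\<omega> t)\<bar> \<partial>P x)"
    unfolding law_eq_transition[OF x t, symmetric]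
    using borel_functionsD(1)[OF f]
    by (intro nn_integral_distr[OF coordinate_measurable[OF x t]]) measurable
  finally show ?thesis .
qed

lemma semigroup_op_borel:
  assumes f: "f \<in> borel_functions S" and t: "0 \<le> t"
  shows "semigroup_op S p t f \<in> borel_functions S"
proof -
  have "(\<lambda>x. integral\<^sup>L (p t x) f) \<in> borel_measurable (state_algebra S)"
    using measurable_compose[OF kernel[OF t] integral_measurable_subprob_algebra[OF borel_functionsD(1)[OF f]]] .
  then have "semigroup_op S p t f \<in> borel_measurable (state_algebra S)"
    by (subst measurable_cong[where g = "\<lambda>x. integral\<^sup>L (p t x) f"])
      (auto intro!: semigroup_op_integral t borel_functionsD(2)[OF f])
  moreover have "(\<integral>\<omega>. f (\<omega> t) \<partial>P None) = (\<integral>\<omega>. 0 \<partial>P None)"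
    by (rule integral_cong_AE[OF observable_measurable[OF f None_in_states t] borel_measurable_const])
      (use start_None in \<open>eventually_elim, auto simp: t borel_functionsD(2)[OF f]\<close>)
  ultimately show ?thesis
    using semigroup_op_expectation[OF None_in_states t f] by (auto simp: borel_functions_def)
qed

text \<open>Integrability is asked for every starting point because \<open>markov\<close> demands it
  from all of S, not only from the current x.\<close>

definition moment_function :: "('n state \<Rightarrow> real) \<Rightarrow> bool" where
  "moment_function f \<longleftrightarrow> f \<in> borel_functions S \<and>
     (\<forall>x\<in>states S. \<forall>t\<ge>0. integrable (P x) (\<lambda>\<omega>. f (\<omega> t)))"

text \<open>The Markov property tested on events of \<open>F s\<close>. In this form it is used
  throughout; conditional expectations return only for the final martingale statement.\<close>

lemma markov_integral:
  assumes f: "moment_function f" and x: "x \<in> states S" and s: "0 \<le> s" and t: "0 \<le> t"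
  shows "integrable (P x) (\<lambda>\<omega>. semigroup_op S p t f (\<omega> s))"
    and "A \<in> sets (F s) \<Longrightarrow> (\<integral>\<omega>. indicator A \<omega> * f (\<omega> (s + t)) \<partial>P x)
      = (\<integral>\<omega>. indicator A \<omega> * semigroup_op S p t f (\<omega> s) \<partial>P x)"
proof -
  interpret c: sigma_finite_subalgebra "P x" "F s" using cond_exp_locale[OF x s] .
  have int: "integrable (P x) (\<lambda>\<omega>. f (\<omega> (s + t)))" using f x s t by (auto simp: moment_function_def)
  have fb: "f \<in> borel_functions S" using f by (simp add: moment_function_def)
  have [measurable]: "(\<lambda>\<omega>. semigroup_op S p t f (\<omega> s)) \<in> borel_measurable (P x)"
    by (rule observable_measurable[OF semigroup_op_borel[OF fb t] x s])
  have ae: "AE \<omega> in P x. real_cond_exp (P x) (F s) (\<lambda>\<omega>. f (\<omega> (s + t))) \<omega> = semigroup_op S p t f (\<omega> s)"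
    using markov[OF x s t fb] f by (auto simp: moment_function_def add.commute)
  show "integrable (P x) (\<lambda>\<omega>. semigroup_op S p t f (\<omega> s))"
    by (rule integrable_cong_AE_imp[OF c.real_cond_exp_int(1)[OF int]])
      (use ae in \<open>auto elim!: eventually_mono\<close>)
  assume A: "A \<in> sets (F s)"
  have [measurable]: "A \<in> sets (P x)" using sets_F_subset[OF x s A] .
  have "(\<integral>\<omega>. indicator A \<omega> * f (\<omega> (s + t)) \<partial>P x)
      = (\<integral>\<omega>. indicator A \<omega> * real_cond_exp (P x) (F s) (\<lambda>\<omega>. f (\<omega> (s + t))) \<omega> \<partial>P x)"
    using c.real_cond_exp_intA[OF int A] by (simp add: set_lebesgue_integral_def)
  also have "\<dots> = (\<integral>\<omega>. indicator A \<omega> * semigroup_op S p t f (\<omega> s) \<partial>P x)"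
    by (rule integral_cong_AE) (use ae in \<open>auto elim!: eventually_mono\<close>)
  finally show "(\<integral>\<omega>. indicator A \<omega> * f (\<omega> (s + t)) \<partial>P x)
      = (\<integral>\<omega>. indicator A \<omega> * semigroup_op S p t f (\<omega> s) \<partial>P x)" .
qed

lemma semigroup_op_add:
  assumes f: "moment_function f" and x: "x \<in> states S" and s: "0 \<le> s" and t: "0 \<le> t"
  shows "semigroup_op S p (s + t) f x = semigroup_op S p s (semigroup_op S p t f) x"
proof -
  have fb: "f \<in> borel_functions S" using f by (simp add: moment_function_def)
  have "(\<integral>\<omega>. indicator (path_space S) \<omega> * f (\<omega> (s + t)) \<partial>P x)
      = (\<integral>\<omega>. indicator (path_space S) \<omega> * semigroup_op S p t f (\<omega> s) \<partial>P x)"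
    using sets.top[of "F s"] by (intro markov_integral[OF f x s t]) (simp add: space_F)
  moreover have "(\<integral>\<omega>. indicator (path_space S) \<omega> * h \<omega> \<partial>P x) = integral\<^sup>L (P x) h" for h :: "'n path \<Rightarrow> real"
    by (intro Bochner_Integration.integral_cong) (auto simp: space_P[OF x])
  ultimately show ?thesis
    using semigroup_op_expectation[OF x _ fb, of "s + t"]
      semigroup_op_expectation[OF x s semigroup_op_borel[OF fb t]] s t by simp
qed

end

section \<open>Moments\<close>

text \<open>Tonelli's criterion in the shape in which it is always checked below: an
  \<open>L1\<close> bound uniform over a bounded time interval. Vanishing outside
  \<open>{0..t}\<close> lets time integrals be plain integrals over \<open>lborel\<close>.\<close>

lemma integrable_time_pair:
  fixes H :: "real \<Rightarrow> 'w \<Rightarrow> real"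
  assumes "sigma_finite_measure Q"
    and meas: "case_prod H \<in> borel_measurable (borel \<Otimes>\<^sub>M Q)"
    and int: "\<And>s. s \<in> {0..t} \<Longrightarrow> integrable Q (H s)"
    and bound: "\<And>s. s \<in> {0..t} \<Longrightarrow> (\<integral>\<omega>. \<bar>H s \<omega>\<bar> \<partial>Q) \<le> B"
    and outside: "\<And>s \<omega>. s \<notin> {0..t} \<Longrightarrow> H s \<omega> = 0"
  shows "integrable (lborel \<Otimes>\<^sub>M Q) (case_prod H)"
proof -
  interpret Q: sigma_finite_measure Q by fact
  interpret pair_sigma_finite lborel Q ..
  have meas': "case_prod H \<in> borel_measurable (lborel \<Otimes>\<^sub>M Q)"
    using meas by (simp cong: measurable_cong_sets sets_pair_measure_cong)
  show ?thesis
  proof (rule Fubini_integrable[OF meas'])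
    have "AE s in lborel. integrable Q (H s)"
      using int outside by (intro AE_I2) (metis (mono_tags) integrable_zero Bochner_Integration.integrable_cong)
    then show "AE s in lborel. integrable Q (\<lambda>\<omega>. case_prod H (s, \<omega>))" by simp
    have m: "(\<lambda>s. \<integral>\<omega>. norm (case_prod H (s, \<omega>)) \<partial>Q) \<in> borel_measurable lborel"
      using meas' by (intro Q.borel_measurable_lebesgue_integral) (simp add: case_prod_unfold)
    show "integrable lborel (\<lambda>s. \<integral>\<omega>. norm (case_prod H (s, \<omega>)) \<partial>Q)"
    proof (rule Bochner_Integration.integrable_bound[OF _ m])
      show "integrable lborel (\<lambda>s. indicator {0..t} s * B)"
        by (intro integrable_mult_left) (simp add: integrable_indicator_iff emeasure_lborel_Icc_eq)
      show "AE s in lborel. norm (\<integral>\<omega>. norm (case_prod H (s, \<omega>)) \<partial>Q) \<le> norm (indicator {0..t} s * B)"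
        using bound outside by (intro AE_I2) (auto simp: indicator_def integral_nonneg_AE intro: order_trans[OF _ abs_ge_self])
    qed
  qed
qed

lemma Fubini_time:
  fixes H :: "real \<Rightarrow> 'w \<Rightarrow> real"
  assumes "sigma_finite_measure Q" and H: "integrable (lborel \<Otimes>\<^sub>M Q) (case_prod H)"
  shows "integrable Q (\<lambda>\<omega>. \<integral>s. H s \<omega> \<partial>lborel)"
    and "AE \<omega> in Q. integrable lborel (\<lambda>s. H s \<omega>)"
    and "(\<integral>\<omega>. (\<integral>s. H s \<omega> \<partial>lborel) \<partial>Q) = (\<integral>s. (\<integral>\<omega>. H s \<omega> \<partial>Q) \<partial>lborel)"
    and "integrable lborel (\<lambda>s. \<integral>\<omega>. H s \<omega> \<partial>Q)"
proof -
  interpret Q: sigma_finite_measure Q by fact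
  interpret pair_sigma_finite lborel Q ..
  show "integrable Q (\<lambda>\<omega>. \<integral>s. H s \<omega> \<partial>lborel)" using integrable_snd[OF H] .
  show "AE \<omega> in Q. integrable lborel (\<lambda>s. H s \<omega>)" using AE_integrable_snd[OF H] .
  show "(\<integral>\<omega>. (\<integral>s. H s \<omega> \<partial>lborel) \<partial>Q) = (\<integral>s. (\<integral>\<omega>. H s \<omega> \<partial>Q) \<partial>lborel)"
    using Fubini_integral[OF H] .
  show "integrable lborel (\<lambda>s. \<integral>\<omega>. H s \<omega> \<partial>Q)" using integrable_fst[OF H] .
qed

section \<open>Time integrals along paths\<close>

context markov_process
begin

text \<open>The upper limit is a variable because the process built from this integral is itself
  integrated in time later on.\<close>

lemma running_integral_measurable:
  assumes g: "g \<in> poly_space S k" and t: "0 \<le> t"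
  shows "(\<lambda>(s, \<omega>). LINT r:{0..min t s}|lborel. g (\<omega> r)) \<in> borel_measurable (borel \<Otimes>\<^sub>M F t)"
proof -
  have eq: "(LINT r:{0..min t s}|lborel. g (\<omega> r))
      = (\<integral>r. of_bool (0 \<le> r \<and> r \<le> min t s) * g (\<omega> (min t (max 0 r))) \<partial>lborel)" for s \<omega>
    unfolding set_lebesgue_integral_def by (intro Bochner_Integration.integral_cong) (auto simp: indicator_def)
  have "(\<lambda>z. (snd z, snd (fst z))) \<in> (borel \<Otimes>\<^sub>M F t) \<Otimes>\<^sub>M lborel \<rightarrow>\<^sub>M borel \<Otimes>\<^sub>M F t"
    by measurable
  from measurable_compose[OF this progressively_measurable[OF g t]]
  have [measurable]: "(\<lambda>z. g (snd (fst z) (min t (max 0 (snd z))))) \<in> borel_measurable ((borel \<Otimes>\<^sub>M F t) \<Otimes>\<^sub>M lborel)"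
    by simp
  have "(\<lambda>z. of_bool (0 \<le> snd z \<and> snd z \<le> min t (fst (fst z))) * g (snd (fst z) (min t (max 0 (snd z)))))
      \<in> borel_measurable ((borel \<Otimes>\<^sub>M F t) \<Otimes>\<^sub>M lborel)" by measurable
  then have "(\<lambda>y. \<integral>r. of_bool (0 \<le> r \<and> r \<le> min t (fst y)) * g (snd y (min t (max 0 r))) \<partial>lborel)
      \<in> borel_measurable (borel \<Otimes>\<^sub>M F t)"
    by (intro lborel.borel_measurable_lebesgue_integral) (simp add: case_prod_unfold)
  then show ?thesis unfolding eq by (simp add: case_prod_unfold)
qed

lemma time_integral_measurable_F:
  assumes g: "g \<in> poly_space S k" and s: "0 \<le> s" "s \<le> t"
  shows "(\<lambda>\<omega>. LINT r:{0..s}|lborel. g (\<omega> r)) \<in> borel_measurable (F t)"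
proof -
  have "(\<lambda>\<omega>. (s, \<omega>)) \<in> F t \<rightarrow>\<^sub>M borel \<Otimes>\<^sub>M F t" by measurable
  from measurable_compose[OF this running_integral_measurable[OF g, of t]]
  show ?thesis using s by (simp add: min_absorb2)
qed

lemma generator_process_measurable:
  assumes f: "f \<in> poly_space S k" and g: "g \<in> poly_space S k" and t: "0 \<le> t"
  shows "generator_process f g x t \<in> borel_measurable (F t)"
  unfolding generator_process_def
  by (intro borel_measurable_diff borel_measurable_const time_integral_measurable_F[OF g]
      observable_measurable_F[OF poly_space_borel[OF f]] t order_refl)

definition dynkin :: "('n state \<Rightarrow> real) \<Rightarrow> ('n state \<Rightarrow> real) \<Rightarrow> bool" where
  "dynkin f g \<longleftrightarrow> (\<forall>x\<in>states S. \<forall>t\<ge>0.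
     semigroup_op S p t f x = f x + (LINT s:{0..t}|lborel. semigroup_op S p s g x))"

end

section \<open>Uniform moment bounds and their consequences\<close>

locale polynomial_setting = markov_process S p F P
  for S :: "(real^'n) set" and p F P +
  fixes m :: nat
  assumes m_ge_2: "2 \<le> m" and even_m: "even m"
begin

abbreviation \<phi> :: "'n state \<Rightarrow> real" where "\<phi> \<equiv> power_weight m"

lemma \<phi>_poly: "\<phi> \<in> poly_space S m" by (rule power_weight_in_poly_space)

lemma \<phi>_nonneg: "0 \<le> \<phi> x" by (rule power_weight_nonneg[OF even_m])

lemma poly_bound: "f \<in> poly_space S m \<Longrightarrow> \<exists>C\<ge>0. \<forall>x\<in>states S. \<bar>f x\<bar> \<le> C * \<phi> x"
  by (rule poly_space_le_power_weight[OF _ order_refl even_m])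

text \<open>Uniformity over bounded time intervals, beyond finiteness of each moment, is what
  Fubini's theorem in time needs. Both directions of the theorem establish this first and share the
  consequences.\<close>

definition moments_bounded :: bool where
  "moments_bounded \<longleftrightarrow> (\<forall>x\<in>states S. \<forall>t. \<exists>B. \<forall>s\<in>{0..t}.
     integrable (P x) (\<lambda>\<omega>. \<phi> (\<omega> s)) \<and> (\<integral>\<omega>. \<phi> (\<omega> s) \<partial>P x) \<le> B)"

lemma path_P: "x \<in> states S \<Longrightarrow> \<omega> \<in> space (P x) \<Longrightarrow> 0 \<le> s \<Longrightarrow> \<omega> s \<in> states S"
  by (auto simp: space_P intro: path_in_states)

lemma expectation_indicator_space:
  "x \<in> states S \<Longrightarrow> (\<integral>\<omega>. indicator (space (P x)) \<omega> * h \<omega> \<partial>P x) = integral\<^sup>L (P x) (h :: 'n path \<Rightarrow> real)"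
  by (intro Bochner_Integration.integral_cong) auto

lemma semigroup_op_poly:
  "f \<in> poly_space S m \<Longrightarrow> x \<in> states S \<Longrightarrow> 0 \<le> t \<Longrightarrow> semigroup_op S p t f x = (\<integral>\<omega>. f (\<omega> t) \<partial>P x)"
  by (intro semigroup_op_expectation poly_space_borel)

lemma semigroup_zero:
  assumes f: "f \<in> poly_space S m" and x: "x \<in> states S"
  shows "semigroup_op S p 0 f x = f x"
proof -
  interpret prob_space "P x" using prob[OF x] .
  have "(\<integral>\<omega>. f (\<omega> 0) \<partial>P x) = (\<integral>\<omega>. f x \<partial>P x)"
    using observable_measurable[OF poly_space_borel[OF f] x order_refl] start[OF x]
    by (intro integral_cong_AE) (auto elim: eventually_mono)
  then show ?thesis using semigroup_op_poly[OF f x order_refl] by (simp add: prob_space)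
qed

text \<open>Stated for moment functions, since linearity already enters the proof that a polynomial
  process has uniformly bounded moments.\<close>

lemma semigroup_linear_moment:
  assumes PM: "\<And>f. f \<in> poly_space S m \<Longrightarrow> moment_function f"
    and f: "\<And>j. j \<in> T \<Longrightarrow> f j \<in> poly_space S m" and x: "x \<in> states S" and t: "0 \<le> t"
    and h: "\<And>z. z \<in> states S \<Longrightarrow> h z = (\<Sum>j\<in>T. a j * f j z)"
  shows "semigroup_op S p t h x = (\<Sum>j\<in>T. a j * semigroup_op S p t (f j) x)"
proof -
  have hp: "h \<in> poly_space S m"
    by (rule poly_space_cong[OF poly_space_sum[OF f] h]) auto
  have "(\<integral>\<omega>. h (\<omega> t) \<partial>P x) = (\<integral>\<omega>. (\<Sum>j\<in>T. a j * f j (\<omega> t)) \<partial>P x)"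
    by (intro Bochner_Integration.integral_cong refl h path_P[OF x _ t])
  also have "\<dots> = (\<Sum>j\<in>T. \<integral>\<omega>. a j * f j (\<omega> t) \<partial>P x)"
    using PM[OF f] x t
    by (intro Bochner_Integration.integral_sum integrable_mult_right) (auto simp: moment_function_def)
  finally show ?thesis
    using f by (simp add: semigroup_op_poly[OF hp x t] semigroup_op_poly[OF f x t])
qed

context
  assumes MB: "moments_bounded"
begin

lemma poly_moment:
  assumes f: "f \<in> poly_space S m" and x: "x \<in> states S" and s: "0 \<le> s"
  shows "integrable (P x) (\<lambda>\<omega>. f (\<omega> s))"
proof -
  obtain C where C: "C \<ge> 0" "\<forall>x\<in>states S. \<bar>f x\<bar> \<le> C * \<phi> x" using poly_bound[OF f] by blast
  have "integrable (P x) (\<lambda>\<omega>. \<phi> (\<omega> s))" using MB x s unfolding moments_bounded_def by force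
  then have i: "integrable (P x) (\<lambda>\<omega>. C * \<phi> (\<omega> s))" by simp
  show ?thesis
    by (rule Bochner_Integration.integrable_bound[OF i observable_measurable[OF poly_space_borel[OF f] x s]])
      (use C path_P[OF x _ s] \<phi>_nonneg in \<open>auto intro!: AE_I2\<close>)
qed

lemma poly_moment_function: "f \<in> poly_space S m \<Longrightarrow> moment_function f"
  by (auto simp: moment_function_def poly_moment intro: poly_space_borel)

lemma poly_moment_bound:
  assumes f: "f \<in> poly_space S m" and x: "x \<in> states S"
  shows "\<exists>B\<ge>0. \<forall>s\<in>{0..t}. (\<integral>\<omega>. \<bar>f (\<omega> s)\<bar> \<partial>P x) \<le> B"
proof -
  obtain C where C: "C \<ge> 0" "\<forall>x\<in>states S. \<bar>f x\<bar> \<le> C * \<phi> x" using poly_bound[OF f] by blast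
  obtain B where B: "\<And>s. s \<in> {0..t} \<Longrightarrow> (\<integral>\<omega>. \<phi> (\<omega> s) \<partial>P x) \<le> B"
    using MB x unfolding moments_bounded_def by meson
  have "(\<integral>\<omega>. \<bar>f (\<omega> s)\<bar> \<partial>P x) \<le> C * \<bar>B\<bar>" if s: "s \<in> {0..t}" for s
  proof -
    have "(\<integral>\<omega>. \<bar>f (\<omega> s)\<bar> \<partial>P x) \<le> (\<integral>\<omega>. C * \<phi> (\<omega> s) \<partial>P x)"
      using s C path_P[OF x]
      by (intro integral_mono integrable_abs poly_moment[OF f x]
          integrable_mult_right poly_moment[OF \<phi>_poly x]) auto
    also have "\<dots> \<le> C * B" using B[OF s] C by (simp add: mult_left_mono)
    also have "\<dots> \<le> C * \<bar>B\<bar>" using C by (simp add: mult_left_mono)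
    finally show ?thesis .
  qed
  then show ?thesis using C by (intro exI[of _ "C * \<bar>B\<bar>"]) auto
qed

lemma time_pair_integrable:
  assumes g: "g \<in> poly_space S m" and x: "x \<in> states S" and t: "0 \<le> t" and A: "A \<in> sets (P x)"
  shows "integrable (lborel \<Otimes>\<^sub>M P x) (\<lambda>(s, \<omega>). indicator {0..t} s * (indicator A \<omega> * g (\<omega> s)))"
proof -
  obtain B where B: "\<forall>s\<in>{0..t}. (\<integral>\<omega>. \<bar>g (\<omega> s)\<bar> \<partial>P x) \<le> B"
    using poly_moment_bound[OF g x] by blast
  note [measurable] = jointly_measurable[OF g t x] A
  have eq: "(\<lambda>(s, \<omega>). indicator {0..t} s * (indicator A \<omega> * g (\<omega> s)))
      = (\<lambda>(s, \<omega>). indicator {0..t} s * (indicator A \<omega> * g (\<omega> (min t (max 0 s)))))"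
    by (auto simp: indicator_def fun_eq_iff)
  show ?thesis
  proof (rule integrable_time_pair[OF prob_space_imp_sigma_finite[OF prob[OF x]]])
    show "(\<lambda>(s, \<omega>). indicator {0..t} s * (indicator A \<omega> * g (\<omega> s))) \<in> borel_measurable (borel \<Otimes>\<^sub>M P x)"
      unfolding eq by measurable
    fix s :: real assume s: "s \<in> {0..t}"
    then have i: "integrable (P x) (\<lambda>\<omega>. indicator A \<omega> * g (\<omega> s))"
      using integrable_mult_indicator[OF A poly_moment[OF g x, of s]] by simp
    then show "integrable (P x) (\<lambda>\<omega>. indicator {0..t} s * (indicator A \<omega> * g (\<omega> s)))" by simp
    have "(\<integral>\<omega>. \<bar>indicator {0..t} s * (indicator A \<omega> * g (\<omega> s))\<bar> \<partial>P x) \<le> (\<integral>\<omega>. \<bar>g (\<omega> s)\<bar> \<partial>P x)"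
      using s i by (intro integral_mono integrable_abs poly_moment[OF g x]) (auto simp: indicator_def)
    also have "\<dots> \<le> B" using B s by auto
    finally show "(\<integral>\<omega>. \<bar>indicator {0..t} s * (indicator A \<omega> * g (\<omega> s))\<bar> \<partial>P x) \<le> B" .
  qed auto
qed

text \<open>All four statements are Fubini's theorem for one integrand. The event A serves the
  conditional form of Dynkin's formula; the plain form takes the whole space.\<close>

lemma
  assumes g: "g \<in> poly_space S m" and x: "x \<in> states S" and t: "0 \<le> t"
  shows time_integral_integrable: "integrable (P x) (\<lambda>\<omega>. LINT s:{0..t}|lborel. g (\<omega> s))"
    and time_integral_exchange: "A \<in> sets (P x) \<Longrightarrow>
      (\<integral>\<omega>. indicator A \<omega> * (LINT s:{0..t}|lborel. g (\<omega> s)) \<partial>P x)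
      = (LINT s:{0..t}|lborel. (\<integral>\<omega>. indicator A \<omega> * g (\<omega> s) \<partial>P x))"
    and time_path_integrable: "AE \<omega> in P x. set_integrable lborel {0..t} (\<lambda>s. g (\<omega> s))"
    and time_expectation_integrable: "A \<in> sets (P x) \<Longrightarrow>
      set_integrable lborel {0..t} (\<lambda>s. \<integral>\<omega>. indicator A \<omega> * g (\<omega> s) \<partial>P x)"
proof -
  have T: "space (P x) \<in> sets (P x)" by simp
  show "integrable (P x) (\<lambda>\<omega>. LINT s:{0..t}|lborel. g (\<omega> s))"
    using Fubini_time(1)[OF prob_space_imp_sigma_finite[OF prob[OF x]] time_pair_integrable[OF g x t T]]
    unfolding set_lebesgue_integral_def
    by (rule Bochner_Integration.integrable_cong[THEN iffD1, rotated 2]) auto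
  show "AE \<omega> in P x. set_integrable lborel {0..t} (\<lambda>s. g (\<omega> s))"
    using Fubini_time(2)[OF prob_space_imp_sigma_finite[OF prob[OF x]] time_pair_integrable[OF g x t T]] AE_space
    by eventually_elim (simp add: set_integrable_def)
  assume A: "A \<in> sets (P x)"
  have "(\<integral>\<omega>. indicator A \<omega> * (LINT s:{0..t}|lborel. g (\<omega> s)) \<partial>P x)
      = (\<integral>\<omega>. (\<integral>s. indicator {0..t} s * (indicator A \<omega> * g (\<omega> s)) \<partial>lborel) \<partial>P x)"
    unfolding set_lebesgue_integral_def
    by (intro Bochner_Integration.integral_cong refl) (auto simp: indicator_def)
  also have "\<dots> = (LINT s:{0..t}|lborel. (\<integral>\<omega>. indicator A \<omega> * g (\<omega> s) \<partial>P x))"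
    using Fubini_time(3)[OF prob_space_imp_sigma_finite[OF prob[OF x]] time_pair_integrable[OF g x t A]]
    unfolding set_lebesgue_integral_def by simp
  finally show "(\<integral>\<omega>. indicator A \<omega> * (LINT s:{0..t}|lborel. g (\<omega> s)) \<partial>P x)
      = (LINT s:{0..t}|lborel. (\<integral>\<omega>. indicator A \<omega> * g (\<omega> s) \<partial>P x))" .
  show "set_integrable lborel {0..t} (\<lambda>s. \<integral>\<omega>. indicator A \<omega> * g (\<omega> s) \<partial>P x)"
    using Fubini_time(4)[OF prob_space_imp_sigma_finite[OF prob[OF x]] time_pair_integrable[OF g x t A]]
    unfolding set_integrable_def by simp
qed

lemma semigroup_time_integrable:
  assumes g: "g \<in> poly_space S m" and x: "x \<in> states S"
  shows "set_integrable lborel {0..t} (\<lambda>s. semigroup_op S p s g x)"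
proof (cases "0 \<le> t")
  case True
  have "set_integrable lborel {0..t} (\<lambda>s. \<integral>\<omega>. g (\<omega> s) \<partial>P x)"
    using time_expectation_integrable[OF g x True sets.top] by (simp add: expectation_indicator_space[OF x])
  then show ?thesis
    by (rule set_integrable_cong[THEN iffD1, rotated 3]) (auto simp: semigroup_op_poly[OF g x])
next
  case False
  then show ?thesis by (simp add: set_integrable_def)
qed

lemma expectation_time_integral:
  assumes g: "g \<in> poly_space S m" and x: "x \<in> states S" and t: "0 \<le> t"
  shows "(\<integral>\<omega>. (LINT s:{0..t}|lborel. g (\<omega> s)) \<partial>P x) = (LINT s:{0..t}|lborel. semigroup_op S p s g x)"
proof -
  have "(\<integral>\<omega>. (LINT s:{0..t}|lborel. g (\<omega> s)) \<partial>P x) = (LINT s:{0..t}|lborel. (\<integral>\<omega>. g (\<omega> s) \<partial>P x))"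
    using time_integral_exchange[OF g x t sets.top] by (simp add: expectation_indicator_space[OF x])
  also have "\<dots> = (LINT s:{0..t}|lborel. semigroup_op S p s g x)"
    by (intro set_lebesgue_integral_cong) (auto simp: semigroup_op_poly[OF g x])
  finally show ?thesis .
qed

lemma semigroup_bound:
  assumes f: "f \<in> poly_space S m" and x: "x \<in> states S"
  shows "\<exists>B\<ge>0. \<forall>s\<in>{0..t}. \<bar>semigroup_op S p s f x\<bar> \<le> B"
proof -
  obtain B where B: "B \<ge> 0" "\<forall>s\<in>{0..t}. (\<integral>\<omega>. \<bar>f (\<omega> s)\<bar> \<partial>P x) \<le> B"
    using poly_moment_bound[OF f x] by blast
  have "\<bar>semigroup_op S p s f x\<bar> \<le> B" if "s \<in> {0..t}" for s
    using order_trans[OF integral_abs_bound bspec[OF B(2) that]] that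
    by (simp add: semigroup_op_poly[OF f x])
  then show ?thesis using B by blast
qed

lemma semigroup_linear:
  assumes "\<And>j. j \<in> T \<Longrightarrow> f j \<in> poly_space S m" "x \<in> states S" "0 \<le> t"
    "\<And>z. z \<in> states S \<Longrightarrow> h z = (\<Sum>j\<in>T. a j * f j z)"
  shows "semigroup_op S p t h x = (\<Sum>j\<in>T. a j * semigroup_op S p t (f j) x)"
  by (rule semigroup_linear_moment[OF poly_moment_function]) (use assms in auto)

end

end

section \<open>Finite dimensional spaces of polynomials\<close>

lemma fun_sum_closed:
  fixes V :: "('a \<Rightarrow> real) set"
  assumes combo: "\<And>f g a c. f \<in> V \<Longrightarrow> g \<in> V \<Longrightarrow> (\<lambda>x. a * f x + c * g x) \<in> V" and zero: "(\<lambda>_. 0) \<in> V"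
    and f: "\<And>j. j \<in> T \<Longrightarrow> f j \<in> V"
  shows "(\<lambda>x. \<Sum>j\<in>T. a j * f j x) \<in> V"
  using f
proof (induction T rule: infinite_finite_induct)
  case (insert j T)
  then have "(\<lambda>x. a j * f j x + 1 * (\<Sum>j\<in>T. a j * f j x)) \<in> V" by (intro combo) auto
  then show ?case using insert by simp
qed (auto simp: zero)

text \<open>Gaussian elimination on the matrix of values of the functions \<open>b i\<close> at points of \<open>X\<close>.\<close>

lemma dual_basis:
  fixes V :: "('a \<Rightarrow> real) set"
  assumes combo: "\<And>f g a c. f \<in> V \<Longrightarrow> g \<in> V \<Longrightarrow> (\<lambda>x. a * f x + c * g x) \<in> V" and zero: "(\<lambda>_. 0) \<in> V"
    and "finite I" and "\<And>i. i \<in> I \<Longrightarrow> b i \<in> V"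
  shows "\<exists>T e. finite T \<and> T \<subseteq> X \<and> (\<forall>j\<in>T. e j \<in> V) \<and>
    (\<forall>i\<in>T. \<forall>j\<in>T. e i j = (if i = j then 1 else 0)) \<and>
    (\<forall>i\<in>I. \<forall>x\<in>X. b i x = (\<Sum>j\<in>T. b i j * e j x))"
  using assms(3,4)
proof (induction I)
  case empty
  then show ?case by (intro exI[of _ "{}"]) auto
next
  case (insert i0 I)
  have "\<exists>T e. finite T \<and> T \<subseteq> X \<and> (\<forall>j\<in>T. e j \<in> V) \<and>
    (\<forall>i\<in>T. \<forall>j\<in>T. e i j = (if i = j then 1 else 0)) \<and>
    (\<forall>i\<in>I. \<forall>x\<in>X. b i x = (\<Sum>j\<in>T. b i j * e j x))"
    by (rule insert.IH) (simp add: insert.prems)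
  then obtain T e where T: "finite T" "T \<subseteq> X" and e': "\<forall>j\<in>T. e j \<in> V"
    and dual': "\<forall>i\<in>T. \<forall>j\<in>T. e i j = (if i = j then 1 else 0)"
    and span': "\<forall>i\<in>I. \<forall>x\<in>X. b i x = (\<Sum>j\<in>T. b i j * e j x)"
    by (elim exE conjE) (rule that; assumption)
  note e = e'[rule_format] and dual = dual'[rule_format] and span = span'[rule_format]
  have sumV: "(\<lambda>x. \<Sum>j\<in>T. b i0 j * e j x) \<in> V"
    by (rule fun_sum_closed) (auto intro: combo zero e)
  \<comment> \<open>The residual vanishes on T. If it vanishes on X, then \<open>b i0\<close> is
    already expanded; otherwise a point y with \<open>r y\<close> nonzero is the next pivot.\<close>
  define r where "r x = b i0 x - (\<Sum>j\<in>T. b i0 j * e j x)" for x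
  have rV: "r \<in> V"
    using combo[OF insert.prems[of i0] sumV, of 1 "-1"]
    by (simp add: r_def[abs_def])
  have r0: "r j = 0" if "j \<in> T" for j
  proof -
    have "(\<Sum>l\<in>T. b i0 l * e l j) = (\<Sum>l\<in>T. if l = j then b i0 l else 0)"
      using that dual by (intro sum.cong) auto
    then show ?thesis using that T by (simp add: r_def)
  qed
  show ?case
  proof (cases "\<forall>x\<in>X. r x = 0")
    case True
    then have "\<forall>x\<in>X. b i0 x = (\<Sum>j\<in>T. b i0 j * e j x)" by (simp add: r_def)
    then have "\<forall>i\<in>insert i0 I. \<forall>x\<in>X. b i x = (\<Sum>j\<in>T. b i j * e j x)"
      using bspec[OF span'] by (metis insertE)
    then show ?thesis using T e' dual' by (intro exI[of _ T] exI[of _ e] conjI)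
  next
    case False
    then obtain y where y: "y \<in> X" "r y \<noteq> 0" by auto
    then have yT: "y \<notin> T" using r0 by auto
    define d where "d x = r x / r y" for x
    define e' where "e' j = (if j = y then d else (\<lambda>x. e j x - e j y * d x))" for j
    have dV: "d \<in> V" using combo[OF rV rV, of "1 / r y" 0] by (simp add: d_def[abs_def])
    have e'V: "e' j \<in> V" if "j \<in> insert y T" for j
      using that dV combo[OF e[of j] dV, of 1 "- e j y"] by (auto simp: e'_def)
    have d0: "d j = 0" if "j \<in> T" for j using r0 that by (simp add: d_def)
    have d1: "d y = 1" using y by (simp add: d_def)
    have dual': "e' i j = (if i = j then 1 else 0)" if "i \<in> insert y T" "j \<in> insert y T" for i j
      using that dual d0 d1 yT by (auto simp: e'_def)
    \<comment> \<open>Adding y changes the interpolant of f by the defect of the old one at y, times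
      d.\<close>
    have key: "(\<Sum>j\<in>insert y T. f j * e' j x) = (\<Sum>j\<in>T. f j * e j x) + (f y - (\<Sum>j\<in>T. f j * e j y)) * d x" for f x
    proof -
      have "(\<Sum>j\<in>T. f j * e' j x) = (\<Sum>j\<in>T. f j * e j x - f j * e j y * d x)"
        using yT by (intro sum.cong refl) (auto simp: e'_def algebra_simps)
      also have "\<dots> = (\<Sum>j\<in>T. f j * e j x) - (\<Sum>j\<in>T. f j * e j y) * d x"
        by (simp add: sum_subtractf sum_distrib_right)
      finally show ?thesis using T yT by (simp add: e'_def algebra_simps)
    qed
    have span': "b i x = (\<Sum>j\<in>insert y T. b i j * e' j x)" if "i \<in> insert i0 I" "x \<in> X" for i x
    proof (cases "i = i0")
      case True
      have "(b i0 y - (\<Sum>j\<in>T. b i0 j * e j y)) * d x = r x" using y by (simp add: d_def r_def[of y, symmetric])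
      then show ?thesis unfolding key True by (simp add: r_def)
    next
      case False
      then have "i \<in> I" using that by auto
      then show ?thesis unfolding key using span[of i x] span[of i y] that y by simp
    qed
    show ?thesis
      by (intro exI[of _ "insert y T"] exI[of _ e'] conjI ballI e'V dual' span') (use T y in auto)
  qed
qed

text \<open>Gaussian elimination again, now inside the subspace W: after subtracting the part
  already matched on the earlier points, the approximants still tend to 1 at the new point, so one
  of them can be normalized there.\<close>

lemma dual_basis_of_dense:
  fixes W :: "('a \<Rightarrow> real) set"
  assumes combo: "\<And>f g a c. f \<in> W \<Longrightarrow> g \<in> W \<Longrightarrow> (\<lambda>x. a * f x + c * g x) \<in> W" and zero: "(\<lambda>_. 0) \<in> W"
    and "finite T"
    and dense: "\<And>i. i \<in> T \<Longrightarrow> \<exists>g. (\<forall>n. g n \<in> W) \<and> (\<forall>j\<in>T. (\<lambda>n. g n j) \<longlonglongrightarrow> (if i = j then 1 else 0))"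
  shows "\<exists>w. \<forall>i\<in>T. w i \<in> W \<and> (\<forall>j\<in>T. w i j = (if i = j then 1 else 0))"
proof -
  have "\<exists>w. \<forall>i\<in>T'. w i \<in> W \<and> (\<forall>j\<in>T'. w i j = (if i = j then 1 else 0))" if "T' \<subseteq> T" for T'
    using finite_subset[OF that \<open>finite T\<close>] that
  proof (induction T')
    case (insert y T')
    then obtain w where wW: "\<And>i. i \<in> T' \<Longrightarrow> w i \<in> W"
      and dual: "\<And>i j. i \<in> T' \<Longrightarrow> j \<in> T' \<Longrightarrow> w i j = (if i = j then 1 else 0)" by auto
    have "\<exists>g. (\<forall>n. g n \<in> W) \<and> (\<forall>j\<in>T. (\<lambda>n. g n j) \<longlonglongrightarrow> (if y = j then 1 else 0))"
      using insert.prems by (intro dense) simp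
    then obtain g where "\<forall>n. g n \<in> W" "\<forall>j\<in>T. (\<lambda>n. g n j) \<longlonglongrightarrow> (if y = j then 1 else 0)"
      by (elim exE conjE) (rule that; assumption)
    note g = this[rule_format]
    define r where "r n x = g n x - (\<Sum>j\<in>T'. g n j * w j x)" for n x
    have sumW: "(\<lambda>x. \<Sum>j\<in>T'. g n j * w j x) \<in> W" for n
      by (rule fun_sum_closed) (auto intro: combo zero wW)
    have rW: "r n \<in> W" for n
      using combo[OF g(1)[of n] sumW[of n], of 1 "-1"]
      by (simp add: r_def[abs_def])
    have r0: "r n j = 0" if "j \<in> T'" for n j
    proof -
      have "(\<Sum>l\<in>T'. g n l * w l j) = (\<Sum>l\<in>T'. if l = j then g n l else 0)"
        using that dual by (intro sum.cong) auto
      then show ?thesis using that insert by (simp add: r_def)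
    qed
    have "(\<lambda>n. r n y) \<longlonglongrightarrow> (if y = y then 1 else 0) - (\<Sum>j\<in>T'. (if y = j then 1 else 0) * w j y)"
      unfolding r_def using insert by (intro tendsto_intros g) auto
    also have "(\<Sum>j\<in>T'. (if y = j then 1 else 0) * w j y) = 0"
      using insert by (intro sum.neutral) auto
    finally have "(\<lambda>n. r n y) \<longlonglongrightarrow> 1" by simp
    then have "eventually (\<lambda>n. r n y \<noteq> 0) sequentially"
      by (rule tendsto_imp_eventually_ne) simp
    then obtain n where n: "r n y \<noteq> 0" using eventually_happens'[OF sequentially_bot] by blast
    define d where "d x = r n x / r n y" for x
    define w' where "w' j = (if j = y then d else (\<lambda>x. w j x - w j y * d x))" for j
    have dW: "d \<in> W" using combo[OF rW[of n] rW[of n], of "1 / r n y" 0] by (simp add: d_def[abs_def])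
    have "w' i \<in> W \<and> (\<forall>j\<in>insert y T'. w' i j = (if i = j then 1 else 0))" if "i \<in> insert y T'" for i
      using that dW combo[OF wW[of i] dW, of 1 "- w i y"] dual r0 n insert(2)
      by (auto simp: w'_def d_def)
    then show ?case by blast
  qed auto
  then show ?thesis by blast
qed

text \<open>Lagrange interpolation replaces coefficients: the values at the finitely many nodes T
  are coordinates of a polynomial function on \<open>states S\<close>, even where monomials are
  dependent.\<close>

lemma poly_dual_basis:
  "\<exists>T (e :: 'n::finite state \<Rightarrow> 'n state \<Rightarrow> real). finite T \<and> T \<subseteq> states S \<and> (\<forall>j\<in>T. e j \<in> poly_space S k) \<and>
    (\<forall>i\<in>T. \<forall>j\<in>T. e i j = (if i = j then 1 else 0)) \<and>
    (\<forall>f\<in>poly_space S k. \<forall>x\<in>states S. f x = (\<Sum>j\<in>T. f j * e j x))"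
proof -
  let ?I = "{\<alpha> :: 'n \<Rightarrow> nat. (\<Sum>i\<in>UNIV. \<alpha> i) \<le> k}"
  have "\<exists>T e. finite T \<and> T \<subseteq> states S \<and> (\<forall>j\<in>T. e j \<in> poly_space S k) \<and>
    (\<forall>i\<in>T. \<forall>j\<in>T. e i j = (if i = j then 1 else 0)) \<and>
    (\<forall>\<alpha>\<in>?I. \<forall>x\<in>states S. monom_fun \<alpha> x = (\<Sum>j\<in>T. monom_fun \<alpha> j * e j x))"
    by (rule dual_basis) (auto intro: poly_space_combo poly_space_zero finite_multi_indices monom_fun_in_poly_space)
  then obtain T and e :: "'n state \<Rightarrow> 'n state \<Rightarrow> real" where T: "finite T" "T \<subseteq> states S"
    and e: "\<forall>j\<in>T. e j \<in> poly_space S k" "\<forall>i\<in>T. \<forall>j\<in>T. e i j = (if i = j then 1 else 0)"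
    and span: "\<forall>\<alpha>\<in>?I. \<forall>x\<in>states S. monom_fun \<alpha> x = (\<Sum>j\<in>T. monom_fun \<alpha> j * e j x)"
    by (elim exE conjE) (rule that; assumption)
  have "f x = (\<Sum>j\<in>T. f j * e j x)" if f: "f \<in> poly_space S k" and x: "x \<in> states S" for f x
  proof -
    obtain c where c: "\<And>x. x \<in> states S \<Longrightarrow> f x = (\<Sum>\<alpha>\<in>?I. c \<alpha> * monom_fun \<alpha> x)"
      using poly_space_monom_expansion[OF f] by blast
    have "f x = (\<Sum>\<alpha>\<in>?I. c \<alpha> * (\<Sum>j\<in>T. monom_fun \<alpha> j * e j x))"
      using span x by (subst c[OF x]) (intro sum.cong refl, auto)
    also have "\<dots> = (\<Sum>\<alpha>\<in>?I. \<Sum>j\<in>T. c \<alpha> * monom_fun \<alpha> j * e j x)"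
      by (simp add: sum_distrib_left mult.assoc)
    also have "\<dots> = (\<Sum>j\<in>T. \<Sum>\<alpha>\<in>?I. c \<alpha> * monom_fun \<alpha> j * e j x)"
      by (rule sum.swap)
    also have "\<dots> = (\<Sum>j\<in>T. f j * e j x)"
      using T c by (intro sum.cong refl) (auto simp: sum_distrib_right)
    finally show ?thesis .
  qed
  then show ?thesis using T e by (intro exI[of _ T] exI[of _ e] conjI ballI) (auto simp only:)
qed

section \<open>Elementary time integrals\<close>

lemma set_integral_sum:
  fixes f :: "'i \<Rightarrow> 'a \<Rightarrow> real"
  assumes "\<And>i. i \<in> I \<Longrightarrow> set_integrable M A (f i)"
  shows "(LINT x:A|M. (\<Sum>i\<in>I. f i x)) = (\<Sum>i\<in>I. LINT x:A|M. f i x)"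
  using assms unfolding set_lebesgue_integral_def set_integrable_def
  by (simp add: sum_distrib_left)

lemma set_integral_power:
  fixes t :: real
  assumes "0 \<le> t"
  shows "(LINT u:{0..t}|lborel. c * u ^ n) = c * t ^ Suc n / real (Suc n)"
    and "set_integrable lborel {0..t} (\<lambda>u. c * u ^ n)"
proof -
  show "set_integrable lborel {0..t} (\<lambda>u. c * u ^ n)"
    by (intro borel_integrable_atLeastAtMost' continuous_intros)
  show "(LINT u:{0..t}|lborel. c * u ^ n) = c * t ^ Suc n / real (Suc n)"
    using integral_power[OF assms, of n] by (simp add: set_lebesgue_integral_def mult.commute mult.assoc)
qed

section \<open>Dynkin's formula on polynomial spaces\<close>

context polynomial_setting
begin

lemma semigroup_op_cong:
  assumes "\<And>z. z \<in> states S \<Longrightarrow> f z = g z"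
  shows "semigroup_op S p t f x = semigroup_op S p t g x"
  unfolding semigroup_op_def set_lebesgue_integral_def
proof (rule Bochner_Integration.integral_cong[OF refl])
  show "indicator (Some ` S) z *\<^sub>R f z = indicator (Some ` S) z *\<^sub>R g z" for z
    using assms[of z] by (cases "z \<in> Some ` S") (auto simp: states_def)
qed

lemma dynkin_cong:
  assumes "dynkin f g" "\<And>z. z \<in> states S \<Longrightarrow> f' z = f z" "\<And>z. z \<in> states S \<Longrightarrow> g' z = g z"
  shows "dynkin f' g'"
  using assms semigroup_op_cong[of f' f] semigroup_op_cong[of g' g] unfolding dynkin_def by simp

context
  assumes MB: "moments_bounded"
begin

lemma dynkin_sum:
  assumes f: "\<And>j. j \<in> T \<Longrightarrow> f j \<in> poly_space S m" and g: "\<And>j. j \<in> T \<Longrightarrow> g j \<in> poly_space S m"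
    and d: "\<And>j. j \<in> T \<Longrightarrow> dynkin (f j) (g j)"
  shows "dynkin (\<lambda>x. \<Sum>j\<in>T. a j * f j x) (\<lambda>x. \<Sum>j\<in>T. a j * g j x)"
  unfolding dynkin_def
proof (intro ballI allI impI)
  fix x t assume x: "x \<in> states S" and t: "0 \<le> (t :: real)"
  have "semigroup_op S p t (\<lambda>x. \<Sum>j\<in>T. a j * f j x) x = (\<Sum>j\<in>T. a j * semigroup_op S p t (f j) x)"
    by (intro semigroup_linear[OF MB] f x t) auto
  also have "\<dots> = (\<Sum>j\<in>T. a j * f j x + (LINT s:{0..t}|lborel. a j * semigroup_op S p s (g j) x))"
    using d x t by (intro sum.cong refl) (simp add: dynkin_def distrib_left)
  also have "\<dots> = (\<Sum>j\<in>T. a j * f j x) + (\<Sum>j\<in>T. LINT s:{0..t}|lborel. a j * semigroup_op S p s (g j) x)"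
    by (simp add: sum.distrib)
  also have "(\<Sum>j\<in>T. LINT s:{0..t}|lborel. a j * semigroup_op S p s (g j) x)
      = (LINT s:{0..t}|lborel. (\<Sum>j\<in>T. a j * semigroup_op S p s (g j) x))"
    by (intro set_integral_sum[symmetric] set_integrable_mult_right impI semigroup_time_integrable[OF MB g x])
  also have "\<dots> = (LINT s:{0..t}|lborel. semigroup_op S p s (\<lambda>x. \<Sum>j\<in>T. a j * g j x) x)"
    by (intro set_lebesgue_integral_cong) (auto intro!: semigroup_linear[OF MB, symmetric] g x)
  finally show "semigroup_op S p t (\<lambda>x. \<Sum>j\<in>T. a j * f j x) x = (\<Sum>j\<in>T. a j * f j x) +
      (LINT s:{0..t}|lborel. semigroup_op S p s (\<lambda>x. \<Sum>j\<in>T. a j * g j x) x)" .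
qed

text \<open>The integral in Dynkin's formula is at most a constant times t for t \<le> 1, by the
  uniform moment bound.\<close>

lemma dynkin_continuous:
  assumes g: "g \<in> poly_space S m" and d: "dynkin f g" and x: "x \<in> states S"
  shows "continuous (at 0 within {0..}) (\<lambda>t. semigroup_op S p t f x)"
proof -
  obtain B where B: "\<And>s. s \<in> {0..1} \<Longrightarrow> \<bar>semigroup_op S p s g x\<bar> \<le> B"
    using semigroup_bound[OF MB g x, of 1] by blast
  have bound: "\<bar>semigroup_op S p t f x - f x\<bar> \<le> B * t" if t: "0 \<le> t" "t \<le> 1" for t
  proof -
    have "\<bar>LINT s:{0..t}|lborel. semigroup_op S p s g x\<bar> \<le> (LINT s:{0..t}|lborel. \<bar>semigroup_op S p s g x\<bar>)"
      using set_integral_norm_bound[OF semigroup_time_integrable[OF MB g x]] by simp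
    also have "\<dots> \<le> (LINT s:{0..t}|lborel. B * s ^ 0)"
      using set_integral_power(2)[OF t(1), of B 0] B t
      by (intro set_integral_mono set_integrable_abs semigroup_time_integrable[OF MB g x]) auto
    also have "\<dots> = B * t" using set_integral_power(1)[OF t(1), of B 0] by simp
    finally show ?thesis using d x t by (simp add: dynkin_def)
  qed
  have zero: "semigroup_op S p 0 f x = f x"
    using bound[of 0] by simp
  have "((\<lambda>t. semigroup_op S p t f x) \<longlongrightarrow> f x) (at 0 within {0..})"
  proof (rule LIM_zero_cancel, rule Lim_null_comparison)
    have "eventually (\<lambda>t :: real. t < 1) (at 0 within {0..})"
      by (rule order_tendstoD(2)[OF tendsto_ident_at]) simp
    moreover have "eventually (\<lambda>t :: real. t \<in> {0..}) (at 0 within {0..})"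
      by (simp add: eventually_at_filter)
    ultimately show "eventually (\<lambda>t. norm (semigroup_op S p t f x - f x) \<le> B * t) (at 0 within {0..})"
      by eventually_elim (use bound in auto)
    show "((\<lambda>t. B * t) \<longlongrightarrow> 0) (at 0 within {0..})"
      by (auto intro!: tendsto_eq_intros)
  qed
  then show ?thesis by (simp add: continuous_within zero)
qed

text \<open>
  The power series of the exponential of the generator, taken in a finite dimensional space of
  functions, where pointwise limits are taken coefficientwise.
\<close>

lemma dynkin_invariant:
  assumes k: "k \<le> m" and gen: "\<And>f. f \<in> poly_space S k \<Longrightarrow> \<exists>g\<in>poly_space S k. dynkin f g"
    and f0: "f0 \<in> poly_space S k" and t: "0 \<le> t"
  shows "semigroup_op S p t f0 \<in> poly_space S k"
proof -
  obtain T and e :: "'n state \<Rightarrow> 'n state \<Rightarrow> real" where T: "finite T" "T \<subseteq> states S"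
    and e: "\<forall>j\<in>T. e j \<in> poly_space S k"
    and span: "\<forall>f\<in>poly_space S k. \<forall>x\<in>states S. f x = (\<Sum>j\<in>T. f j * e j x)"
    using poly_dual_basis[of S k] by (elim exE conjE) (rule that; assumption)
  note e = e[rule_format] and span = span[rule_format]
  have sub: "f \<in> poly_space S m" if "f \<in> poly_space S k" for f
    using that poly_space_mono[OF k] by blast
  obtain g where g: "\<And>j. j \<in> T \<Longrightarrow> g j \<in> poly_space S k" "\<And>j. j \<in> T \<Longrightarrow> dynkin (e j) (g j)"
    using gen[OF e] by metis
  \<comment> \<open>The generator as a linear operator sending \<open>e j\<close> to
    \<open>g j\<close>, acting through values on T. \<open>N\<close> is the l1 norm of these values
    and \<open>K\<close> bounds the operator norm of A.\<close>
  define A where "A f = (\<lambda>x. \<Sum>j\<in>T. f j * g j x)" for f :: "'n state \<Rightarrow> real"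
  define N where "N f = (\<Sum>j\<in>T. \<bar>f j\<bar>)" for f :: "'n state \<Rightarrow> real"
  define K where "K = (\<Sum>i\<in>T. \<Sum>j\<in>T. \<bar>g i j\<bar>)"
  have K: "0 \<le> K" by (auto simp: K_def intro!: sum_nonneg)
  have N: "0 \<le> N f" for f by (auto simp: N_def intro!: sum_nonneg)
  have AP: "A f \<in> poly_space S k" for f unfolding A_def by (intro poly_space_sum g)
  have dA: "dynkin f (A f)" if f: "f \<in> poly_space S k" for f
    by (rule dynkin_cong[OF dynkin_sum[of T e g f]]) (auto simp: A_def intro: g sub e span[OF f])
  have NA: "N (A f) \<le> K * N f" for f
  proof -
    have "N (A f) \<le> (\<Sum>j\<in>T. \<Sum>i\<in>T. \<bar>f i\<bar> * \<bar>g i j\<bar>)"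
      unfolding N_def A_def by (intro sum_mono order_trans[OF sum_abs]) (simp add: abs_mult)
    also have "\<dots> = (\<Sum>i\<in>T. \<bar>f i\<bar> * (\<Sum>j\<in>T. \<bar>g i j\<bar>))"
      by (subst sum.swap) (simp add: sum_distrib_left)
    also have "\<dots> \<le> (\<Sum>i\<in>T. \<bar>f i\<bar> * K)"
      unfolding K_def using T
      by (intro sum_mono mult_left_mono member_le_sum) (auto intro: sum_nonneg)
    finally show ?thesis by (simp add: N_def sum_distrib_left mult.commute)
  qed
  \<comment> \<open>Partial sum of the exponential series of A at time s.\<close>
  define q where "q n f s x = (\<Sum>r<n. s ^ r / fact r * (A ^^ r) f x)" for n f s x
  have qP: "(\<lambda>x. q n f s x) \<in> poly_space S k" if "f \<in> poly_space S k" for n f s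
  proof -
    have "(A ^^ r) f \<in> poly_space S k" for r using that AP by (cases r) auto
    then show ?thesis unfolding q_def by (intro poly_space_sum)
  qed
  have lim: "(\<lambda>n. q n f0 t x) \<longlonglongrightarrow> semigroup_op S p t f0 x" if x: "x \<in> states S" for x
  proof -
    have "\<exists>B\<ge>0. \<forall>j\<in>T. \<forall>s\<in>{0..t}. \<bar>semigroup_op S p s (e j) x\<bar> \<le> B"
    proof -
      have "\<exists>B. \<forall>j\<in>T. B j \<ge> 0 \<and> (\<forall>s\<in>{0..t}. \<bar>semigroup_op S p s (e j) x\<bar> \<le> B j)"
        using semigroup_bound[OF MB sub[OF e] x, of _ t] by metis
      then obtain B where B: "\<And>j. j \<in> T \<Longrightarrow> B j \<ge> 0"
        "\<And>j s. j \<in> T \<Longrightarrow> s \<in> {0..t} \<Longrightarrow> \<bar>semigroup_op S p s (e j) x\<bar> \<le> B j" by blast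
      have "B j \<le> sum B T" if "j \<in> T" for j using T B that by (intro member_le_sum) auto
      then have "\<forall>j\<in>T. \<forall>s\<in>{0..t}. \<bar>semigroup_op S p s (e j) x\<bar> \<le> sum B T"
        using order_trans[OF B(2)] by blast
      then show ?thesis using B by (intro exI[of _ "sum B T"]) (auto intro: sum_nonneg)
    qed
    then obtain B where B: "B \<ge> 0" "\<And>j s. j \<in> T \<Longrightarrow> s \<in> {0..t} \<Longrightarrow> \<bar>semigroup_op S p s (e j) x\<bar> \<le> B"
      by blast
    have bound: "\<bar>semigroup_op S p s f x\<bar> \<le> B * N f" if f: "f \<in> poly_space S k" and s: "s \<in> {0..t}" for f s
    proof -
      have "semigroup_op S p s f x = (\<Sum>j\<in>T. f j * semigroup_op S p s (e j) x)"
        by (rule semigroup_linear[OF MB _ x _ span[OF f]]) (use s in \<open>auto intro: sub e\<close>)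
      also have "\<bar>\<dots>\<bar> \<le> (\<Sum>j\<in>T. \<bar>f j\<bar> * B)"
        using B s by (intro order_trans[OF sum_abs] sum_mono) (auto simp: abs_mult intro!: mult_left_mono)
      finally show ?thesis by (simp add: N_def sum_distrib_left mult.commute)
    qed
    \<comment> \<open>Remainder estimate of the exponential series. Both f and s vary in the
      induction, because one application of Dynkin's formula passes from f to \<open>A f\<close> and
      integrates over earlier times.\<close>
    have main: "\<bar>semigroup_op S p s f x - q n f s x\<bar> \<le> B * N f * (K * s) ^ n / fact n"
      if "f \<in> poly_space S k" "s \<in> {0..t}" for n f s
      using that
    proof (induction n arbitrary: f s)
      case 0
      then show ?case using bound by (simp add: q_def)
    next
      case (Suc n)
      have s: "0 \<le> s" using Suc.prems by auto
      have q_int: "set_integrable lborel {0..s} (\<lambda>u. q n (A f) u x)"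
        unfolding q_def by (intro borel_integrable_atLeastAtMost' continuous_intros) auto
      have P_int: "set_integrable lborel {0..s} (\<lambda>u. semigroup_op S p u (A f) x)"
        by (rule semigroup_time_integrable[OF MB sub[OF AP] x])
      have "(LINT u:{0..s}|lborel. q n (A f) u x)
          = (LINT u:{0..s}|lborel. (\<Sum>r<n. ((A ^^ r) (A f) x / fact r) * u ^ r))"
        unfolding q_def by (simp add: mult.commute)
      also have "\<dots> = (\<Sum>r<n. LINT u:{0..s}|lborel. ((A ^^ r) (A f) x / fact r) * u ^ r)"
        by (intro set_integral_sum set_integral_power(2)[OF s])
      also have "\<dots> = (\<Sum>r<n. s ^ Suc r / fact (Suc r) * (A ^^ Suc r) f x)"
        by (intro sum.cong refl) (subst set_integral_power(1)[OF s], simp add: funpow_swap1 field_simps)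
      finally have q_Suc: "q (Suc n) f s x = f x + (LINT u:{0..s}|lborel. q n (A f) u x)"
        unfolding q_def by (subst sum.lessThan_Suc_shift) simp
      have "semigroup_op S p s f x = f x + (LINT u:{0..s}|lborel. semigroup_op S p u (A f) x)"
        using dA[OF Suc.prems(1)] x s by (auto simp: dynkin_def)
      then have "\<bar>semigroup_op S p s f x - q (Suc n) f s x\<bar>
          = \<bar>LINT u:{0..s}|lborel. semigroup_op S p u (A f) x - q n (A f) u x\<bar>"
        unfolding q_Suc using set_integral_diff(2)[OF P_int q_int] by simp
      also have "\<dots> \<le> (LINT u:{0..s}|lborel. \<bar>semigroup_op S p u (A f) x - q n (A f) u x\<bar>)"
        using set_integral_norm_bound[OF set_integral_diff(1)[OF P_int q_int]] by simp
      also have "\<dots> \<le> (LINT u:{0..s}|lborel. (B * N (A f) * K ^ n / fact n) * u ^ n)"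
      proof (intro set_integral_mono set_integrable_abs set_integral_diff(1) P_int q_int set_integral_power(2)[OF s])
        fix u assume "u \<in> {0..s}"
        then have "\<bar>semigroup_op S p u (A f) x - q n (A f) u x\<bar> \<le> B * N (A f) * (K * u) ^ n / fact n"
          using Suc.prems by (intro Suc.IH AP) auto
        then show "\<bar>semigroup_op S p u (A f) x - q n (A f) u x\<bar> \<le> B * N (A f) * K ^ n / fact n * u ^ n"
          by (simp add: power_mult_distrib mult.assoc)
      qed
      also have "\<dots> = (B * N (A f) * K ^ n / fact n) * s ^ Suc n / real (Suc n)"
        by (rule set_integral_power(1)[OF s])
      also have "\<dots> \<le> (B * (K * N f) * K ^ n / fact n) * s ^ Suc n / real (Suc n)"
        using NA[of f] B s K by (intro divide_right_mono mult_right_mono mult_left_mono) auto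
      also have "\<dots> = B * N f * (K * s) ^ Suc n / fact (Suc n)"
        by (simp add: power_mult_distrib field_simps)
      finally show ?case .
    qed
    show ?thesis
    proof (rule LIM_zero_cancel, rule Lim_null_comparison)
      show "eventually (\<lambda>n. norm (q n f0 t x - semigroup_op S p t f0 x) \<le> B * N f0 * ((K * t) ^ n / fact n)) sequentially"
        using main[OF f0] t by (auto simp: abs_minus_commute)
      have "(\<lambda>n. (K * t) ^ n / fact n) \<longlonglongrightarrow> 0"
        using summable_LIMSEQ_zero[OF summable_exp[of "K * t"]] by (simp add: divide_inverse mult.commute)
      then show "(\<lambda>n. B * N f0 * ((K * t) ^ n / fact n)) \<longlonglongrightarrow> 0"
        by (rule tendsto_mult_right_zero)
    qed
  qed
  \<comment> \<open>Each partial sum is the interpolant of its values on T, and a finite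
    interpolation formula survives the pointwise limit.\<close>
  have "semigroup_op S p t f0 x = (\<Sum>j\<in>T. semigroup_op S p t f0 j * e j x)" if x: "x \<in> states S" for x
  proof (rule LIMSEQ_unique[OF lim[OF x]])
    have "(\<lambda>n. \<Sum>j\<in>T. q n f0 t j * e j x) \<longlonglongrightarrow> (\<Sum>j\<in>T. semigroup_op S p t f0 j * e j x)"
      using T by (intro tendsto_intros lim) auto
    then show "(\<lambda>n. q n f0 t x) \<longlonglongrightarrow> (\<Sum>j\<in>T. semigroup_op S p t f0 j * e j x)"
      using span[OF qP[OF f0] x] by simp
  qed
  then show ?thesis
    by (intro poly_space_cong[OF poly_space_sum[OF e]])
qed

end

end

section \<open>Shifts and averages of time integrals\<close>

lemma set_integral_shift:
  fixes u :: "real \<Rightarrow> real"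
  assumes t: "0 \<le> t" "0 \<le> h" and u: "set_integrable lborel {0..t + h} u"
  shows "set_integrable lborel {0..h} (\<lambda>s. u (t + s))"
    and "(LINT s:{0..h}|lborel. u (t + s)) = (LINT s:{0..t + h}|lborel. u s) - (LINT s:{0..t}|lborel. u s)"
proof -
  have ind: "indicator {0..h} s = indicator {t..t + h} (t + 1 * s)" for s :: real
    by (auto simp: indicator_def)
  have u1: "set_integrable lborel {0..t} u" and u2: "set_integrable lborel {t..t + h} u"
    using t by (auto intro!: set_integrable_subset[OF u])
  show "set_integrable lborel {0..h} (\<lambda>s. u (t + s))"
    using u2 lborel_integrable_real_affine_iff[of 1 "\<lambda>s. indicator {t..t + h} s *\<^sub>R u s" t]
    unfolding set_integrable_def ind by simp
  have "(LINT s:{0..h}|lborel. u (t + s)) = (LINT s:{t..t + h}|lborel. u s)"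
    unfolding set_lebesgue_integral_def ind
    using lborel_integral_real_affine[of 1 "\<lambda>s. indicator {t..t + h} s *\<^sub>R u s" t] by simp
  moreover have "(LINT s:{0..t} \<union> {t..t + h}|lborel. u s) = (LINT s:{0..t}|lborel. u s) + (LINT s:{t..t + h}|lborel. u s)"
  proof (rule set_integral_Un_AE[OF _ _ _ u1 u2])
    show "AE x in lborel. \<not> (x \<in> {0..t} \<and> x \<in> {t..t + h})"
      using AE_lborel_singleton[of t] by eventually_elim auto
  qed auto
  moreover have "{0..t} \<union> {t..t + h} = {0..t + h}" using t by auto
  ultimately show "(LINT s:{0..h}|lborel. u (t + s)) = (LINT s:{0..t + h}|lborel. u s) - (LINT s:{0..t}|lborel. u s)"
    by simp
qed

lemma right_average_tendsto:
  fixes u :: "real \<Rightarrow> real"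
  assumes u: "\<And>t. set_integrable lborel {0..t} u" and lim: "(u \<longlongrightarrow> l) (at 0 within {0..})"
  shows "(\<lambda>n. (1 / inverse (real (Suc n))) * (LINT s:{0..inverse (real (Suc n))}|lborel. u s)) \<longlonglongrightarrow> l"
proof (rule LIMSEQ_I)
  fix r :: real assume r: "0 < r"
  have "eventually (\<lambda>s. dist (u s) l < r / 2) (at 0 within {0..})"
    using tendstoD[OF lim, of "r / 2"] r by simp
  then obtain d where d: "0 < d" "\<And>s. 0 \<le> s \<Longrightarrow> s \<noteq> 0 \<Longrightarrow> s < d \<Longrightarrow> dist (u s) l < r / 2"
    unfolding eventually_at by (auto simp: dist_real_def)
  obtain N where N: "inverse (real (Suc N)) < d" using reals_Archimedean[OF d(1)] by blast
  show "\<exists>no. \<forall>n\<ge>no. norm ((1 / inverse (real (Suc n))) * (LINT s:{0..inverse (real (Suc n))}|lborel. u s) - l) < r"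
  proof (intro exI[of _ N] allI impI)
    fix n assume n: "N \<le> n"
    define h where "h = inverse (real (Suc n))"
    have h: "0 < h" "h < d"
    proof -
      show "0 < h" by (simp add: h_def)
      have "h \<le> inverse (real (Suc N))" unfolding h_def using n by (intro le_imp_inverse_le) auto
      then show "h < d" using N by linarith
    qed
    have c: "set_integrable lborel {0..h} (\<lambda>_. c)" "(LINT s:{0..h}|lborel. c) = c * h" for c :: real
      using set_integral_power[of h c 0] h by auto
    have "\<bar>(LINT s:{0..h}|lborel. u s - l)\<bar> \<le> (LINT s:{0..h}|lborel. \<bar>u s - l\<bar>)"
      using set_integral_norm_bound[OF set_integral_diff(1)[OF u c(1)[of l]]] by simp
    also have "\<dots> \<le> (LINT s:{0..h}|lborel. r / 2)"
    proof (rule set_integral_mono_AE[OF set_integrable_abs[OF set_integral_diff(1)[OF u c(1)]] c(1)])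
      \<comment> \<open>The limit says nothing about the value at 0 itself, which is a null
        set.\<close>
      show "AE s\<in>{0..h} in lborel. \<bar>u s - l\<bar> \<le> r / 2"
        using AE_lborel_singleton[of 0]
      proof eventually_elim
        case (elim s)
        show ?case
        proof
          assume "s \<in> {0..h}"
          then have "dist (u s) l < r / 2" using elim h by (intro d) auto
          then show "\<bar>u s - l\<bar> \<le> r / 2" by (simp add: dist_real_def)
        qed
      qed
    qed
    finally have "\<bar>(LINT s:{0..h}|lborel. u s) - l * h\<bar> \<le> r / 2 * h"
      using set_integral_diff(2)[OF u c(1)[of l]] c(2) by simp
    then have "\<bar>(LINT s:{0..h}|lborel. u s) - l * h\<bar> / h \<le> r / 2"
      using h by (simp add: pos_divide_le_eq)
    moreover have "\<bar>(LINT s:{0..h}|lborel. u s) - l * h\<bar> / h = \<bar>((LINT s:{0..h}|lborel. u s) - l * h) / h\<bar>"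
      using h by (simp add: abs_divide)
    moreover have "((LINT s:{0..h}|lborel. u s) - l * h) / h = 1 / h * (LINT s:{0..h}|lborel. u s) - l"
      using h by (simp add: field_simps)
    ultimately show "norm ((1 / inverse (real (Suc n))) * (LINT s:{0..inverse (real (Suc n))}|lborel. u s) - l) < r"
      using r unfolding h_def[symmetric] by simp
  qed
qed

section \<open>The generator of a polynomial process on polynomials\<close>

context polynomial_setting
begin

context
  assumes PP: "polynomial_process m S p"
begin

lemma polynomial_moment_function:
  assumes f: "f \<in> poly_space S m"
  shows "moment_function f"
  unfolding moment_function_def
proof (intro conjI ballI allI impI)
  show fb: "f \<in> borel_functions S" by (rule poly_space_borel[OF f])
  fix x t assume x: "x \<in> states S" and t: "0 \<le> (t :: real)"
  have "(\<integral>\<^sup>+\<omega>. ennreal \<bar>f (\<omega> t)\<bar> \<partial>P x) < \<infinity>"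
    using PP f x t unfolding nn_integral_kernel[OF x t fb, symmetric] polynomial_process_def by blast
  then show "integrable (P x) (\<lambda>\<omega>. f (\<omega> t))"
    by (intro integrableI_bounded observable_measurable[OF fb x t]) simp
qed

lemma polynomial_invariant:
  "k \<le> m \<Longrightarrow> f \<in> poly_space S k \<Longrightarrow> 0 \<le> t \<Longrightarrow> semigroup_op S p t f \<in> poly_space S k"
  using PP by (auto simp: polynomial_process_def)

lemma semigroup_tendsto:
  assumes f: "f \<in> poly_space S m" and x: "x \<in> states S"
  shows "((\<lambda>t. semigroup_op S p t f x) \<longlongrightarrow> f x) (at 0 within {0..})"
proof -
  have "continuous (at 0 within {0..}) (\<lambda>t. semigroup_op S p t f x)"
    using PP f x by (simp add: polynomial_process_def)
  then show ?thesis by (simp add: continuous_within semigroup_zero[OF f x])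
qed

text \<open>In the coordinates given by T the semigroup acts by finite matrices; the second part is
  their multiplicativity.\<close>

lemma polynomial_semigroup_expand:
  assumes T: "T \<subseteq> states S" "\<And>j. j \<in> T \<Longrightarrow> e j \<in> poly_space S k" and k: "k \<le> m"
    and span: "\<And>f x. f \<in> poly_space S k \<Longrightarrow> x \<in> states S \<Longrightarrow> f x = (\<Sum>j\<in>T. f j * e j x)"
    and f: "f \<in> poly_space S k" and x: "x \<in> states S" and t: "0 \<le> t"
  shows "semigroup_op S p t f x = (\<Sum>j\<in>T. f j * semigroup_op S p t (e j) x)"
    and "0 \<le> s \<Longrightarrow> semigroup_op S p (t + s) f x = (\<Sum>j\<in>T. semigroup_op S p s f j * semigroup_op S p t (e j) x)"
proof -
  have sub: "h \<in> poly_space S m" if "h \<in> poly_space S k" for h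
    using that poly_space_mono[OF k] by blast
  have lin: "semigroup_op S p t h x = (\<Sum>j\<in>T. h j * semigroup_op S p t (e j) x)"
    if h: "h \<in> poly_space S k" for h
    by (rule semigroup_linear_moment[OF polynomial_moment_function _ x t span[OF h]])
      (auto intro: sub T)
  show "semigroup_op S p t f x = (\<Sum>j\<in>T. f j * semigroup_op S p t (e j) x)" by (rule lin[OF f])
  assume s: "0 \<le> s"
  then show "semigroup_op S p (t + s) f x = (\<Sum>j\<in>T. semigroup_op S p s f j * semigroup_op S p t (e j) x)"
    using semigroup_op_add[OF polynomial_moment_function[OF sub[OF f]] x t s]
      lin[OF polynomial_invariant[OF k f s]] by simp
qed

text \<open>Regularity in time is given only at 0. Applied to the finitely many matrix entries it
  bounds them on a short interval, the semigroup property carries the bound to every bounded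
  interval, and the expansion in T transfers it to all states.\<close>

lemma polynomial_moments_bounded: "moments_bounded"
proof -
  obtain T and e :: "'n state \<Rightarrow> 'n state \<Rightarrow> real" where T: "finite T" "T \<subseteq> states S"
    and e: "\<forall>j\<in>T. e j \<in> poly_space S m" and dual: "\<forall>i\<in>T. \<forall>j\<in>T. e i j = (if i = j then 1 else 0)"
    and span: "\<forall>f\<in>poly_space S m. \<forall>x\<in>states S. f x = (\<Sum>j\<in>T. f j * e j x)"
    using poly_dual_basis[of S m] by (elim exE conjE) (rule that; assumption)
  note e = e[rule_format] and dual = dual[rule_format] and span = span[rule_format]
  have expand: "semigroup_op S p t f x = (\<Sum>j\<in>T. f j * semigroup_op S p t (e j) x)"
    "0 \<le> s \<Longrightarrow> semigroup_op S p (t + s) f x = (\<Sum>j\<in>T. semigroup_op S p s f j * semigroup_op S p t (e j) x)"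
    if "f \<in> poly_space S m" "x \<in> states S" "0 \<le> t" for f x t s
    using that by (auto intro!: polynomial_semigroup_expand[OF T(2) _ order_refl] e span)
  have "eventually (\<lambda>s. \<forall>i\<in>T. \<forall>j\<in>T. \<bar>semigroup_op S p s (e i) j\<bar> < 2) (at 0 within {0..})"
  proof (intro eventually_ball_finite T ballI)
    fix i j assume ij: "i \<in> T" "j \<in> T"
    have "((\<lambda>s. \<bar>semigroup_op S p s (e i) j\<bar>) \<longlongrightarrow> \<bar>e i j\<bar>) (at 0 within {0..})"
      using ij T by (intro tendsto_rabs semigroup_tendsto e) auto
    \<comment> \<open>The entries at time 0 are 0 or 1, so 2 is a strict bound and persists for
      small times.\<close>
    moreover have "\<bar>e i j\<bar> < 2" using dual[OF ij] by auto
    ultimately show "eventually (\<lambda>s. \<bar>semigroup_op S p s (e i) j\<bar> < 2) (at 0 within {0..})"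
      by (rule order_tendstoD)
  qed
  then obtain d where d: "0 < d"
    "\<And>s i j. 0 \<le> s \<Longrightarrow> s \<noteq> 0 \<Longrightarrow> s < d \<Longrightarrow> i \<in> T \<Longrightarrow> j \<in> T \<Longrightarrow> \<bar>semigroup_op S p s (e i) j\<bar> < 2"
    unfolding eventually_at by (auto simp: dist_real_def)
  define \<delta> where "\<delta> = d / 2"
  have \<delta>: "0 < \<delta>" "\<delta> < d" using d by (auto simp: \<delta>_def)
  have small: "\<bar>semigroup_op S p s (e i) j\<bar> \<le> 2" if "0 \<le> s" "s \<le> \<delta>" "i \<in> T" "j \<in> T" for s i j
  proof (cases "s = 0")
    case True
    then show ?thesis using that T by (auto simp: semigroup_zero e dual)
  next
    case False
    then show ?thesis using d(2)[of s i j] that \<delta> by auto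
  qed
  have bounded: "\<exists>K. \<forall>s\<in>{0..real n * \<delta>}. \<forall>i\<in>T. \<forall>j\<in>T. \<bar>semigroup_op S p s (e i) j\<bar> \<le> K" for n
  proof (induction n)
    case 0
    then show ?case using small[of 0] \<delta> by (intro exI[of _ 2]) auto
  next
    case (Suc n)
    then obtain K where K: "\<And>s i j. s \<in> {0..real n * \<delta>} \<Longrightarrow> i \<in> T \<Longrightarrow> j \<in> T \<Longrightarrow> \<bar>semigroup_op S p s (e i) j\<bar> \<le> K"
      by blast
    \<comment> \<open>Splitting off the time \<delta> is a matrix product. The 2 covers times up to
      \<delta>, and the absolute value covers the case of empty T, where K may be negative.\<close>
    have "\<bar>semigroup_op S p s (e i) j\<bar> \<le> max 2 (\<Sum>l\<in>T. \<bar>K\<bar> * 2)"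
      if s: "s \<in> {0..real (Suc n) * \<delta>}" and ij: "i \<in> T" "j \<in> T" for s i j
    proof (cases "s \<le> \<delta>")
      case True
      then show ?thesis using small[of s i j] that by auto
    next
      case False
      have r: "s - \<delta> \<in> {0..real n * \<delta>}" using s False by (auto simp: algebra_simps)
      have "semigroup_op S p (\<delta> + (s - \<delta>)) (e i) j = (\<Sum>l\<in>T. semigroup_op S p (s - \<delta>) (e i) l * semigroup_op S p \<delta> (e l) j)"
        using ij T r \<delta> by (intro expand(2) e) auto
      then have "\<bar>semigroup_op S p s (e i) j\<bar> \<le> (\<Sum>l\<in>T. \<bar>semigroup_op S p (s - \<delta>) (e i) l\<bar> * \<bar>semigroup_op S p \<delta> (e l) j\<bar>)"
        by (simp add: abs_mult[symmetric])
      also have "\<dots> \<le> (\<Sum>l\<in>T. \<bar>K\<bar> * 2)"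
        using K[OF r] small[of \<delta>] \<delta> ij
        by (intro sum_mono mult_mono) (auto intro: order_trans[OF _ abs_ge_self])
      finally show ?thesis by linarith
    qed
    then show ?case by blast
  qed
  show ?thesis
    unfolding moments_bounded_def
  proof (intro ballI allI)
    fix x and t :: real assume x: "x \<in> states S"
    obtain n where n: "t < real n * \<delta>" using reals_Archimedean3[OF \<delta>(1)] by blast
    obtain K where K: "\<forall>s\<in>{0..real n * \<delta>}. \<forall>i\<in>T. \<forall>j\<in>T. \<bar>semigroup_op S p s (e i) j\<bar> \<le> K"
      using bounded by blast
    have "(\<integral>\<omega>. \<phi> (\<omega> s) \<partial>P x) \<le> (\<Sum>j\<in>T. \<bar>\<phi> j\<bar> * (\<Sum>l\<in>T. K * \<bar>e l x\<bar>))" if s: "s \<in> {0..t}" for s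
    proof -
      have s0: "0 \<le> s" using s by auto
      have ej: "\<bar>semigroup_op S p s (e j) x\<bar> \<le> (\<Sum>l\<in>T. K * \<bar>e l x\<bar>)" if j: "j \<in> T" for j
      proof -
        have "semigroup_op S p s (e j) x = (\<Sum>l\<in>T. semigroup_op S p s (e j) l * e l x)"
          by (intro span polynomial_invariant e j x order_refl s0)
        also have "\<bar>\<dots>\<bar> \<le> (\<Sum>l\<in>T. K * \<bar>e l x\<bar>)"
          using K j s n by (intro order_trans[OF sum_abs] sum_mono) (auto simp: abs_mult intro!: mult_right_mono)
        finally show ?thesis .
      qed
      have "(\<integral>\<omega>. \<phi> (\<omega> s) \<partial>P x) = (\<Sum>j\<in>T. \<phi> j * semigroup_op S p s (e j) x)"
        using semigroup_op_poly[OF \<phi>_poly x s0] expand(1)[OF \<phi>_poly x s0] by simp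
      also have "\<dots> \<le> (\<Sum>j\<in>T. \<bar>\<phi> j\<bar> * (\<Sum>l\<in>T. K * \<bar>e l x\<bar>))"
      proof (rule sum_mono)
        fix j assume "j \<in> T"
        then have "\<bar>\<phi> j * semigroup_op S p s (e j) x\<bar> \<le> \<bar>\<phi> j\<bar> * (\<Sum>l\<in>T. K * \<bar>e l x\<bar>)"
          using ej by (auto simp: abs_mult intro!: mult_left_mono)
        then show "\<phi> j * semigroup_op S p s (e j) x \<le> \<bar>\<phi> j\<bar> * (\<Sum>l\<in>T. K * \<bar>e l x\<bar>)"
          by linarith
      qed
      finally show ?thesis .
    qed
    moreover have "integrable (P x) (\<lambda>\<omega>. \<phi> (\<omega> s))" if "s \<in> {0..t}" for s
      using polynomial_moment_function[OF \<phi>_poly] x that by (auto simp: moment_function_def)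
    ultimately show "\<exists>B. \<forall>s\<in>{0..t}. integrable (P x) (\<lambda>\<omega>. \<phi> (\<omega> s)) \<and> (\<integral>\<omega>. \<phi> (\<omega> s) \<partial>P x) \<le> B"
      by blast
  qed
qed

text \<open>
  The time averages of \<open>P\<^sub>s f\<close> lie in the domain of the generator and approximate \<open>f\<close>; in finite
  dimensions a dense subspace is everything.
\<close>

lemma polynomial_dynkin:
  assumes k: "k \<le> m" and f: "f \<in> poly_space S k"
  shows "\<exists>g\<in>poly_space S k. dynkin f g"
proof -
  note MB = polynomial_moments_bounded
  obtain T and e :: "'n state \<Rightarrow> 'n state \<Rightarrow> real" where T: "finite T" "T \<subseteq> states S"
    and e: "\<forall>j\<in>T. e j \<in> poly_space S k" and dual: "\<forall>i\<in>T. \<forall>j\<in>T. e i j = (if i = j then 1 else 0)"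
    and span: "\<forall>f\<in>poly_space S k. \<forall>x\<in>states S. f x = (\<Sum>j\<in>T. f j * e j x)"
    using poly_dual_basis[of S k] by (elim exE conjE) (rule that; assumption)
  note e = e[rule_format] and dual = dual[rule_format] and span = span[rule_format]
  have sub: "h \<in> poly_space S m" if "h \<in> poly_space S k" for h
    using that poly_space_mono[OF k] by blast
  define W where "W = {f \<in> poly_space S k. \<exists>g\<in>poly_space S k. dynkin f g}"
  have W_sum: "(\<lambda>x. \<Sum>j\<in>I. a j * w j x) \<in> W" if w: "\<And>j. j \<in> I \<Longrightarrow> w j \<in> W"
    for I :: "'i set" and a w
  proof -
    have "\<forall>j\<in>I. \<exists>h. h \<in> poly_space S k \<and> dynkin (w j) h" using w by (auto simp: W_def)
    then obtain g where g: "\<forall>j\<in>I. g j \<in> poly_space S k \<and> dynkin (w j) (g j)"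
      by (elim bchoice[elim_format] exE) (rule that)
    have wP: "\<And>j. j \<in> I \<Longrightarrow> w j \<in> poly_space S k" using w by (auto simp: W_def)
    have "dynkin (\<lambda>x. \<Sum>j\<in>I. a j * w j x) (\<lambda>x. \<Sum>j\<in>I. a j * g j x)"
      using g wP sub by (intro dynkin_sum[OF MB]) auto
    moreover have "(\<lambda>x. \<Sum>j\<in>I. a j * g j x) \<in> poly_space S k" using g by (intro poly_space_sum) auto
    moreover have "(\<lambda>x. \<Sum>j\<in>I. a j * w j x) \<in> poly_space S k" using wP by (intro poly_space_sum) auto
    ultimately show ?thesis by (auto simp: W_def)
  qed
  have W_combo: "(\<lambda>x. a * u x + c * v x) \<in> W" if "u \<in> W" "v \<in> W" for u v a c
  proof -
    have "(\<lambda>x. \<Sum>b\<in>UNIV. (if b then a else c) * (if b then u else v) x) \<in> W"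
      using that by (intro W_sum) auto
    then show ?thesis by (simp add: UNIV_bool add.commute)
  qed
  have W_zero: "(\<lambda>_. 0) \<in> W" using W_sum[of "{} :: nat set"] by simp
  \<comment> \<open>The average of P_s f over \<open>{0..h}\<close>, written through the dual basis
    so that it visibly lies in \<open>poly_space S k\<close>; \<open>V_eq\<close> recovers the
    pointwise average.\<close>
  have average: "(\<lambda>x. \<Sum>j\<in>T. (1 / h * (LINT s:{0..h}|lborel. semigroup_op S p s f j)) * e j x) \<in> W"
    (is "?V \<in> W") if f: "f \<in> poly_space S k" and h: "0 < h" for f h
  proof -
    let ?u = "\<lambda>x s. semigroup_op S p s f x"
    let ?c = "\<lambda>j. 1 / h * (LINT s:{0..h}|lborel. ?u j s)"
    \<comment> \<open>The difference quotient (P_h f - f) / h is the image of the average under the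
      generator: both sides of Dynkin's formula telescope to the same integrals of P_s f.\<close>
    define g where "g x = (1 / h) * semigroup_op S p h f x + (- 1 / h) * f x" for x
    have u_int: "set_integrable lborel {0..t} (?u x)" if "x \<in> states S" for x t
      by (rule semigroup_time_integrable[OF MB sub[OF f] that])
    have gP: "g \<in> poly_space S k"
      unfolding g_def[abs_def] using h by (intro poly_space_combo polynomial_invariant k f) auto
    have VP: "?V \<in> poly_space S k" by (intro poly_space_sum e)
    have swap: "(\<Sum>j\<in>T. ?c j * b j) = 1 / h * (LINT s:{0..h}|lborel. (\<Sum>j\<in>T. ?u j s * b j))" for b
    proof -
      have "(LINT s:{0..h}|lborel. (\<Sum>j\<in>T. ?u j s * b j)) = (\<Sum>j\<in>T. LINT s:{0..h}|lborel. ?u j s * b j)"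
        using T u_int by (intro set_integral_sum set_integrable_mult_left impI) auto
      then show ?thesis by (simp add: sum_distrib_left mult.assoc)
    qed
    have V_eq: "?V x = 1 / h * (LINT s:{0..h}|lborel. ?u x s)" if x: "x \<in> states S" for x
      unfolding swap
      using span[OF polynomial_invariant[OF k f] x]
      by (intro arg_cong2[where f = "(*)"] set_lebesgue_integral_cong) auto
    have "dynkin ?V g"
      unfolding dynkin_def
    proof (intro ballI allI impI)
      fix x t assume x: "x \<in> states S" and t: "0 \<le> (t :: real)"
      have "semigroup_op S p t ?V x = (\<Sum>j\<in>T. ?c j * semigroup_op S p t (e j) x)"
        by (rule semigroup_linear[OF MB _ x t]) (auto intro: sub e)
      also have "\<dots> = 1 / h * (LINT s:{0..h}|lborel. (\<Sum>j\<in>T. ?u j s * semigroup_op S p t (e j) x))"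
        by (rule swap)
      also have "(LINT s:{0..h}|lborel. (\<Sum>j\<in>T. ?u j s * semigroup_op S p t (e j) x)) = (LINT s:{0..h}|lborel. ?u x (t + s))"
      proof (intro set_lebesgue_integral_cong allI impI)
        fix s assume "s \<in> {0..h}"
        then have "0 \<le> s" by simp
        then show "(\<Sum>j\<in>T. ?u j s * semigroup_op S p t (e j) x) = ?u x (t + s)"
          by (intro polynomial_semigroup_expand(2)[OF T(2) _ k _ f x t, symmetric] e span)
      qed simp
      also have "\<dots> = (LINT s:{0..t + h}|lborel. ?u x s) - (LINT s:{0..t}|lborel. ?u x s)"
        using h t by (intro set_integral_shift u_int x) auto
      finally have lhs: "semigroup_op S p t ?V x
          = 1 / h * ((LINT s:{0..t + h}|lborel. ?u x s) - (LINT s:{0..t}|lborel. ?u x s))" .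
      have g_eq: "semigroup_op S p s g x = 1 / h * (?u x (h + s) - ?u x s)" if s: "s \<in> {0..t}" for s
      proof -
        have "semigroup_op S p s g x = (\<Sum>b\<in>UNIV. (if b then 1 / h else - 1 / h) *
            semigroup_op S p s (if b then semigroup_op S p h f else f) x)"
          using s h by (intro semigroup_linear[OF MB _ x])
            (auto simp: UNIV_bool g_def intro: sub f sub[OF polynomial_invariant[OF k f]])
        then show ?thesis
          using semigroup_op_add[OF polynomial_moment_function[OF sub[OF f]] x, of s h] s h
          by (simp add: UNIV_bool add.commute algebra_simps diff_divide_distrib)
      qed
      have "(LINT s:{0..t}|lborel. semigroup_op S p s g x) = (LINT s:{0..t}|lborel. 1 / h * (?u x (h + s) - ?u x s))"
        using g_eq by (intro set_lebesgue_integral_cong) auto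
      also have "\<dots> = 1 / h * ((LINT s:{0..t}|lborel. ?u x (h + s)) - (LINT s:{0..t}|lborel. ?u x s))"
        using h t set_integral_diff(2)[OF set_integral_shift(1)[of h t "?u x"] u_int[OF x]] u_int[OF x] by simp
      also have "(LINT s:{0..t}|lborel. ?u x (h + s)) = (LINT s:{0..h + t}|lborel. ?u x s) - (LINT s:{0..h}|lborel. ?u x s)"
        using h t by (intro set_integral_shift u_int x) auto
      finally show "semigroup_op S p t ?V x = ?V x + (LINT s:{0..t}|lborel. semigroup_op S p s g x)"
        unfolding lhs V_eq[OF x] by (simp add: algebra_simps add.commute)
    qed
    then show ?thesis using VP gP by (auto simp: W_def)
  qed
  have "\<exists>w. \<forall>i\<in>T. w i \<in> W \<and> (\<forall>j\<in>T. w i j = (if i = j then 1 else 0))"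
  proof (rule dual_basis_of_dense[OF W_combo W_zero T(1)])
    fix i assume i: "i \<in> T"
    define h where "h n = inverse (real (Suc n))" for n
    define V where "V n = (\<lambda>x. \<Sum>j\<in>T. (1 / h n * (LINT s:{0..h n}|lborel. semigroup_op S p s (e i) j)) * e j x)" for n
    have "V n \<in> W" for n unfolding V_def by (intro average e i) (simp add: h_def)
    moreover have "(\<lambda>n. V n j) \<longlonglongrightarrow> (if i = j then 1 else 0)" if j: "j \<in> T" for j
    proof -
      have "V n j = 1 / h n * (LINT s:{0..h n}|lborel. semigroup_op S p s (e i) j)" for n
      proof -
        have "V n j = (\<Sum>l\<in>T. if l = j then 1 / h n * (LINT s:{0..h n}|lborel. semigroup_op S p s (e i) l) else 0)"
          unfolding V_def using j by (intro sum.cong refl) (auto simp: dual)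
        then show ?thesis using T j by simp
      qed
      moreover have "(\<lambda>n. 1 / h n * (LINT s:{0..h n}|lborel. semigroup_op S p s (e i) j)) \<longlonglongrightarrow> e i j"
        unfolding h_def using j T i
        by (intro right_average_tendsto semigroup_time_integrable[OF MB] semigroup_tendsto sub e) auto
      ultimately show ?thesis using dual[OF i j] by simp
    qed
    ultimately show "\<exists>g. (\<forall>n. g n \<in> W) \<and> (\<forall>j\<in>T. (\<lambda>n. g n j) \<longlonglongrightarrow> (if i = j then 1 else 0))"
      by blast
  qed
  then obtain w where w': "\<forall>i\<in>T. w i \<in> W \<and> (\<forall>j\<in>T. w i j = (if i = j then 1 else 0))"
    by (elim exE) (rule that)
  have w: "\<And>i. i \<in> T \<Longrightarrow> w i \<in> W" and wd: "\<And>i j. i \<in> T \<Longrightarrow> j \<in> T \<Longrightarrow> w i j = (if i = j then 1 else 0)"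
    using w' by simp_all
  \<comment> \<open>A polynomial is determined by its values on T, so the dual functions found in W
    are the \<open>e i\<close> themselves and W exhausts the space.\<close>
  have w_eq: "w i x = e i x" if i: "i \<in> T" and x: "x \<in> states S" for i x
  proof -
    have "w i \<in> poly_space S k" using w[OF i] by (auto simp: W_def)
    then have "w i x = (\<Sum>j\<in>T. w i j * e j x)" using span x by blast
    also have "\<dots> = (\<Sum>j\<in>T. if j = i then e j x else 0)" using i wd by (intro sum.cong) auto
    finally show ?thesis using T i by simp
  qed
  have "(\<lambda>x. \<Sum>j\<in>T. f j * w j x) \<in> W" using w by (intro W_sum)
  then obtain g where g: "g \<in> poly_space S k" "dynkin (\<lambda>x. \<Sum>j\<in>T. f j * w j x) g" by (auto simp: W_def)
  have "dynkin f g"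
  proof (rule dynkin_cong[OF g(2)])
    fix z assume z: "z \<in> states S"
    show "f z = (\<Sum>j\<in>T. f j * w j z)"
      using z by (subst span[OF f z], intro sum.cong refl) (simp add: w_eq)
  qed simp
  with g(1) show ?thesis by blast
qed

end

end

section \<open>Non-explosion\<close>

lemma cadlag_cong:
  assumes "\<And>t :: real. 0 \<le> t \<Longrightarrow> v t = w t" and "cadlag T w"
  shows "cadlag T v"
proof -
  have "limitin T v (v t) (at_right t)" if t: "0 \<le> t" for t
  proof -
    have "eventually (\<lambda>s. w s = v s) (at_right t)"
      using eventually_at_right_less[of t] by eventually_elim (use assms t in auto)
    moreover have "limitin T w (v t) (at_right t)" using assms t by (auto simp: cadlag_def)
    ultimately show ?thesis by (rule limitin_transform_eventually)
  qed
  moreover have "\<exists>l. limitin T v l (at_left t)" if t: "0 < t" for t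
  proof -
    have "eventually (\<lambda>s. w s = v s) (at_left t)"
      using eventually_at_left_real[OF t] by eventually_elim (use assms in auto)
    moreover have "\<exists>l. limitin T w l (at_left t)" using assms(2) t by (simp add: cadlag_def)
    then obtain l where "limitin T w l (at_left t)" ..
    ultimately have "limitin T v l (at_left t)" by (rule limitin_transform_eventually)
    then show ?thesis ..
  qed
  ultimately show ?thesis by (simp add: cadlag_def)
qed

lemma cadlag_diff_Lipschitz:
  fixes u I :: "real \<Rightarrow> real"
  assumes u: "\<And>t. 0 \<le> t \<Longrightarrow> (u \<longlongrightarrow> u t) (at_right t)" "\<And>t. 0 < t \<Longrightarrow> \<exists>l. (u \<longlongrightarrow> l) (at_left t)"
    and I: "continuous_on {0..} I"
  shows "cadlag euclidean (\<lambda>t. u t - c - I t)"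
proof -
  have r: "(I \<longlongrightarrow> I t) (at_right t)" if "0 \<le> t" for t
  proof -
    have "(I \<longlongrightarrow> I t) (at t within {0..})" using I that by (simp add: continuous_on_def)
    then show ?thesis by (rule tendsto_within_subset) (use that in auto)
  qed
  have l: "(I \<longlongrightarrow> I t) (at_left t)" if t: "0 < t" for t
  proof -
    have "(I \<longlongrightarrow> I t) (at t within {0..})" using I t by (simp add: continuous_on_def)
    then have "(I \<longlongrightarrow> I t) (at t within {0<..})" by (rule tendsto_within_subset) auto
    then have "(I \<longlongrightarrow> I t) (at t)" using t by (simp add: at_within_open[of t "{0<..}"])
    then show ?thesis by (rule filterlim_mono) (auto simp: at_le)
  qed
  show ?thesis
    unfolding cadlag_def limitin_canonical_iff
  proof (intro conjI allI impI)
    fix t :: real assume t: "0 \<le> t"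
    show "((\<lambda>t. u t - c - I t) \<longlongrightarrow> u t - c - I t) (at_right t)"
      by (intro tendsto_intros u r t)
  next
    fix t :: real assume t: "0 < t"
    obtain b where "(u \<longlongrightarrow> b) (at_left t)" using u(2)[OF t] by blast
    then have "((\<lambda>t. u t - c - I t) \<longlongrightarrow> b - c - I t) (at_left t)"
      by (intro tendsto_intros l t)
    then show "\<exists>b. ((\<lambda>t. u t - c - I t) \<longlongrightarrow> b) (at_left t)" by blast
  qed
qed

section \<open>Maximal inequality and pathwise bounds\<close>

context polynomial_setting
begin

text \<open>The hypothesis \<open>lower\<close> is a submartingale property up to the factor K; by
  the Markov property it lets a later time dominate an earlier one on every event of the earlier
  time.\<close>

lemma \<phi>_conditional_lower:
  assumes PM: "moment_function \<phi>" and x: "x \<in> states S" and st: "0 \<le> s" "s \<le> t"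
    and lower: "\<And>z. z \<in> states S \<Longrightarrow> \<phi> z \<le> K * semigroup_op S p (t - s) \<phi> z"
    and A: "A \<in> sets (F s)"
  shows "(\<integral>\<omega>. indicator A \<omega> * \<phi> (\<omega> s) \<partial>P x) \<le> K * (\<integral>\<omega>. indicator A \<omega> * \<phi> (\<omega> t) \<partial>P x)"
proof -
  have AP: "A \<in> sets (P x)" by (rule sets_F_subset[OF x st(1) A])
  have i1: "integrable (P x) (\<lambda>\<omega>. indicator A \<omega> * \<phi> (\<omega> s))"
    using integrable_mult_indicator[OF AP, of "\<lambda>\<omega>. \<phi> (\<omega> s)"] PM x st by (simp add: moment_function_def)
  have i2: "integrable (P x) (\<lambda>\<omega>. indicator A \<omega> * semigroup_op S p (t - s) \<phi> (\<omega> s))"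
    using integrable_mult_indicator[OF AP markov_integral(1)[OF PM x st(1), of "t - s"]] st by simp
  have "(\<integral>\<omega>. indicator A \<omega> * \<phi> (\<omega> s) \<partial>P x) \<le> (\<integral>\<omega>. K * (indicator A \<omega> * semigroup_op S p (t - s) \<phi> (\<omega> s)) \<partial>P x)"
    using lower path_P[OF x _ st(1)]
    by (intro integral_mono i1 integrable_mult_right i2) (auto simp: indicator_def)
  also have "\<dots> = K * (\<integral>\<omega>. indicator A \<omega> * semigroup_op S p (t - s) \<phi> (\<omega> s) \<partial>P x)" by simp
  also have "(\<integral>\<omega>. indicator A \<omega> * semigroup_op S p (t - s) \<phi> (\<omega> s) \<partial>P x) = (\<integral>\<omega>. indicator A \<omega> * \<phi> (\<omega> t) \<partial>P x)"
    using markov_integral(2)[OF PM x st(1) _ A, of "t - s"] st by simp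
  finally show ?thesis .
qed

lemma observable_level_sets:
  assumes "0 \<le> r"
  shows "{\<omega> \<in> path_space S. \<phi> (\<omega> r) > l} \<in> sets (F r)" "{\<omega> \<in> path_space S. \<phi> (\<omega> r) \<le> l} \<in> sets (F r)"
  using observable_measurable_F[OF poly_space_borel[OF \<phi>_poly] assms order_refl]
    borel_measurable_iff_greater[of "\<lambda>\<omega>. \<phi> (\<omega> r)" "F r"] borel_measurable_iff_le[of "\<lambda>\<omega>. \<phi> (\<omega> r)" "F r"]
  by (auto simp: space_F)

text \<open>Doob's argument with the factor K: decompose by the first time in R at which the level
  is exceeded and compare with the endpoint \<open>a + h\<close> on each piece.\<close>

lemma maximal_inequality:
  assumes PM: "moment_function \<phi>" and x: "x \<in> states S" and a: "0 \<le> a" and K: "0 \<le> K"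
    and lower: "\<And>r z. r \<in> {0..h} \<Longrightarrow> z \<in> states S \<Longrightarrow> \<phi> z \<le> K * semigroup_op S p r \<phi> z"
    and R: "finite R" "R \<subseteq> {a..a + h}" and l: "0 < l"
  shows "measure (P x) {\<omega> \<in> path_space S. \<exists>r\<in>R. \<phi> (\<omega> r) > l} \<le> K * (\<integral>\<omega>. \<phi> (\<omega> (a + h)) \<partial>P x) / l"
proof (cases "R = {}")
  case True
  then show ?thesis using l K by (simp add: integral_nonneg_AE \<phi>_nonneg)
next
  case False
  interpret prob_space "P x" using prob[OF x] .
  \<comment> \<open>First exceedance at r. It looks only at times up to r, hence lies in
    \<open>F r\<close>, and different r give disjoint events.\<close>
  define A where "A r = {\<omega> \<in> path_space S. \<phi> (\<omega> r) > l \<and> (\<forall>q\<in>R. q < r \<longrightarrow> \<phi> (\<omega> q) \<le> l)}" for r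
  have R0: "0 \<le> r" if "r \<in> R" for r using R a that by auto
  have h: "0 \<le> h" using False R by fastforce
  have AF: "A r \<in> sets (F r)" if r: "r \<in> R" for r
  proof -
    have fin: "finite {q\<in>R. q < r}" using R by auto
    have eq: "A r = {\<omega> \<in> path_space S. \<phi> (\<omega> r) > l} \<inter> {\<omega> \<in> space (F r). \<forall>q\<in>{q\<in>R. q < r}. \<phi> (\<omega> q) \<le> l}"
      by (auto simp: A_def space_F)
    have "{\<omega> \<in> space (F r). \<phi> (\<omega> q) \<le> l} \<in> sets (F r)" if "q \<in> {q\<in>R. q < r}" for q
      using observable_level_sets(2)[of q] sets_F_mono[of q r] R0 that by (auto simp: space_F)
    then have "{\<omega> \<in> space (F r). \<forall>q\<in>{q\<in>R. q < r}. \<phi> (\<omega> q) \<le> l} \<in> sets (F r)"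
      using fin by (rule sets.sets_Collect_finite_All)
    then show ?thesis unfolding eq by (rule sets.Int[OF observable_level_sets(1)[OF R0[OF r]]])
  qed
  have AP: "A r \<in> sets (P x)" if "r \<in> R" for r by (rule sets_F_subset[OF x R0[OF that] AF[OF that]])
  have union: "{\<omega> \<in> path_space S. \<exists>r\<in>R. \<phi> (\<omega> r) > l} = (\<Union>r\<in>R. A r)"
  proof (intro equalityI subsetI)
    fix \<omega> assume "\<omega> \<in> {\<omega> \<in> path_space S. \<exists>r\<in>R. \<phi> (\<omega> r) > l}"
    then have w: "\<omega> \<in> path_space S" and ne: "{r\<in>R. \<phi> (\<omega> r) > l} \<noteq> {}" by auto
    define r where "r = Min {r\<in>R. \<phi> (\<omega> r) > l}"
    have "r \<in> {r\<in>R. \<phi> (\<omega> r) > l}" unfolding r_def using R ne by (intro Min_in) auto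
    moreover have "\<phi> (\<omega> q) \<le> l" if "q \<in> R" "q < r" for q
    proof (rule ccontr)
      assume "\<not> \<phi> (\<omega> q) \<le> l"
      then have "r \<le> q" unfolding r_def using R that by (intro Min_le) auto
      then show False using that by simp
    qed
    ultimately show "\<omega> \<in> (\<Union>r\<in>R. A r)" using w by (auto simp: A_def)
  qed (auto simp: A_def)
  have le1: "(\<Sum>r\<in>R. indicator (A r) \<omega>) \<le> (1 :: real)" for \<omega>
  proof (cases "\<exists>r0\<in>R. \<omega> \<in> A r0")
    case True
    then obtain r0 where r0: "r0 \<in> R" "\<omega> \<in> A r0" by blast
    have "(\<Sum>r\<in>R. indicator (A r) \<omega>) = (\<Sum>r\<in>R. if r = r0 then 1 else (0 :: real))"
    proof (intro sum.cong refl)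
      fix r assume r: "r \<in> R"
      show "indicator (A r) \<omega> = (if r = r0 then 1 else (0 :: real))"
      proof (cases r r0 rule: linorder_cases)
        case less
        then have "\<omega> \<notin> A r" using r0 r by (auto simp: A_def)
        then show ?thesis using less by simp
      next
        case greater
        then have "\<omega> \<notin> A r" using r0 r by (auto simp: A_def)
        then show ?thesis using greater by simp
      qed (use r0 in simp)
    qed
    then show ?thesis using R r0 by simp
  next
    case False
    then have "(\<Sum>r\<in>R. indicator (A r) \<omega>) = (0 :: real)" by (intro sum.neutral) auto
    then show ?thesis by simp
  qed
  have mom: "integrable (P x) (\<lambda>\<omega>. \<phi> (\<omega> s))" if "0 \<le> s" for s
    using PM x that by (simp add: moment_function_def)
  have int: "integrable (P x) (\<lambda>\<omega>. indicator (A r) \<omega> * \<phi> (\<omega> s))" if "0 \<le> s" "r \<in> R" for r s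
    using integrable_mult_indicator[OF AP mom] that by simp
  have "l * measure (P x) (A r) \<le> K * (\<integral>\<omega>. indicator (A r) \<omega> * \<phi> (\<omega> (a + h)) \<partial>P x)" if r: "r \<in> R" for r
  proof -
    have int_l: "integrable (P x) (\<lambda>\<omega>. indicator (A r) \<omega> * l)"
      using AP[OF r] by (intro integrable_mult_left integrable_real_indicator) (simp_all add: less_top[symmetric])
    have "l * measure (P x) (A r) = (\<integral>\<omega>. indicator (A r) \<omega> * l \<partial>P x)"
      using AP[OF r] by (simp add: mult.commute)
    also have "\<dots> \<le> (\<integral>\<omega>. indicator (A r) \<omega> * \<phi> (\<omega> r) \<partial>P x)"
    proof (rule integral_mono[OF int_l int[OF R0[OF r] r]])
      show "indicator (A r) \<omega> * l \<le> indicator (A r) \<omega> * \<phi> (\<omega> r)" for \<omega>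
        by (auto simp: indicator_def A_def)
    qed
    also have "\<dots> \<le> K * (\<integral>\<omega>. indicator (A r) \<omega> * \<phi> (\<omega> (a + h)) \<partial>P x)"
      using R r by (intro \<phi>_conditional_lower[OF PM x R0 _ lower AF]) auto
    finally show ?thesis .
  qed
  then have "(\<Sum>r\<in>R. l * measure (P x) (A r)) \<le> (\<Sum>r\<in>R. K * (\<integral>\<omega>. indicator (A r) \<omega> * \<phi> (\<omega> (a + h)) \<partial>P x))"
    by (rule sum_mono)
  also have "\<dots> = K * (\<integral>\<omega>. (\<Sum>r\<in>R. indicator (A r) \<omega> * \<phi> (\<omega> (a + h))) \<partial>P x)"
    using int a h by (simp add: sum_distrib_left Bochner_Integration.integral_sum)
  also have "\<dots> \<le> K * (\<integral>\<omega>. \<phi> (\<omega> (a + h)) \<partial>P x)"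
  proof (intro mult_left_mono K integral_mono Bochner_Integration.integrable_sum int mom)
    show "(\<Sum>r\<in>R. indicator (A r) \<omega> * \<phi> (\<omega> (a + h))) \<le> \<phi> (\<omega> (a + h))" for \<omega>
      using mult_right_mono[OF le1 \<phi>_nonneg] by (simp add: sum_distrib_right)
  qed (use a h in auto)
  finally have "l * (\<Sum>r\<in>R. measure (P x) (A r)) \<le> K * (\<integral>\<omega>. \<phi> (\<omega> (a + h)) \<partial>P x)"
    by (simp add: sum_distrib_left)
  moreover have "measure (P x) (\<Union>r\<in>R. A r) \<le> (\<Sum>r\<in>R. measure (P x) (A r))"
    using R AP by (intro measure_UNION_le) auto
  ultimately have "l * measure (P x) (\<Union>r\<in>R. A r) \<le> K * (\<integral>\<omega>. \<phi> (\<omega> (a + h)) \<partial>P x)"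
    using l by (meson mult_left_mono less_imp_le order_trans)
  then show ?thesis unfolding union using l by (simp add: pos_le_divide_eq mult.commute)
qed

text \<open>The maximal inequality passes from finite sets to all rational times by monotone limits,
  and the level tends to infinity. Right continuity of \<open>\<phi>\<close> along the path then
  reaches all times.\<close>

lemma bounded_on_rationals:
  assumes PM: "moment_function \<phi>" and x: "x \<in> states S" and a: "0 \<le> a" and K: "0 \<le> K" and h: "0 < h"
    and lower: "\<And>r z. r \<in> {0..h} \<Longrightarrow> z \<in> states S \<Longrightarrow> \<phi> z \<le> K * semigroup_op S p r \<phi> z"
  shows "AE \<omega> in P x. \<exists>l. \<forall>s\<in>{a..<a + h}. \<phi> (\<omega> s) \<le> l"
proof -
  interpret prob_space "P x" using prob[OF x] .
  let ?D = "\<rat> \<inter> {a<..<a + h}"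
  let ?B = "K * (\<integral>\<omega>. \<phi> (\<omega> (a + h)) \<partial>P x)"
  have D: "countable ?D" by (simp add: countable_rat)
  obtain q0 where "q0 \<in> \<rat>" "a < q0" "q0 < a + h" using Rats_dense_in_real[of a "a + h"] h by auto
  then have ne: "?D \<noteq> {}" by auto
  define q where "q = from_nat_into ?D"
  have q: "range q = ?D" unfolding q_def by (rule range_from_nat_into[OF ne D])
  define E where "E l n = {\<omega> \<in> path_space S. \<exists>r\<in>q ` {..n}. \<phi> (\<omega> r) > l}" for l n
  have qD: "q i \<in> ?D" for i unfolding q[symmetric] by (rule rangeI)
  have qpos: "0 \<le> q i" for i using qD[of i] a by auto
  have EP: "E l n \<in> sets (P x)" for l n
  proof -
    have "E l n = (\<Union>i\<in>{..n}. {\<omega> \<in> path_space S. \<phi> (\<omega> (q i)) > l})" by (auto simp: E_def)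
    moreover have "{\<omega> \<in> path_space S. \<phi> (\<omega> (q i)) > l} \<in> sets (P x)" for i
      by (rule sets_F_subset[OF x qpos observable_level_sets(1)[OF qpos]])
    ultimately show ?thesis by (simp add: sets.finite_UN)
  qed
  have bound: "measure (P x) (\<Union>n. E l n) \<le> ?B / l" if l: "0 < l" for l
  proof (rule LIMSEQ_le_const2[OF finite_Lim_measure_incseq])
    show "range (E l) \<subseteq> sets (P x)" using EP by auto
    show "incseq (E l)" by (auto simp: incseq_def E_def intro: order_trans)
    have "measure (P x) (E l n) \<le> ?B / l" for n
      unfolding E_def
    proof (rule maximal_inequality[OF PM x a K lower _ _ l])
      show "q ` {..n} \<subseteq> {a..a + h}" using qD by (auto simp: image_subset_iff less_imp_le)
    qed auto
    then show "\<exists>N. \<forall>n\<ge>N. measure (P x) (E l n) \<le> ?B / l" by blast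
  qed
  \<comment> \<open>On Z the supremum over the rational times is infinite.\<close>
  define Z where "Z = (\<Inter>l :: nat. \<Union>n. E (real (Suc l)) n)"
  have ZP: "Z \<in> sets (P x)" unfolding Z_def using EP by auto
  have "measure (P x) Z \<le> ?B / real (Suc l)" for l
  proof -
    have "measure (P x) Z \<le> measure (P x) (\<Union>n. E (real (Suc l)) n)"
      unfolding Z_def using EP by (intro finite_measure_mono sets.countable_UN) auto
    also have "\<dots> \<le> ?B / real (Suc l)" by (rule bound) simp
    finally show ?thesis .
  qed
  moreover have "(\<lambda>l. ?B / real (Suc l)) \<longlonglongrightarrow> 0"
    using tendsto_mult_right_zero[OF LIMSEQ_inverse_real_of_nat, of ?B] by (simp add: divide_inverse)
  ultimately have "measure (P x) Z \<le> 0"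
    by (intro LIMSEQ_le_const) auto
  then have "Z \<in> null_sets (P x)"
    using ZP by (simp add: null_sets_def emeasure_eq_measure measure_le_0_iff)
  then have "AE \<omega> in P x. \<omega> \<notin> Z" by (rule AE_not_in)
  with AE_space show ?thesis
  proof eventually_elim
    case (elim \<omega>)
    then have w: "\<omega> \<in> path_space S" by (simp add: space_P[OF x])
    from elim(2) obtain l where "\<forall>n. \<omega> \<notin> E (real (Suc l)) n" by (auto simp: Z_def)
    then have le: "\<phi> (\<omega> (q n)) \<le> real (Suc l)" for n
      using w unfolding E_def by (auto simp: not_less)
    have "\<phi> (\<omega> s) \<le> real (Suc l)" if s: "s \<in> {a..<a + h}" for s
    proof (rule ccontr)
      assume "\<not> \<phi> (\<omega> s) \<le> real (Suc l)"
      then have gt: "\<phi> (\<omega> s) > real (Suc l)" by simp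
      \<comment> \<open>A level exceeded at s is also exceeded at rational times just after s. They
        have to lie below \<open>a + h\<close>, which is why the interval is half-open.\<close>
      have "((\<lambda>s. \<phi> (\<omega> s)) \<longlongrightarrow> \<phi> (\<omega> s)) (at_right s)"
        using s a by (intro path_right_continuous[OF w _ \<phi>_poly]) auto
      then have "eventually (\<lambda>r. \<phi> (\<omega> r) > real (Suc l)) (at_right s)"
        using gt by (rule order_tendstoD)
      then obtain b where b: "b > s" "\<And>r. s < r \<Longrightarrow> r < b \<Longrightarrow> \<phi> (\<omega> r) > real (Suc l)"
        by (auto simp: eventually_at_right_field)
      obtain r where r: "r \<in> \<rat>" "s < r" "r < min b (a + h)"
        using Rats_dense_in_real[of s "min b (a + h)"] b s by auto
      then have "r \<in> range q" using s unfolding q by auto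
      then obtain n where "r = q n" by blast
      then show False using le[of n] b(2)[of r] r by auto
    qed
    then show ?case by blast
  qed
qed

text \<open>Countably many half-open intervals of length h cover the half-line, and finitely many of
  them cover \<open>{0..T}\<close>; the bound depends on the path.\<close>

lemma no_explosion:
  assumes PM: "moment_function \<phi>" and x: "x \<in> states S" and K: "0 \<le> K" and h: "0 < h"
    and lower: "\<And>r z. r \<in> {0..h} \<Longrightarrow> z \<in> states S \<Longrightarrow> \<phi> z \<le> K * semigroup_op S p r \<phi> z"
  shows "AE \<omega> in P x. \<forall>T. \<exists>c. \<forall>s\<in>{0..T}. \<phi> (\<omega> s) \<le> c"
proof -
  have "AE \<omega> in P x. \<forall>k :: nat. \<exists>l. \<forall>s\<in>{real k * h..<real k * h + h}. \<phi> (\<omega> s) \<le> l"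
    unfolding AE_all_countable using h
    by (intro allI bounded_on_rationals[OF PM x _ K h lower]) auto
  then show ?thesis
  proof eventually_elim
    case (elim \<omega>)
    then obtain l where l: "\<And>k s. s \<in> {real k * h..<real k * h + h} \<Longrightarrow> \<phi> (\<omega> s) \<le> l k" by metis
    show ?case
    proof
      fix T :: real
      obtain n where n: "T < real n * h" using reals_Archimedean3[OF h] by blast
      have "\<phi> (\<omega> s) \<le> (\<Sum>k<n. \<bar>l k\<bar>)" if s: "s \<in> {0..T}" for s
      proof -
        define k where "k = nat \<lfloor>s / h\<rfloor>"
        have sh: "0 \<le> s / h" using s h by auto
        then have k: "real k \<le> s / h" "s / h < real k + 1" unfolding k_def by linarith+
        then have ks: "real k * h \<le> s" "s < real k * h + h" using h by (auto simp: field_simps)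
        have "s \<le> T" using s by simp
        then have "real k * h < real n * h" using ks(1) n by linarith
        then have "k < n" using h by simp
        have "\<phi> (\<omega> s) \<le> \<bar>l k\<bar>" using l[of s k] ks by auto
        also have "\<dots> \<le> (\<Sum>k<n. \<bar>l k\<bar>)" using \<open>k < n\<close> by (intro member_le_sum) auto
        finally show ?thesis .
      qed
      then show "\<exists>c. \<forall>s\<in>{0..T}. \<phi> (\<omega> s) \<le> c" by blast
    qed
  qed
qed

lemma path_integrable:
  assumes w: "\<omega> \<in> path_space S" and b: "\<forall>T. \<exists>c. \<forall>s\<in>{0..T}. \<phi> (\<omega> s) \<le> c" and g: "g \<in> poly_space S m"
  shows "\<exists>C. \<forall>s\<in>{0..T}. \<bar>g (\<omega> s)\<bar> \<le> C" and "set_integrable lborel {0..T} (\<lambda>s. g (\<omega> s))"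
proof -
  obtain c where c: "\<And>s. s \<in> {0..T} \<Longrightarrow> \<phi> (\<omega> s) \<le> c" using b by blast
  obtain C where C: "C \<ge> 0" "\<And>z. z \<in> states S \<Longrightarrow> \<bar>g z\<bar> \<le> C * \<phi> z" using poly_bound[OF g] by blast
  have le: "\<bar>g (\<omega> s)\<bar> \<le> C * c" if s: "s \<in> {0..T}" for s
    using order_trans[OF C(2)[OF path_in_states[OF w]] mult_left_mono[OF c[OF s] C(1)]] s by auto
  then show "\<exists>C. \<forall>s\<in>{0..T}. \<bar>g (\<omega> s)\<bar> \<le> C" by blast
  show "set_integrable lborel {0..T} (\<lambda>s. g (\<omega> s))"
  proof (cases "0 \<le> T")
    case True
    have "(\<lambda>s. (s, \<omega>)) \<in> borel \<rightarrow>\<^sub>M borel \<Otimes>\<^sub>M F T"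
      using w by (intro measurable_Pair2') (simp add: space_F)
    from measurable_compose[OF this progressively_measurable[OF g True]]
    have m: "(\<lambda>s. g (\<omega> (min T (max 0 s)))) \<in> borel_measurable borel" by simp
    have eq: "indicator {0..T} s *\<^sub>R g (\<omega> s) = indicator {0..T} s *\<^sub>R g (\<omega> (min T (max 0 s)))" for s
      by (auto simp: indicator_def)
    show ?thesis
      unfolding set_integrable_def eq
    proof (rule Bochner_Integration.integrable_bound)
      show "integrable lborel (\<lambda>s. indicator {0..T} s * (C * c))"
        by (intro integrable_mult_left) (simp add: integrable_indicator_iff emeasure_lborel_Icc_eq)
      show "(\<lambda>s. indicator {0..T} s *\<^sub>R g (\<omega> (min T (max 0 s)))) \<in> borel_measurable lborel"
        using m by measurable
      show "AE s in lborel. norm (indicator {0..T} s *\<^sub>R g (\<omega> (min T (max 0 s)))) \<le> norm (indicator {0..T} s * (C * c))"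
        unfolding eq[symmetric] using le by (intro AE_I2) (auto simp: indicator_def intro: order_trans[OF _ abs_ge_self])
    qed
  qed (simp add: set_integrable_def)
qed

lemma generator_process_cadlag:
  assumes w: "\<omega> \<in> path_space S" and b: "\<forall>T. \<exists>c. \<forall>s\<in>{0..T}. \<phi> (\<omega> s) \<le> c"
    and f: "f \<in> poly_space S m" and g: "g \<in> poly_space S m"
  shows "cadlag euclidean (\<lambda>t. generator_process f g x t \<omega>)"
  unfolding generator_process_def
proof (rule cadlag_diff_Lipschitz)
  show "((\<lambda>s. f (\<omega> s)) \<longlongrightarrow> f (\<omega> t)) (at_right t)" if "0 \<le> t" for t
    by (rule path_right_continuous[OF w that f])
  show "\<exists>l. ((\<lambda>s. f (\<omega> s)) \<longlongrightarrow> l) (at_left t)" if t: "0 < t" for t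
  proof -
    obtain c where "\<And>s. s \<in> {0..t} \<Longrightarrow> \<phi> (\<omega> s) \<le> c" using b by blast
    then show ?thesis using m_ge_2 by (intro path_left_limit[OF closed_S w t f even_m, where c = c]) auto
  qed
  let ?I = "\<lambda>t. LINT s:{0..t}|lborel. g (\<omega> s)"
  have int: "set_integrable lborel {0..T} (\<lambda>s. g (\<omega> s))" for T by (rule path_integrable[OF w b g])
  have "continuous_on {0..T} ?I" for T
  proof -
    have "continuous_on {0..T} (\<lambda>t. integral {0..t} (\<lambda>s. g (\<omega> s)))"
      by (rule indefinite_integral_continuous_1[OF set_borel_integral_eq_integral(1)[OF int]])
    then show ?thesis
      by (rule continuous_on_eq) (simp add: set_borel_integral_eq_integral(2)[OF int])
  qed
  then show "continuous_on {0..} ?I"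
    unfolding continuous_on_eq_continuous_within
  proof (intro ballI)
    fix t :: real assume c: "\<And>T. \<forall>x\<in>{0..T}. continuous (at x within {0..T}) ?I" and t: "t \<in> {0..}"
    have "continuous (at t within {0..t + 1}) ?I" using c[of "t + 1"] t by auto
    moreover have "at t within {0..t + 1} = at t within {0..}"
      using t by (intro at_within_nhd[of t "{..<t + 1}"]) auto
    ultimately show "continuous (at t within {0..}) ?I" by simp
  qed
qed

end

section \<open>From polynomial processes to the generator\<close>

text \<open>The constant infinity localizes: taking the minimum with it is the identity on
  nonnegative times.\<close>

lemma martingale_local_martingale:
  assumes M: "martingale Q F' M"
  shows "local_martingale Q F' M"
proof -
  have eq: "enn2real (min (ennreal t) \<infinity>) = t" if "0 \<le> t" for t using that by simp
  have "cadlag euclidean (\<lambda>t. M (enn2real (min (ennreal t) \<infinity>)) \<omega>)" if "cadlag euclidean (\<lambda>t. M t \<omega>)" for \<omega>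
    by (rule cadlag_cong[OF _ that]) (simp add: eq)
  then have "martingale Q F' (\<lambda>t \<omega>. M (enn2real (min (ennreal t) \<infinity>)) \<omega>)"
    using M unfolding martingale_def by (auto simp: eq elim!: eventually_mono)
  then show ?thesis
    using M unfolding local_martingale_def martingale_def
    by (intro conjI exI[of _ "\<lambda>_ _. \<infinity>"]) auto
qed

section \<open>The martingale property from Dynkin's formula\<close>

context polynomial_setting
begin

context
  assumes PP: "polynomial_process m S p"
begin

text \<open>The coordinates of P_r \<phi> - \<phi> tend to 0 with r and each dual basis function is
  dominated by \<phi>. So the difference is at most half of \<phi> for small r, uniformly in the
  state; this uniformity is what finite dimension provides.\<close>

lemma polynomial_lower_bound:
  "\<exists>h>0. \<forall>r\<in>{0..h}. \<forall>z\<in>states S. \<phi> z \<le> 2 * semigroup_op S p r \<phi> z"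
proof -
  obtain T and e :: "'n state \<Rightarrow> 'n state \<Rightarrow> real" where T: "finite T" "T \<subseteq> states S"
    and e: "\<forall>j\<in>T. e j \<in> poly_space S m"
    and span: "\<forall>f\<in>poly_space S m. \<forall>x\<in>states S. f x = (\<Sum>j\<in>T. f j * e j x)"
    using poly_dual_basis[of S m] by (elim exE conjE) (rule that; assumption)
  note e = e[rule_format] and span = span[rule_format]
  have "\<forall>j\<in>T. \<exists>C. C \<ge> 0 \<and> (\<forall>x\<in>states S. \<bar>e j x\<bar> \<le> C * \<phi> x)" using poly_bound[OF e] by blast
  then obtain C where C: "\<forall>j\<in>T. C j \<ge> 0 \<and> (\<forall>x\<in>states S. \<bar>e j x\<bar> \<le> C j * \<phi> x)"
    by (elim bchoice[elim_format] exE) (rule that)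
  let ?d = "\<lambda>r. \<Sum>j\<in>T. \<bar>semigroup_op S p r \<phi> j - \<phi> j\<bar> * C j"
  have zero: "?d 0 = 0"
    using T by (intro sum.neutral) (auto simp: semigroup_zero[OF \<phi>_poly])
  have "(?d \<longlongrightarrow> (\<Sum>j\<in>T. \<bar>\<phi> j - \<phi> j\<bar> * C j)) (at 0 within {0..})"
    using T by (intro tendsto_intros semigroup_tendsto[OF PP \<phi>_poly]) auto
  then have "eventually (\<lambda>r. ?d r < 1 / 2) (at 0 within {0..})"
    by (intro order_tendstoD) auto
  then obtain d where d: "0 < d" "\<And>r. 0 \<le> r \<Longrightarrow> r \<noteq> 0 \<Longrightarrow> r < d \<Longrightarrow> ?d r < 1 / 2"
    unfolding eventually_at by (auto simp: dist_real_def)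
  have "\<phi> z \<le> 2 * semigroup_op S p r \<phi> z" if r: "r \<in> {0..d / 2}" and z: "z \<in> states S" for r z
  proof -
    have small: "?d r \<le> 1 / 2"
    proof (cases "r = 0")
      case True then show ?thesis using zero by simp
    next
      case False then show ?thesis using d(2)[of r] r d(1) by force
    qed
    have r0: "0 \<le> r" using r by simp
    have "semigroup_op S p r \<phi> z - \<phi> z
        = (\<Sum>j\<in>T. semigroup_op S p r \<phi> j * e j z) - (\<Sum>j\<in>T. \<phi> j * e j z)"
      using span[OF polynomial_invariant[OF PP order_refl \<phi>_poly r0] z] span[OF \<phi>_poly z] by (rule arg_cong2)
    also have "\<dots> = (\<Sum>j\<in>T. (semigroup_op S p r \<phi> j - \<phi> j) * e j z)"
      by (simp add: sum_subtractf left_diff_distrib)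
    finally have "\<bar>semigroup_op S p r \<phi> z - \<phi> z\<bar> \<le> (\<Sum>j\<in>T. \<bar>semigroup_op S p r \<phi> j - \<phi> j\<bar> * \<bar>e j z\<bar>)"
      by (simp add: abs_mult[symmetric])
    also have "\<dots> \<le> (\<Sum>j\<in>T. \<bar>semigroup_op S p r \<phi> j - \<phi> j\<bar> * (C j * \<phi> z))"
      using C z by (intro sum_mono mult_left_mono) auto
    also have "\<dots> = ?d r * \<phi> z" by (simp add: sum_distrib_right mult.assoc)
    also have "\<dots> \<le> 1 / 2 * \<phi> z" by (intro mult_right_mono small \<phi>_nonneg)
    finally show ?thesis by linarith
  qed
  then show ?thesis using d(1) by (intro exI[of _ "d / 2"]) auto
qed

lemma polynomial_no_explosion:
  assumes x: "x \<in> states S"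
  shows "AE \<omega> in P x. \<forall>T. \<exists>c. \<forall>s\<in>{0..T}. \<phi> (\<omega> s) \<le> c"
proof -
  obtain h where h: "0 < h" "\<And>r z. r \<in> {0..h} \<Longrightarrow> z \<in> states S \<Longrightarrow> \<phi> z \<le> 2 * semigroup_op S p r \<phi> z"
    using polynomial_lower_bound by blast
  show ?thesis
    by (rule no_explosion[OF polynomial_moment_function[OF PP \<phi>_poly] x _ h(1) h(2)]) auto
qed

text \<open>Dynkin's formula from the random state at time s. Expanding P_r g in the dual basis
  separates the time r from the state, so the time integral passes through the expectation as a
  finite sum.\<close>

lemma polynomial_conditional_dynkin:
  assumes f: "f \<in> poly_space S m" and g: "g \<in> poly_space S m" and d: "dynkin f g"
    and x: "x \<in> states S" and s: "0 \<le> s" and h: "0 \<le> h" and A: "A \<in> sets (F s)"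
  shows "(\<integral>\<omega>. indicator A \<omega> * generator_process f g x (s + h) \<omega> \<partial>P x)
    = (\<integral>\<omega>. indicator A \<omega> * generator_process f g x s \<omega> \<partial>P x)"
proof -
  note MB = polynomial_moments_bounded[OF PP]
  obtain T and e :: "'n state \<Rightarrow> 'n state \<Rightarrow> real" where T: "finite T" "T \<subseteq> states S"
    and e: "\<forall>j\<in>T. e j \<in> poly_space S m"
    and span: "\<forall>f\<in>poly_space S m. \<forall>x\<in>states S. f x = (\<Sum>j\<in>T. f j * e j x)"
    using poly_dual_basis[of S m] by (elim exE conjE) (rule that; assumption)
  note e = e[rule_format] and span = span[rule_format]
  have AP: "A \<in> sets (P x)" by (rule sets_F_subset[OF x s A])
  have int: "integrable (P x) (\<lambda>\<omega>. indicator A \<omega> * q (\<omega> t))" if "q \<in> poly_space S m" "0 \<le> t" for q t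
    using integrable_mult_indicator[OF AP poly_moment[OF MB that(1) x that(2)]] by simp
  have intI: "integrable (P x) (\<lambda>\<omega>. indicator A \<omega> * (LINT r:{0..t}|lborel. g (\<omega> r)))" if "0 \<le> t" for t
    using integrable_mult_indicator[OF AP time_integral_integrable[OF MB g x that]] by simp
  define D where "D r = (\<integral>\<omega>. indicator A \<omega> * g (\<omega> r) \<partial>P x)" for r
  let ?c = "\<lambda>j. LINT r:{0..h}|lborel. semigroup_op S p r g j"
  have D_int: "set_integrable lborel {0..t} D" if "0 \<le> t" for t
    unfolding D_def by (rule time_expectation_integrable[OF MB g x that AP])
  have sg_int: "set_integrable lborel {0..h} (\<lambda>r. semigroup_op S p r g z)" if "z \<in> states S" for z
    by (rule semigroup_time_integrable[OF MB g that])
  have increment: "semigroup_op S p h f z - f z = (\<Sum>j\<in>T. ?c j * e j z)" if z: "z \<in> states S" for z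
  proof -
    have "semigroup_op S p h f z - f z = (LINT r:{0..h}|lborel. semigroup_op S p r g z)"
      using d z h by (simp add: dynkin_def)
    also have "\<dots> = (LINT r:{0..h}|lborel. (\<Sum>j\<in>T. semigroup_op S p r g j * e j z))"
      by (intro set_lebesgue_integral_cong) (auto intro!: span polynomial_invariant[OF PP] g z)
    also have "\<dots> = (\<Sum>j\<in>T. LINT r:{0..h}|lborel. semigroup_op S p r g j * e j z)"
      using T sg_int by (intro set_integral_sum set_integrable_mult_left impI) auto
    finally show ?thesis by simp
  qed
  \<comment> \<open>The Markov property at s leaves finitely many fixed expectations, with
    coefficients depending on r only.\<close>
  have "(LINT r:{0..h}|lborel. D (s + r)) = (LINT r:{0..h}|lborel.
      (\<Sum>j\<in>T. semigroup_op S p r g j * (\<integral>\<omega>. indicator A \<omega> * e j (\<omega> s) \<partial>P x)))"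
  proof (intro set_lebesgue_integral_cong allI impI)
    fix r assume r: "r \<in> {0..h}"
    then have r0: "0 \<le> r" by simp
    have "D (s + r) = (\<integral>\<omega>. indicator A \<omega> * semigroup_op S p r g (\<omega> s) \<partial>P x)"
      unfolding D_def by (rule markov_integral(2)[OF poly_moment_function[OF MB g] x s r0 A])
    also have "\<dots> = (\<integral>\<omega>. (\<Sum>j\<in>T. semigroup_op S p r g j * (indicator A \<omega> * e j (\<omega> s))) \<partial>P x)"
    proof (intro Bochner_Integration.integral_cong refl)
      fix \<omega> assume "\<omega> \<in> space (P x)"
      then have "semigroup_op S p r g (\<omega> s) = (\<Sum>j\<in>T. semigroup_op S p r g j * e j (\<omega> s))"
        by (intro span polynomial_invariant[OF PP] g r0 path_P[OF x _ s] order_refl)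
      then show "indicator A \<omega> * semigroup_op S p r g (\<omega> s)
          = (\<Sum>j\<in>T. semigroup_op S p r g j * (indicator A \<omega> * e j (\<omega> s)))"
        by (simp add: sum_distrib_left algebra_simps)
    qed
    also have "\<dots> = (\<Sum>j\<in>T. \<integral>\<omega>. semigroup_op S p r g j * (indicator A \<omega> * e j (\<omega> s)) \<partial>P x)"
      by (intro Bochner_Integration.integral_sum integrable_mult_right int e s)
    finally show "D (s + r) = (\<Sum>j\<in>T. semigroup_op S p r g j * (\<integral>\<omega>. indicator A \<omega> * e j (\<omega> s) \<partial>P x))"
      by simp
  qed simp
  also have "\<dots> = (\<Sum>j\<in>T. LINT r:{0..h}|lborel. semigroup_op S p r g j * (\<integral>\<omega>. indicator A \<omega> * e j (\<omega> s) \<partial>P x))"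
    using T sg_int by (intro set_integral_sum set_integrable_mult_left impI) auto
  also have "\<dots> = (\<Sum>j\<in>T. \<integral>\<omega>. ?c j * (indicator A \<omega> * e j (\<omega> s)) \<partial>P x)" by simp
  also have "\<dots> = (\<integral>\<omega>. (\<Sum>j\<in>T. ?c j * (indicator A \<omega> * e j (\<omega> s))) \<partial>P x)"
    by (intro Bochner_Integration.integral_sum[symmetric] integrable_mult_right int e s)
  also have "\<dots> = (\<integral>\<omega>. indicator A \<omega> * semigroup_op S p h f (\<omega> s) - indicator A \<omega> * f (\<omega> s) \<partial>P x)"
  proof (intro Bochner_Integration.integral_cong refl)
    fix \<omega> assume "\<omega> \<in> space (P x)"
    then have "semigroup_op S p h f (\<omega> s) - f (\<omega> s) = (\<Sum>j\<in>T. ?c j * e j (\<omega> s))"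
      by (intro increment path_P[OF x _ s])
    then show "(\<Sum>j\<in>T. ?c j * (indicator A \<omega> * e j (\<omega> s)))
        = indicator A \<omega> * semigroup_op S p h f (\<omega> s) - indicator A \<omega> * f (\<omega> s)"
      by (simp add: right_diff_distrib[symmetric] sum_distrib_left algebra_simps)
  qed
  also have "\<dots> = (\<integral>\<omega>. indicator A \<omega> * semigroup_op S p h f (\<omega> s) \<partial>P x) - (\<integral>\<omega>. indicator A \<omega> * f (\<omega> s) \<partial>P x)"
    by (intro Bochner_Integration.integral_diff int f s polynomial_invariant[OF PP] h order_refl)
  also have "(\<integral>\<omega>. indicator A \<omega> * semigroup_op S p h f (\<omega> s) \<partial>P x) = (\<integral>\<omega>. indicator A \<omega> * f (\<omega> (s + h)) \<partial>P x)"
    by (rule markov_integral(2)[OF poly_moment_function[OF MB f] x s h A, symmetric])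
  finally have main: "(LINT r:{0..s + h}|lborel. D r) - (LINT r:{0..s}|lborel. D r)
      = (\<integral>\<omega>. indicator A \<omega> * f (\<omega> (s + h)) \<partial>P x) - (\<integral>\<omega>. indicator A \<omega> * f (\<omega> s) \<partial>P x)"
    using set_integral_shift(2)[OF s h D_int] s h by simp
  have split: "(\<integral>\<omega>. indicator A \<omega> * generator_process f g x t \<omega> \<partial>P x)
      = (\<integral>\<omega>. indicator A \<omega> * f (\<omega> t) \<partial>P x) - (\<integral>\<omega>. indicator A \<omega> * f x \<partial>P x) - (LINT r:{0..t}|lborel. D r)"
    if t: "0 \<le> t" for t
  proof -
    interpret prob_space "P x" using prob[OF x] .
    have c: "integrable (P x) (\<lambda>\<omega>. indicator A \<omega> * f x)"
      using AP by (intro integrable_mult_left integrable_real_indicator) (simp_all add: less_top[symmetric])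
    have "(\<integral>\<omega>. indicator A \<omega> * generator_process f g x t \<omega> \<partial>P x)
      = (\<integral>\<omega>. indicator A \<omega> * f (\<omega> t) - indicator A \<omega> * f x - indicator A \<omega> * (LINT r:{0..t}|lborel. g (\<omega> r)) \<partial>P x)"
      by (simp add: generator_process_def algebra_simps)
    also have "\<dots> = (\<integral>\<omega>. indicator A \<omega> * f (\<omega> t) \<partial>P x) - (\<integral>\<omega>. indicator A \<omega> * f x \<partial>P x)
        - (\<integral>\<omega>. indicator A \<omega> * (LINT r:{0..t}|lborel. g (\<omega> r)) \<partial>P x)"
      using int[OF f t] intI[OF t] c by simp
    finally show ?thesis unfolding D_def using time_integral_exchange[OF MB g x t AP] by simp
  qed
  show ?thesis using split[OF s] split[of "s + h"] main s h by simp
qed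

lemma polynomial_martingale:
  assumes f: "f \<in> poly_space S m" and g: "g \<in> poly_space S m" and d: "dynkin f g" and x: "x \<in> states S"
  shows "martingale (P x) F (generator_process f g x)"
  unfolding martingale_def
proof (intro conjI allI impI)
  note MB = polynomial_moments_bounded[OF PP]
  interpret prob_space "P x" using prob[OF x] .
  fix t :: real assume t: "0 \<le> t"
  show "generator_process f g x t \<in> borel_measurable (F t)"
    by (rule generator_process_measurable[OF f g t])
  show "integrable (P x) (generator_process f g x t)"
    unfolding generator_process_def[abs_def]
    by (intro Bochner_Integration.integrable_diff poly_moment[OF MB f x t] time_integral_integrable[OF MB g x t]) simp
next
  show "AE \<omega> in P x. cadlag euclidean (\<lambda>t. generator_process f g x t \<omega>)"
    using polynomial_no_explosion[OF x] AE_space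
    by eventually_elim (intro generator_process_cadlag f g, auto simp: space_P[OF x])
next
  note MB = polynomial_moments_bounded[OF PP]
  interpret prob_space "P x" using prob[OF x] .
  have int: "integrable (P x) (generator_process f g x t)" if t: "0 \<le> t" for t
    unfolding generator_process_def[abs_def]
    by (intro Bochner_Integration.integrable_diff poly_moment[OF MB f x t] time_integral_integrable[OF MB g x t]) simp
  fix s t :: real assume s: "0 \<le> s" and st: "s \<le> t"
  interpret c: sigma_finite_subalgebra "P x" "F s" using cond_exp_locale[OF x s] .
  show "AE \<omega> in P x. real_cond_exp (P x) (F s) (generator_process f g x t) \<omega> = generator_process f g x s \<omega>"
  proof (rule c.real_cond_exp_charact)
    fix A assume A: "A \<in> sets (F s)"
    show "(LINT \<omega>:A|P x. generator_process f g x t \<omega>) = (LINT \<omega>:A|P x. generator_process f g x s \<omega>)"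
      using polynomial_conditional_dynkin[OF f g d x s _ A, of "t - s"] st
      by (simp add: set_lebesgue_integral_def)
  qed (use s st in \<open>auto intro!: int generator_process_measurable[OF f g]\<close>)
qed

lemma polynomial_generator_graph:
  assumes f: "f \<in> poly_space S m" and g: "g \<in> poly_space S m" and d: "dynkin f g"
  shows "(f, g) \<in> generator_graph S F P"
  unfolding generator_graph_def
proof (intro CollectI case_prodI conjI ballI)
  show "f \<in> borel_functions S" by (rule poly_space_borel[OF f])
  fix x assume x: "x \<in> states S"
  show "AE \<omega> in P x. \<forall>t\<ge>0. set_integrable lborel {0..t} (\<lambda>s. g (\<omega> s))"
    using polynomial_no_explosion[OF x] AE_space
    by eventually_elim (intro allI impI path_integrable(2)[OF _ _ g], auto simp: space_P[OF x])
  show "local_martingale (P x) F (generator_process f g x)"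
    by (rule martingale_local_martingale[OF polynomial_martingale[OF f g d x]])
qed

lemma polynomial_process_imp_generator:
  "poly_space S m \<subseteq> generator_domain S F P \<and>
    (\<exists>G. extended_generator S F P G \<and> (\<forall>k\<in>{0..m}. G ` poly_space S k \<subseteq> poly_space S k))"
proof -
  have ex: "\<exists>g. g \<in> poly_space S m \<and> dynkin f g \<and> (\<forall>k\<le>m. f \<in> poly_space S k \<longrightarrow> g \<in> poly_space S k)"
    if f: "f \<in> poly_space S m" for f
  proof -
    \<comment> \<open>One image has to serve all degrees at once: it is taken in the least degree
      that contains f and then belongs to all larger ones.\<close>
    define k0 where "k0 = (LEAST k. f \<in> poly_space S k)"
    have k0: "f \<in> poly_space S k0" "k0 \<le> m" unfolding k0_def using f by (auto intro: LeastI Least_le)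
    obtain g where g: "g \<in> poly_space S k0" "dynkin f g"
      using polynomial_dynkin[OF PP k0(2,1)] by blast
    have "g \<in> poly_space S k" if "f \<in> poly_space S k" for k
    proof -
      have "k0 \<le> k" unfolding k0_def using that by (rule Least_le)
      then show ?thesis using g(1) poly_space_mono by blast
    qed
    then show ?thesis using g f by blast
  qed
  \<comment> \<open>\<open>extended_generator\<close> asks for a version on the whole domain, so
    outside \<open>poly_space S m\<close> an arbitrary one is picked.\<close>
  define G where "G f = (if f \<in> poly_space S m
      then SOME g. g \<in> poly_space S m \<and> dynkin f g \<and> (\<forall>k\<le>m. f \<in> poly_space S k \<longrightarrow> g \<in> poly_space S k)
      else SOME g. (f, g) \<in> generator_graph S F P)" for f
  have G: "G f \<in> poly_space S m \<and> dynkin f (G f) \<and> (\<forall>k\<le>m. f \<in> poly_space S k \<longrightarrow> G f \<in> poly_space S k)"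
    if "f \<in> poly_space S m" for f
    unfolding G_def using someI_ex[OF ex[OF that]] that by simp
  have graph: "(f, G f) \<in> generator_graph S F P" if "f \<in> poly_space S m" for f
    using polynomial_generator_graph[OF that] G[OF that] by blast
  have "(f, G f) \<in> generator_graph S F P" if "f \<in> generator_domain S F P" for f
  proof (cases "f \<in> poly_space S m")
    case False
    have "\<exists>g. (f, g) \<in> generator_graph S F P" using that by (auto simp: generator_domain_def)
    then have "(f, SOME g. (f, g) \<in> generator_graph S F P) \<in> generator_graph S F P" by (rule someI_ex)
    then show ?thesis using False by (simp add: G_def)
  qed (rule graph)
  then have "extended_generator S F P G" by (simp add: extended_generator_def)
  moreover have "G ` poly_space S k \<subseteq> poly_space S k" if "k \<in> {0..m}" for k
    using G that poly_space_mono[of k m S] by (auto simp: image_subset_iff)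
  moreover have "poly_space S m \<subseteq> generator_domain S F P" using graph by (auto simp: generator_domain_def)
  ultimately show ?thesis by blast
qed

end

end

section \<open>Stopping and integration by parts\<close>

lemma exp_weight_integral:
  fixes C u :: real
  assumes "0 \<le> u"
  shows "set_integrable lborel {a..u} (\<lambda>s. C * exp (- C * s))"
    and "a \<le> u \<Longrightarrow> (LINT s:{a..u}|lborel. C * exp (- C * s)) = exp (- C * a) - exp (- C * u)"
proof -
  show "set_integrable lborel {a..u} (\<lambda>s. C * exp (- C * s))"
    by (intro borel_integrable_atLeastAtMost' continuous_intros)
  assume "a \<le> u"
  have "(\<integral>s. indicator {a..u} s *\<^sub>R (C * exp (- C * s)) \<partial>lborel) = (- exp (- C * u)) - (- exp (- C * a))"
    using \<open>a \<le> u\<close>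
    by (intro integral_FTC_Icc[where F = "\<lambda>s. - exp (- C * s)"])
      (auto intro!: derivative_eq_intros continuous_intros simp flip: has_real_derivative_iff_has_vector_derivative)
  then show "(LINT s:{a..u}|lborel. C * exp (- C * s)) = exp (- C * a) - exp (- C * u)"
    unfolding set_lebesgue_integral_def by linarith
qed

text \<open>Integration by parts, for an integrand that is merely integrable, by Fubini.\<close>

lemma exp_weight_parts:
  fixes g :: "real \<Rightarrow> real"
  assumes u: "0 \<le> u" and C: "0 \<le> C" and g: "set_integrable lborel {0..u} g"
  shows "(LINT s:{0..u}|lborel. C * exp (- C * s) * (LINT r:{0..s}|lborel. g r))
      = (LINT r:{0..u}|lborel. (exp (- C * r) - exp (- C * u)) * g r)"
    and "set_integrable lborel {0..u} (\<lambda>s. C * exp (- C * s) * (LINT r:{0..s}|lborel. g r))"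
proof -
  define g0 where "g0 r = indicator {0..u} r * g r" for r
  have g0: "integrable lborel g0" using g by (simp add: set_integrable_def g0_def[abs_def])
  then have [measurable]: "g0 \<in> borel_measurable borel" by simp
  \<comment> \<open>The double integrand on the triangle r \<le> s \<le> u, integrated in both
    orders.\<close>
  define H where "H s r = of_bool (0 \<le> r \<and> r \<le> s \<and> s \<le> u) * (C * exp (- C * s) * g0 r)" for s r
  have H_int: "integrable lborel (H s)" for s
  proof (rule Bochner_Integration.integrable_bound)
    show "integrable lborel (\<lambda>r. C * exp (- C * s) * g0 r)" using g0 by simp
  qed (auto simp: H_def[abs_def])
  have pair: "integrable (lborel \<Otimes>\<^sub>M lborel) (case_prod H)"
  proof (rule integrable_time_pair[where t = u and B = "C * (\<integral>r. \<bar>g0 r\<bar> \<partial>lborel)"])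
    show "sigma_finite_measure (lborel :: real measure)" ..
    show "case_prod H \<in> borel_measurable (borel \<Otimes>\<^sub>M lborel)"
      unfolding H_def by measurable
    show "H s r = 0" if "s \<notin> {0..u}" for s r using that by (auto simp: H_def)
    show "integrable lborel (H s)" for s by (rule H_int)
    fix s assume s: "s \<in> {0..u}"
    have "(\<integral>r. \<bar>H s r\<bar> \<partial>lborel) \<le> (\<integral>r. C * \<bar>g0 r\<bar> \<partial>lborel)"
    proof (intro integral_mono integrable_abs H_int integrable_mult_right g0)
      fix r
      have "C * exp (- C * s) * \<bar>g0 r\<bar> \<le> C * 1 * \<bar>g0 r\<bar>"
        using s C by (intro mult_right_mono mult_left_mono) auto
      then show "\<bar>H s r\<bar> \<le> C * \<bar>g0 r\<bar>" using C by (auto simp: H_def abs_mult)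
    qed
    then show "(\<integral>r. \<bar>H s r\<bar> \<partial>lborel) \<le> C * (\<integral>r. \<bar>g0 r\<bar> \<partial>lborel)" by simp
  qed
  note fub = Fubini_time[OF _ pair]
  have sf: "sigma_finite_measure (lborel :: real measure)" ..
  have inner_r: "(\<integral>r. H s r \<partial>lborel) = indicator {0..u} s * (C * exp (- C * s) * (LINT r:{0..s}|lborel. g r))" for s
  proof (cases "s \<in> {0..u}")
    case True
    have "(\<integral>r. H s r \<partial>lborel) = (\<integral>r. C * exp (- C * s) * (indicator {0..s} r * g r) \<partial>lborel)"
      using True by (intro Bochner_Integration.integral_cong) (auto simp: H_def g0_def indicator_def)
    then show ?thesis using True by (simp add: set_lebesgue_integral_def)
  next
    case False
    then have "H s r = 0" for r by (auto simp: H_def)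
    then show ?thesis using False by simp
  qed
  have inner_s: "(\<integral>s. H s r \<partial>lborel) = indicator {0..u} r * ((exp (- C * r) - exp (- C * u)) * g r)" for r
  proof (cases "r \<in> {0..u}")
    case True
    have "(\<integral>s. H s r \<partial>lborel) = (\<integral>s. (indicator {r..u} s * (C * exp (- C * s))) * g r \<partial>lborel)"
      using True by (intro Bochner_Integration.integral_cong) (auto simp: H_def g0_def indicator_def)
    also have "\<dots> = (LINT s:{r..u}|lborel. C * exp (- C * s)) * g r"
      by (simp only: set_lebesgue_integral_def real_scaleR_def integral_mult_left_zero)
    finally show ?thesis using True exp_weight_integral(2)[OF u, of r C] by simp
  next
    case False
    then have "H s r = 0" for s by (auto simp: H_def g0_def)
    then show ?thesis using False by simp
  qed
  show "(LINT s:{0..u}|lborel. C * exp (- C * s) * (LINT r:{0..s}|lborel. g r))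
      = (LINT r:{0..u}|lborel. (exp (- C * r) - exp (- C * u)) * g r)"
    using fub(3)[OF sf] unfolding inner_r inner_s by (simp add: set_lebesgue_integral_def)
  show "set_integrable lborel {0..u} (\<lambda>s. C * exp (- C * s) * (LINT r:{0..s}|lborel. g r))"
    using fub(4)[OF sf] unfolding inner_r by (simp add: set_integrable_def)
qed

text \<open>With W = v - a - \<integral> g, the right side is formally \<integral> exp (- C s) dW
  plus the initial value of W. It exceeds the left side by exactly \<integral> exp (- C s) (C v - g)
  ds, which is nonnegative. This is the pathwise substitute for Gronwall's lemma.\<close>

lemma exp_weight_lower_bound:
  fixes v g :: "real \<Rightarrow> real"
  assumes u: "0 \<le> u" and C: "0 \<le> C" and g: "set_integrable lborel {0..u} g"
    and le: "\<And>s. s \<in> {0..u} \<Longrightarrow> g s \<le> C * v s"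
    and W_int: "set_integrable lborel {0..u} (\<lambda>s. C * exp (- C * s) * (v s - a - (LINT r:{0..s}|lborel. g r)))"
  shows "exp (- C * u) * v u - a \<le> (LINT s:{0..u}|lborel. C * exp (- C * s) * (v s - a - (LINT r:{0..s}|lborel. g r)))
      + exp (- C * u) * (v u - a - (LINT r:{0..u}|lborel. g r))"
proof -
  let ?W = "\<lambda>s. C * exp (- C * s) * (v s - a - (LINT r:{0..s}|lborel. g r))"
  let ?I = "\<lambda>s. C * exp (- C * s) * (LINT r:{0..s}|lborel. g r)"
  note parts = exp_weight_parts[OF u C g]
  have a_int: "set_integrable lborel {0..u} (\<lambda>s. C * exp (- C * s) * a)"
    "(LINT s:{0..u}|lborel. C * exp (- C * s) * a) = (1 - exp (- C * u)) * a"
    using exp_weight_integral[OF u, of 0 C] u by auto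
  have "(\<lambda>s. C * exp (- C * s) * v s) = (\<lambda>s. (?W s + C * exp (- C * s) * a) + ?I s)"
    by (auto simp: fun_eq_iff algebra_simps)
  then have v_int: "set_integrable lborel {0..u} (\<lambda>s. C * exp (- C * s) * v s)"
    and v_eq: "(LINT s:{0..u}|lborel. C * exp (- C * s) * v s)
      = (LINT s:{0..u}|lborel. ?W s) + (1 - exp (- C * u)) * a + (LINT s:{0..u}|lborel. ?I s)"
    using set_integral_add[OF set_integral_add(1)[OF W_int a_int(1)] parts(2)] set_integral_add(2)[OF W_int a_int(1)] a_int(2)
    by simp_all
  have eg_int: "set_integrable lborel {0..u} (\<lambda>s. exp (- C * s) * g s)"
  proof (rule set_integrable_bound[OF g])
    show "set_borel_measurable lborel {0..u} (\<lambda>s. exp (- C * s) * g s)"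
      using borel_measurable_integrable[OF g[unfolded set_integrable_def]] unfolding set_borel_measurable_def
      by (auto simp: mult.left_commute[of "indicator _ _"])
    show "AE s in lborel. s \<in> {0..u} \<longrightarrow> norm (exp (- C * s) * g s) \<le> norm (g s)"
    proof (intro AE_I2 impI)
      fix s assume "s \<in> {0..u}"
      then have "exp (- C * s) \<le> 1" using C by simp
      then show "norm (exp (- C * s) * g s) \<le> norm (g s)"
        using mult_right_mono[of "exp (- C * s)" 1 "\<bar>g s\<bar>"] by (simp add: abs_mult)
    qed
  qed
  have "(LINT s:{0..u}|lborel. exp (- C * s) * g s) \<le> (LINT s:{0..u}|lborel. C * exp (- C * s) * v s)"
  proof (rule set_integral_mono[OF eg_int v_int])
    fix s assume "s \<in> {0..u}"
    from mult_left_mono[OF le[OF this], of "exp (- C * s)"]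
    show "exp (- C * s) * g s \<le> C * exp (- C * s) * v s" by (simp add: mult_ac)
  qed
  moreover have "(LINT s:{0..u}|lborel. ?I s) = (LINT s:{0..u}|lborel. exp (- C * s) * g s) - exp (- C * u) * (LINT s:{0..u}|lborel. g s)"
    unfolding parts(1) using set_integral_diff(2)[OF eg_int set_integrable_mult_right, of "exp (- C * u)" g] g
    by (simp add: left_diff_distrib)
  ultimately show ?thesis using v_eq by (simp add: algebra_simps)
qed

section \<open>Martingales in integrated form\<close>

lemma martingale_set_integral:
  assumes M: "martingale Q F' N" and sf: "sigma_finite_subalgebra Q (F' s)"
    and st: "0 \<le> s" "s \<le> t" and A: "A \<in> sets (F' s)"
  shows "(\<integral>\<omega>. indicator A \<omega> * N s \<omega> \<partial>Q) = (\<integral>\<omega>. indicator A \<omega> * N t \<omega> \<partial>Q)"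
proof -
  interpret sigma_finite_subalgebra Q "F' s" by (rule sf)
  have AQ: "A \<in> sets Q" using A subalg by (auto simp: subalgebra_def)
  have i: "integrable Q (N t)" "integrable Q (N s)" using M st by (auto simp: martingale_def)
  have ae: "AE \<omega> in Q. real_cond_exp Q (F' s) (N t) \<omega> = N s \<omega>" using M st by (auto simp: martingale_def)
  have "(\<integral>\<omega>. indicator A \<omega> * N t \<omega> \<partial>Q) = (\<integral>\<omega>. indicator A \<omega> * real_cond_exp Q (F' s) (N t) \<omega> \<partial>Q)"
    using real_cond_exp_intA[OF i(1) A] by (simp add: set_lebesgue_integral_def)
  also have "\<dots> = (\<integral>\<omega>. indicator A \<omega> * N s \<omega> \<partial>Q)"
    using ae borel_measurable_integrable[OF i(2)] AQ
    by (intro integral_cong_AE) (auto elim!: eventually_mono)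
  finally show ?thesis by simp
qed

text \<open>Conditional Jensen for the absolute value, by testing the martingale property on the two
  events given by the sign of \<open>N s\<close>. It supplies the \<open>L1\<close> bound, uniform
  in time, needed for Fubini.\<close>

lemma martingale_abs_mono:
  assumes M: "martingale Q F' N" and sf: "sigma_finite_subalgebra Q (F' s)"
    and st: "0 \<le> s" "s \<le> t"
  shows "(\<integral>\<omega>. \<bar>N s \<omega>\<bar> \<partial>Q) \<le> (\<integral>\<omega>. \<bar>N t \<omega>\<bar> \<partial>Q)"
proof -
  interpret sigma_finite_subalgebra Q "F' s" by (rule sf)
  have [measurable]: "N s \<in> borel_measurable (F' s)" using M st by (auto simp: martingale_def)
  have i: "integrable Q (N t)" "integrable Q (N s)" using M st by (auto simp: martingale_def)
  define A where "A = {\<omega> \<in> space (F' s). 0 \<le> N s \<omega>}"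
  define B where "B = {\<omega> \<in> space (F' s). N s \<omega> < 0}"
  have AB: "A \<in> sets (F' s)" "B \<in> sets (F' s)" unfolding A_def B_def by measurable
  then have ABQ: "A \<in> sets Q" "B \<in> sets Q" using subalg by (auto simp: subalgebra_def)
  have sp: "space (F' s) = space Q" using subalg by (simp add: subalgebra_def)
  have int: "integrable Q (\<lambda>\<omega>. indicator D \<omega> * N r \<omega>)" if "D \<in> sets Q" "r \<in> {s, t}" for D r
    using integrable_mult_indicator[OF that(1), of "N r"] i that by auto
  have "(\<integral>\<omega>. \<bar>N s \<omega>\<bar> \<partial>Q) = (\<integral>\<omega>. indicator A \<omega> * N s \<omega> - indicator B \<omega> * N s \<omega> \<partial>Q)"
    by (intro Bochner_Integration.integral_cong refl) (auto simp: A_def B_def indicator_def sp)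
  also have "\<dots> = (\<integral>\<omega>. indicator A \<omega> * N s \<omega> \<partial>Q) - (\<integral>\<omega>. indicator B \<omega> * N s \<omega> \<partial>Q)"
    using int ABQ by simp
  also have "\<dots> = (\<integral>\<omega>. indicator A \<omega> * N t \<omega> \<partial>Q) - (\<integral>\<omega>. indicator B \<omega> * N t \<omega> \<partial>Q)"
    using martingale_set_integral[OF M sf st] AB by simp
  also have "\<dots> = (\<integral>\<omega>. indicator A \<omega> * N t \<omega> - indicator B \<omega> * N t \<omega> \<partial>Q)"
    using int ABQ by simp
  also have "\<dots> \<le> (\<integral>\<omega>. \<bar>N t \<omega>\<bar> \<partial>Q)"
  proof (rule integral_mono)
    show "integrable Q (\<lambda>\<omega>. indicator A \<omega> * N t \<omega> - indicator B \<omega> * N t \<omega>)"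
      using int ABQ by simp
    show "integrable Q (\<lambda>\<omega>. \<bar>N t \<omega>\<bar>)" using i by simp
    show "indicator A \<omega> * N t \<omega> - indicator B \<omega> * N t \<omega> \<le> \<bar>N t \<omega>\<bar>" for \<omega>
      by (auto simp: A_def B_def indicator_def)
  qed
  finally show ?thesis .
qed

section \<open>Processes stopped at a localizing time\<close>

context markov_process
begin

definition stopping :: "('n path \<Rightarrow> ennreal) \<Rightarrow> bool" where
  "stopping \<sigma> \<longleftrightarrow> (\<forall>t\<ge>0. Measurable.pred (F t) (\<lambda>\<omega>. \<sigma> \<omega> \<le> ennreal t))"

text \<open>The same expression as the evaluation time in \<open>local_martingale\<close>, so
  stopped processes from that definition fold to it.\<close>

definition truncated :: "('n path \<Rightarrow> ennreal) \<Rightarrow> real \<Rightarrow> 'n path \<Rightarrow> real" where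
  "truncated \<sigma> t \<omega> = enn2real (min (ennreal t) (\<sigma> \<omega>))"

lemma truncated_bounds: "0 \<le> t \<Longrightarrow> 0 \<le> truncated \<sigma> t \<omega>" "0 \<le> t \<Longrightarrow> truncated \<sigma> t \<omega> \<le> t"
  unfolding truncated_def by (auto intro: enn2real_leI)

text \<open>Below the cap t the event depends on \<sigma> only and is decided at time s.\<close>

lemma truncated_less_iff:
  assumes "0 \<le> s" "s < t"
  shows "s < truncated \<sigma> t \<omega> \<longleftrightarrow> \<not> \<sigma> \<omega> \<le> ennreal s"
proof -
  have "s < truncated \<sigma> t \<omega> \<longleftrightarrow> ennreal s < min (ennreal t) (\<sigma> \<omega>)"
    unfolding truncated_def using assms
    by (cases "min (ennreal t) (\<sigma> \<omega>)") (auto simp: ennreal_less_iff min_def split: if_splits)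
  then show ?thesis using assms by (auto simp: ennreal_less_iff)
qed

lemma truncated_le: "0 \<le> s \<Longrightarrow> s \<le> truncated \<sigma> t \<omega> \<Longrightarrow> s \<le> t \<Longrightarrow> truncated \<sigma> s \<omega> = s"
  unfolding truncated_def
  by (cases "\<sigma> \<omega>") (auto simp: min_def ennreal_le_iff2 split: if_splits)

lemma truncated_eq:
  assumes "0 \<le> t"
  shows "\<not> \<sigma> \<omega> \<le> ennreal t \<Longrightarrow> truncated \<sigma> t \<omega> = t" "\<sigma> \<omega> \<le> ennreal t \<Longrightarrow> truncated \<sigma> t \<omega> = enn2real (\<sigma> \<omega>)"
  using assms by (auto simp: truncated_def min_def)

text \<open>The upper level sets are everything for a < 0 and empty for a \<ge> t; in between they
  lie already in \<open>F a\<close>.\<close>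

lemma truncated_measurable:
  assumes \<sigma>: "stopping \<sigma>" and t: "0 \<le> t"
  shows "truncated \<sigma> t \<in> borel_measurable (F t)"
proof (rule borel_measurableI_greater)
  fix a :: real
  consider "a < 0" | "0 \<le> a" "a < t" | "t \<le> a" by linarith
  then show "{\<omega> \<in> space (F t). truncated \<sigma> t \<omega> > a} \<in> sets (F t)"
  proof cases
    case 1
    then have "{\<omega> \<in> space (F t). truncated \<sigma> t \<omega> > a} = space (F t)"
      using truncated_bounds(1)[OF t, of \<sigma>] by (auto intro: less_le_trans)
    then show ?thesis by simp
  next
    case 2
    have "Measurable.pred (F a) (\<lambda>\<omega>. \<not> \<sigma> \<omega> \<le> ennreal a)"
      using \<sigma> 2 by (intro pred_intros_logic) (auto simp: stopping_def)
    then have "{\<omega> \<in> space (F a). \<not> \<sigma> \<omega> \<le> ennreal a} \<in> sets (F a)" by (simp add: pred_def)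
    then have "{\<omega> \<in> space (F t). \<not> \<sigma> \<omega> \<le> ennreal a} \<in> sets (F t)"
      using sets_F_mono[of a t] 2 by (auto simp: space_F)
    then show ?thesis using truncated_less_iff[OF 2] by simp
  next
    case 3
    then have "{\<omega> \<in> space (F t). truncated \<sigma> t \<omega> > a} = {}"
      using truncated_bounds(2)[OF t, of \<sigma>] by (auto simp: not_less intro: order_trans)
    then show ?thesis by (simp only: sets.empty_sets)
  qed
qed

text \<open>The event belongs to the earlier \<open>F s\<close>. This allows the martingale property
  at time s to be tested on not having stopped yet.\<close>

lemma truncated_less_sets:
  assumes \<sigma>: "stopping \<sigma>" and s: "0 \<le> s" "s \<le> t"
  shows "{\<omega> \<in> path_space S. s < truncated \<sigma> t \<omega>} \<in> sets (F s)"
proof (cases "s = t")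
  case True
  then have "{\<omega> \<in> path_space S. s < truncated \<sigma> t \<omega>} = {}"
    using truncated_bounds(2)[of t \<sigma>] s by (auto simp: not_less)
  then show ?thesis by (simp only: sets.empty_sets)
next
  case False
  have "Measurable.pred (F s) (\<lambda>\<omega>. \<not> \<sigma> \<omega> \<le> ennreal s)"
    using \<sigma> s by (intro pred_intros_logic) (auto simp: stopping_def)
  then show ?thesis using truncated_less_iff[of s t \<sigma>] s False by (simp add: pred_def space_F)
qed

lemma observable_at_truncated:
  assumes f: "f \<in> poly_space S k" and \<sigma>: "stopping \<sigma>" and t: "0 \<le> t" and x: "x \<in> states S"
  shows "(\<lambda>\<omega>. f (\<omega> (truncated \<sigma> t \<omega>))) \<in> borel_measurable (P x)"
proof -
  have "truncated \<sigma> t \<in> borel_measurable (P x)" by (rule measurable_F_P[OF x t truncated_measurable[OF \<sigma> t]])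
  then have "(\<lambda>\<omega>. (truncated \<sigma> t \<omega>, \<omega>)) \<in> P x \<rightarrow>\<^sub>M borel \<Otimes>\<^sub>M P x" by measurable
  from measurable_compose[OF this jointly_measurable[OF f t x]]
  show ?thesis using truncated_bounds[OF t, of \<sigma>] by (simp add: min_absorb2 max_absorb2)
qed

lemma stopped_mean_zero:
  assumes x: "x \<in> states S"
    and M: "martingale (P x) F (\<lambda>t \<omega>. generator_process f g x (truncated \<sigma> t \<omega>) \<omega>)"
    and t: "0 \<le> t"
  shows "(\<integral>\<omega>. generator_process f g x (truncated \<sigma> t \<omega>) \<omega> \<partial>P x) = 0"
proof -
  let ?N = "\<lambda>s \<omega>. generator_process f g x (truncated \<sigma> s \<omega>) \<omega>"
  have ind: "(\<integral>\<omega>. indicator (space (F 0)) \<omega> * h \<omega> \<partial>P x) = integral\<^sup>L (P x) h" for h :: "'n path \<Rightarrow> real"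
    by (intro Bochner_Integration.integral_cong refl) (simp add: space_F space_P[OF x])
  have "(\<integral>\<omega>. ?N t \<omega> \<partial>P x) = (\<integral>\<omega>. ?N 0 \<omega> \<partial>P x)"
    using martingale_set_integral[OF M cond_exp_locale[OF x order_refl] order_refl t, of "space (F 0)"]
    by (simp add: ind)
  also have "\<dots> = (\<integral>\<omega>. 0 \<partial>P x)"
  proof (rule integral_cong_AE)
    show "AE \<omega> in P x. ?N 0 \<omega> = 0"
      using start[OF x]
    proof eventually_elim
      case (elim \<omega>)
      have "truncated \<sigma> 0 \<omega> = 0" using truncated_bounds[of 0 \<sigma> \<omega>] by simp
      moreover have "(LINT s:{0..0 :: real}|lborel. g (\<omega> s)) = 0"
        using set_integral_at_point[of lborel "0 :: real" "\<lambda>s. g (\<omega> s)"] by simp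
      ultimately show ?case using elim by (simp add: generator_process_def)
    qed
    show "?N 0 \<in> borel_measurable (P x)" using M by (auto simp: martingale_def)
  qed simp
  finally show ?thesis by simp
qed

end

section \<open>Exponential moment bounds from the local martingale\<close>

context polynomial_setting
begin

text \<open>
  The integral \<open>X\<close> in the proof is \<open>\<integral>\<^sub>0\<^sup>t exp (- C s) dN\<^sub>s\<close> for the stopped martingale \<open>N\<close>, after
  integration by parts; its expectation vanishes.
\<close>

lemma stopped_weight_bound:
  assumes x: "x \<in> states S" and g: "g \<in> poly_space S m" and C: "0 \<le> C"
    and le: "\<And>z. z \<in> states S \<Longrightarrow> g z \<le> C * \<phi> z"
    and int_g: "AE \<omega> in P x. \<forall>t\<ge>0. set_integrable lborel {0..t} (\<lambda>s. g (\<omega> s))"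
    and \<sigma>: "stopping \<sigma>"
    and M: "martingale (P x) F (\<lambda>t \<omega>. generator_process \<phi> g x (truncated \<sigma> t \<omega>) \<omega>)"
    and t: "0 \<le> t"
  shows "(\<integral>\<^sup>+\<omega>. ennreal (exp (- C * truncated \<sigma> t \<omega>) * \<phi> (\<omega> (truncated \<sigma> t \<omega>))) \<partial>P x) \<le> ennreal (\<phi> x)"
proof -
  interpret prob_space "P x" using prob[OF x] .
  have sfP: "sigma_finite_measure (P x)" by (rule prob_space_imp_sigma_finite[OF prob[OF x]])
  define u where "u = truncated \<sigma> t"
  define N where "N s \<omega> = generator_process \<phi> g x (truncated \<sigma> s \<omega>) \<omega>" for s \<omega>
  have MN: "martingale (P x) F N" using M unfolding N_def[abs_def] .
  have N_int: "integrable (P x) (N s)" if "0 \<le> s" for s using MN that by (simp add: martingale_def)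
  have u_bounds: "0 \<le> u \<omega>" "u \<omega> \<le> t" for \<omega> unfolding u_def using truncated_bounds[OF t] by auto
  have u_meas [measurable]: "u \<in> borel_measurable (P x)"
    unfolding u_def by (rule measurable_F_P[OF x t truncated_measurable[OF \<sigma> t]])
  have Nt_meas [measurable]: "N t \<in> borel_measurable (P x)" using N_int[OF t] by simp
  let ?A = "\<lambda>s. {\<omega> \<in> path_space S. s < u \<omega>}"
  let ?W = "\<lambda>s \<omega>. C * exp (- C * s) * generator_process \<phi> g x s \<omega>"
  \<comment> \<open>H integrates the weighted process up to the random time u, and \<open>H'\<close>
    has the terminal value \<open>N t\<close> in its place. Before u the process equals N, and the
    event s < u lies in \<open>F s\<close>, so the martingale property equates their expectations at
    each s.\<close>
  define H where "H s \<omega> = of_bool (0 \<le> s \<and> s < u \<omega>) * ?W s \<omega>" for s \<omega>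
  define H' where "H' s \<omega> = of_bool (0 \<le> s \<and> s < u \<omega>) * (C * exp (- C * s) * N t \<omega>)" for s \<omega>
  have AF: "?A s \<in> sets (F s)" if "0 \<le> s" "s \<le> t" for s
    unfolding u_def by (rule truncated_less_sets[OF \<sigma> that])
  have AP: "?A s \<in> sets (P x)" if "0 \<le> s" "s \<le> t" for s by (rule sets_F_subset[OF x that(1) AF[OF that]])
  have H_eq: "H s \<omega> = C * exp (- C * s) * (indicator (?A s) \<omega> * N s \<omega>)"
    if "0 \<le> s" "s \<le> t" "\<omega> \<in> space (P x)" for s \<omega>
  proof (cases "s < u \<omega>")
    case True
    then have "truncated \<sigma> s \<omega> = s" using truncated_le[of s \<sigma> t \<omega>] that by (simp add: u_def)
    then show ?thesis using True that by (simp add: H_def N_def space_P[OF x])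
  next
    case False then show ?thesis by (simp add: H_def)
  qed
  have H'_eq: "H' s \<omega> = C * exp (- C * s) * (indicator (?A s) \<omega> * N t \<omega>)"
    if "0 \<le> s" "\<omega> \<in> space (P x)" for s \<omega>
    using that by (simp add: H'_def indicator_def space_P[OF x])
  have outside: "H s \<omega> = 0" "H' s \<omega> = 0" if "s \<notin> {0..t}" for s \<omega>
    using that u_bounds[of \<omega>] by (auto simp: H_def H'_def)
  have iN: "integrable (P x) (\<lambda>\<omega>. indicator (?A s) \<omega> * N r \<omega>)" if "0 \<le> s" "s \<le> t" "0 \<le> r" for s r
    using integrable_mult_indicator[OF AP[OF that(1,2)] N_int[OF that(3)]] by simp
  have small: "C * exp (- C * s) \<le> C" if "0 \<le> s" for s using that C by (simp add: mult_left_le)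
  \<comment> \<open>The \<open>L1\<close> norm of a martingale increases in time, so its value at t
    bounds all integrands uniformly.\<close>
  have abs_le: "(\<integral>\<omega>. \<bar>C * exp (- C * s) * (indicator (?A s) \<omega> * N r \<omega>)\<bar> \<partial>P x) \<le> C * (\<integral>\<omega>. \<bar>N t \<omega>\<bar> \<partial>P x)"
    if s: "0 \<le> s" "s \<le> t" and r: "0 \<le> r" "r \<le> t" for s r
  proof -
    have "(\<integral>\<omega>. \<bar>C * exp (- C * s) * (indicator (?A s) \<omega> * N r \<omega>)\<bar> \<partial>P x) \<le> (\<integral>\<omega>. C * \<bar>N r \<omega>\<bar> \<partial>P x)"
    proof (intro integral_mono integrable_abs integrable_mult_right iN s r N_int)
      fix \<omega>
      have "C * exp (- C * s) * \<bar>N r \<omega>\<bar> \<le> C * \<bar>N r \<omega>\<bar>" by (intro mult_right_mono small s) auto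
      then show "\<bar>C * exp (- C * s) * (indicator (?A s) \<omega> * N r \<omega>)\<bar> \<le> C * \<bar>N r \<omega>\<bar>"
        using C by (auto simp: indicator_def abs_mult)
    qed
    also have "\<dots> = C * (\<integral>\<omega>. \<bar>N r \<omega>\<bar> \<partial>P x)" by simp
    also have "\<dots> \<le> C * (\<integral>\<omega>. \<bar>N t \<omega>\<bar> \<partial>P x)"
      by (intro mult_left_mono C martingale_abs_mono[OF MN cond_exp_locale[OF x r(1)] r])
    finally show ?thesis .
  qed
  have pair: "integrable (lborel \<Otimes>\<^sub>M P x) (case_prod H)"
  proof (rule integrable_time_pair[OF sfP])
    note [measurable] = jointly_measurable[OF \<phi>_poly t x]
      measurable_pair_F_P[OF x t running_integral_measurable[OF g t]]
    have "case_prod H = (\<lambda>(s, \<omega>). of_bool (0 \<le> s \<and> s < u \<omega>) * (C * exp (- C * s) *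
        (\<phi> (\<omega> (min t (max 0 s))) - \<phi> x - (LINT r:{0..min t s}|lborel. g (\<omega> r)))))"
    proof (intro ext, clarify)
      fix s \<omega>
      show "H s \<omega> = of_bool (0 \<le> s \<and> s < u \<omega>) * (C * exp (- C * s) *
        (\<phi> (\<omega> (min t (max 0 s))) - \<phi> x - (LINT r:{0..min t s}|lborel. g (\<omega> r))))"
      proof (cases "0 \<le> s \<and> s < u \<omega>")
        case True
        then have "min t s = s" "max 0 s = s" using u_bounds[of \<omega>] by auto
        then show ?thesis by (simp add: H_def generator_process_def)
      qed (simp only: H_def of_bool_eq mult_zero_left)
    qed
    also have "\<dots> \<in> borel_measurable (borel \<Otimes>\<^sub>M P x)" by measurable
    finally show "case_prod H \<in> borel_measurable (borel \<Otimes>\<^sub>M P x)" .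
    fix s assume "s \<in> {0..t}"
    then have s: "0 \<le> s" "s \<le> t" by auto
    have i: "integrable (P x) (\<lambda>\<omega>. C * exp (- C * s) * (indicator (?A s) \<omega> * N s \<omega>))"
      by (intro integrable_mult_right iN s)
    show "integrable (P x) (H s)"
      by (rule Bochner_Integration.integrable_cong[THEN iffD1, OF refl _ i]) (use H_eq[OF s] in simp)
    have "(\<integral>\<omega>. \<bar>H s \<omega>\<bar> \<partial>P x) = (\<integral>\<omega>. \<bar>C * exp (- C * s) * (indicator (?A s) \<omega> * N s \<omega>)\<bar> \<partial>P x)"
      using H_eq[OF s] by (intro Bochner_Integration.integral_cong) auto
    also have "\<dots> \<le> C * (\<integral>\<omega>. \<bar>N t \<omega>\<bar> \<partial>P x)" by (rule abs_le[OF s s])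
    finally show "(\<integral>\<omega>. \<bar>H s \<omega>\<bar> \<partial>P x) \<le> C * (\<integral>\<omega>. \<bar>N t \<omega>\<bar> \<partial>P x)" .
  qed (rule outside)
  have pair': "integrable (lborel \<Otimes>\<^sub>M P x) (case_prod H')"
  proof (rule integrable_time_pair[OF sfP])
    show "case_prod H' \<in> borel_measurable (borel \<Otimes>\<^sub>M P x)"
      unfolding H'_def by measurable
    fix s assume "s \<in> {0..t}"
    then have s: "0 \<le> s" "s \<le> t" by auto
    have i: "integrable (P x) (\<lambda>\<omega>. C * exp (- C * s) * (indicator (?A s) \<omega> * N t \<omega>))"
      by (intro integrable_mult_right iN s t)
    show "integrable (P x) (H' s)"
      by (rule Bochner_Integration.integrable_cong[THEN iffD1, OF refl _ i]) (use H'_eq[OF s(1)] in simp)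
    have "(\<integral>\<omega>. \<bar>H' s \<omega>\<bar> \<partial>P x) = (\<integral>\<omega>. \<bar>C * exp (- C * s) * (indicator (?A s) \<omega> * N t \<omega>)\<bar> \<partial>P x)"
      using H'_eq[OF s(1)] by (intro Bochner_Integration.integral_cong) auto
    also have "\<dots> \<le> C * (\<integral>\<omega>. \<bar>N t \<omega>\<bar> \<partial>P x)" by (rule abs_le[OF s t order_refl])
    finally show "(\<integral>\<omega>. \<bar>H' s \<omega>\<bar> \<partial>P x) \<le> C * (\<integral>\<omega>. \<bar>N t \<omega>\<bar> \<partial>P x)" .
  qed (rule outside)
  have EH: "(\<integral>\<omega>. H s \<omega> \<partial>P x) = (\<integral>\<omega>. H' s \<omega> \<partial>P x)" for s
  proof (cases "s \<in> {0..t}")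
    case True
    then have s: "0 \<le> s" "s \<le> t" by auto
    have "(\<integral>\<omega>. H s \<omega> \<partial>P x) = (\<integral>\<omega>. C * exp (- C * s) * (indicator (?A s) \<omega> * N s \<omega>) \<partial>P x)"
      by (intro Bochner_Integration.integral_cong refl H_eq s)
    also have "\<dots> = (\<integral>\<omega>. C * exp (- C * s) * (indicator (?A s) \<omega> * N t \<omega>) \<partial>P x)"
      using martingale_set_integral[OF MN cond_exp_locale[OF x s(1)] s AF[OF s]] by simp
    also have "\<dots> = (\<integral>\<omega>. H' s \<omega> \<partial>P x)"
      by (intro Bochner_Integration.integral_cong refl H'_eq[symmetric] s)
    finally show ?thesis .
  qed (simp add: outside)
  note fub = Fubini_time[OF sfP pair] and fub' = Fubini_time[OF sfP pair']
  have point: "integrable lborel (indicator {a} :: real \<Rightarrow> real)" "(\<integral>s. indicator {a} s \<partial>lborel) = (0 :: real)" for a :: real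
    by (auto simp: integrable_indicator_iff)
  \<comment> \<open>With \<open>N t\<close> frozen, the weights
    \<open>1 - exp (- C * u \<omega>)\<close> and \<open>exp (- C * u \<omega>)\<close> add up to 1.
    Hence X has the expectation of \<open>N t\<close>, which is 0.\<close>
  have inner': "(\<integral>s. H' s \<omega> \<partial>lborel) = (1 - exp (- C * u \<omega>)) * N t \<omega>" for \<omega>
  proof -
    have i1: "integrable lborel (\<lambda>s. indicator {0..u \<omega>} s * (C * exp (- C * s)))"
      using exp_weight_integral(1)[OF u_bounds(1)[of \<omega>], of 0 C] by (simp add: set_integrable_def)
    have "H' s \<omega> = (indicator {0..u \<omega>} s * (C * exp (- C * s)) - indicator {u \<omega>} s * (C * exp (- C * u \<omega>))) * N t \<omega>" for s
      using u_bounds(1)[of \<omega>] by (auto simp: H'_def indicator_def)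
    then have "(\<integral>s. H' s \<omega> \<partial>lborel) = (\<integral>s. indicator {0..u \<omega>} s * (C * exp (- C * s)) \<partial>lborel) * N t \<omega>"
      using i1 point by simp
    also have "(\<integral>s. indicator {0..u \<omega>} s * (C * exp (- C * s)) \<partial>lborel) = 1 - exp (- C * u \<omega>)"
      using exp_weight_integral(2)[OF u_bounds(1)[of \<omega>] u_bounds(1)[of \<omega>], of C]
      unfolding set_lebesgue_integral_def real_scaleR_def by simp
    finally show ?thesis .
  qed
  define X where "X \<omega> = (\<integral>s. H s \<omega> \<partial>lborel) + exp (- C * u \<omega>) * N t \<omega>" for \<omega>
  have expN: "integrable (P x) (\<lambda>\<omega>. exp (- C * u \<omega>) * N t \<omega>)"
  proof (rule Bochner_Integration.integrable_bound[OF N_int[OF t]])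
    have "exp (- C * u \<omega>) \<le> 1" for \<omega> using C u_bounds(1)[of \<omega>] by simp
    then show "AE \<omega> in P x. norm (exp (- C * u \<omega>) * N t \<omega>) \<le> norm (N t \<omega>)"
      by (auto simp: abs_mult intro!: AE_I2 mult_left_le_one_le)
  qed measurable
  have X_int: "integrable (P x) X" unfolding X_def[abs_def] by (intro Bochner_Integration.integrable_add fub(1) expN)
  have "(\<integral>\<omega>. X \<omega> \<partial>P x) = (\<integral>\<omega>. (\<integral>s. H s \<omega> \<partial>lborel) \<partial>P x) + (\<integral>\<omega>. exp (- C * u \<omega>) * N t \<omega> \<partial>P x)"
    unfolding X_def by (rule Bochner_Integration.integral_add[OF fub(1) expN])
  also have "(\<integral>\<omega>. (\<integral>s. H s \<omega> \<partial>lborel) \<partial>P x) = (\<integral>\<omega>. (\<integral>s. H' s \<omega> \<partial>lborel) \<partial>P x)"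
    unfolding fub(3) fub'(3) EH ..
  also have "\<dots> + (\<integral>\<omega>. exp (- C * u \<omega>) * N t \<omega> \<partial>P x) = (\<integral>\<omega>. (\<integral>s. H' s \<omega> \<partial>lborel) + exp (- C * u \<omega>) * N t \<omega> \<partial>P x)"
    by (rule Bochner_Integration.integral_add[OF fub'(1) expN, symmetric])
  also have "\<dots> = (\<integral>\<omega>. N t \<omega> \<partial>P x)"
    unfolding inner' by (intro Bochner_Integration.integral_cong) (auto simp: algebra_simps)
  also have "\<dots> = 0"
    using stopped_mean_zero[OF x M t] by (simp add: N_def)
  finally have EX: "(\<integral>\<omega>. X \<omega> \<partial>P x) = 0" .
  have ae: "AE \<omega> in P x. exp (- C * u \<omega>) * \<phi> (\<omega> (u \<omega>)) \<le> \<phi> x + X \<omega>"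
    using fub(2) int_g AE_space
  proof eventually_elim
    case (elim \<omega>)
    have g_int: "set_integrable lborel {0..u \<omega>} (\<lambda>s. g (\<omega> s))" using elim(2) u_bounds by blast
    \<comment> \<open>H stops strictly before u, whereas the pathwise inequality integrates over the
      closed interval; one point makes no difference.\<close>
    have H_split: "indicator {0..u \<omega>} s *\<^sub>R ?W s \<omega> = H s \<omega> + indicator {u \<omega>} s * ?W (u \<omega>) \<omega>" for s
      using u_bounds(1)[of \<omega>] by (auto simp: H_def indicator_def)
    have W_int: "set_integrable lborel {0..u \<omega>} (\<lambda>s. ?W s \<omega>)"
      unfolding set_integrable_def H_split using elim(1) point by simp
    have W_eq: "(LINT s:{0..u \<omega>}|lborel. ?W s \<omega>) = (\<integral>s. H s \<omega> \<partial>lborel)"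
      unfolding set_lebesgue_integral_def H_split using elim(1) point by simp
    have "exp (- C * u \<omega>) * \<phi> (\<omega> (u \<omega>)) - \<phi> x
        \<le> (LINT s:{0..u \<omega>}|lborel. ?W s \<omega>) + exp (- C * u \<omega>) * generator_process \<phi> g x (u \<omega>) \<omega>"
      unfolding generator_process_def
    proof (rule exp_weight_lower_bound[OF u_bounds(1) C g_int _ W_int[unfolded generator_process_def]])
      show "g (\<omega> s) \<le> C * \<phi> (\<omega> s)" if "s \<in> {0..u \<omega>}" for s
        using that path_P[OF x elim(3)] by (intro le) auto
    qed
    then show ?case unfolding W_eq X_def N_def u_def[symmetric] by linarith
  qed
  have "(\<integral>\<^sup>+\<omega>. ennreal (exp (- C * u \<omega>) * \<phi> (\<omega> (u \<omega>))) \<partial>P x) \<le> (\<integral>\<^sup>+\<omega>. ennreal (\<phi> x + X \<omega>) \<partial>P x)"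
    using ae by (intro nn_integral_mono_AE) (auto elim!: eventually_mono intro: ennreal_leI)
  also have "\<dots> = ennreal (\<integral>\<omega>. \<phi> x + X \<omega> \<partial>P x)"
  proof (rule nn_integral_eq_integral)
    show "AE \<omega> in P x. 0 \<le> \<phi> x + X \<omega>"
      using ae by eventually_elim (meson \<phi>_nonneg exp_ge_zero mult_nonneg_nonneg order_trans)
  qed (use X_int in simp)
  also have "(\<integral>\<omega>. \<phi> x + X \<omega> \<partial>P x) = \<phi> x" using X_int EX by (simp add: prob_space)
  finally show ?thesis unfolding u_def .
qed

text \<open>The stopped bound is uniform in n. Once \<open>\<tau> n\<close> exceeds t the stopped
  value is the value at t, so Fatou's lemma removes the stopping without any integrability known
  beforehand.\<close>

lemma weight_bound:
  assumes gph: "(\<phi>, g) \<in> generator_graph S F P" and g: "g \<in> poly_space S m" and C: "0 \<le> C"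
    and le: "\<And>z. z \<in> states S \<Longrightarrow> g z \<le> C * \<phi> z" and x: "x \<in> states S" and t: "0 \<le> t"
  shows "(\<integral>\<^sup>+\<omega>. ennreal (\<phi> (\<omega> t)) \<partial>P x) \<le> ennreal (exp (C * t) * \<phi> x)"
proof -
  from gph x have int_g: "AE \<omega> in P x. \<forall>t\<ge>0. set_integrable lborel {0..t} (\<lambda>s. g (\<omega> s))"
    and lm: "local_martingale (P x) F (generator_process \<phi> g x)"
    by (auto simp: generator_graph_def)
  from lm obtain \<tau> :: "nat \<Rightarrow> 'n path \<Rightarrow> ennreal" where
    \<tau>: "\<And>n. stopping (\<tau> n)" and lim: "AE \<omega> in P x. (\<lambda>n. \<tau> n \<omega>) \<longlonglongrightarrow> \<infinity>"
    and mart: "\<And>n. martingale (P x) F (\<lambda>t \<omega>. generator_process \<phi> g x (truncated (\<tau> n) t \<omega>) \<omega>)"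
    unfolding local_martingale_def stopping_def truncated_def by (auto elim!: eventually_mono)
  let ?Y = "\<lambda>n \<omega>. ennreal (exp (- C * truncated (\<tau> n) t \<omega>) * \<phi> (\<omega> (truncated (\<tau> n) t \<omega>)))"
  have Y_meas: "?Y n \<in> borel_measurable (P x)" for n
    using observable_at_truncated[OF \<phi>_poly \<tau> t x] measurable_F_P[OF x t truncated_measurable[OF \<tau> t]]
    by measurable
  have "(\<integral>\<^sup>+\<omega>. ennreal (exp (- C * t) * \<phi> (\<omega> t)) \<partial>P x) = (\<integral>\<^sup>+\<omega>. liminf (\<lambda>n. ?Y n \<omega>) \<partial>P x)"
  proof (rule nn_integral_cong_AE)
    show "AE \<omega> in P x. ennreal (exp (- C * t) * \<phi> (\<omega> t)) = liminf (\<lambda>n. ?Y n \<omega>)"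
      using lim
    proof eventually_elim
      case (elim \<omega>)
      have "eventually (\<lambda>n. ennreal t < \<tau> n \<omega>) sequentially"
        by (rule order_tendstoD(1)[OF elim]) simp
      then have "eventually (\<lambda>n. ?Y n \<omega> = ennreal (exp (- C * t) * \<phi> (\<omega> t))) sequentially"
        by eventually_elim (simp add: truncated_eq(1)[OF t] not_le)
      then have "(\<lambda>n. ?Y n \<omega>) \<longlonglongrightarrow> ennreal (exp (- C * t) * \<phi> (\<omega> t))" by (rule tendsto_eventually)
      then show ?case by (rule lim_imp_Liminf[OF sequentially_bot, symmetric])
    qed
  qed
  also have "\<dots> \<le> liminf (\<lambda>n. \<integral>\<^sup>+\<omega>. ?Y n \<omega> \<partial>P x)" by (rule nn_integral_liminf[OF Y_meas])
  also have "\<dots> \<le> liminf (\<lambda>n. ennreal (\<phi> x))"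
    by (intro Liminf_mono always_eventually allI stopped_weight_bound[OF x g C le int_g \<tau> mart t])
  also have "\<dots> = ennreal (\<phi> x)" by (simp add: Liminf_const)
  finally have *: "(\<integral>\<^sup>+\<omega>. ennreal (exp (- C * t) * \<phi> (\<omega> t)) \<partial>P x) \<le> ennreal (\<phi> x)" .
  have "(\<integral>\<^sup>+\<omega>. ennreal (\<phi> (\<omega> t)) \<partial>P x) = (\<integral>\<^sup>+\<omega>. ennreal (exp (C * t)) * ennreal (exp (- C * t) * \<phi> (\<omega> t)) \<partial>P x)"
  proof (intro nn_integral_cong)
    fix \<omega>
    have "\<phi> (\<omega> t) = exp (C * t) * (exp (- C * t) * \<phi> (\<omega> t))"
      by (simp add: exp_minus mult.assoc[symmetric])
    then show "ennreal (\<phi> (\<omega> t)) = ennreal (exp (C * t)) * ennreal (exp (- C * t) * \<phi> (\<omega> t))"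
      using \<phi>_nonneg by (metis ennreal_mult exp_ge_zero mult_nonneg_nonneg)
  qed
  also have "\<dots> = ennreal (exp (C * t)) * (\<integral>\<^sup>+\<omega>. ennreal (exp (- C * t) * \<phi> (\<omega> t)) \<partial>P x)"
    using observable_measurable[OF poly_space_borel[OF \<phi>_poly] x t] by (intro nn_integral_cmult) measurable
  also have "\<dots> \<le> ennreal (exp (C * t)) * ennreal (\<phi> x)" by (intro mult_left_mono *) simp
  also have "\<dots> = ennreal (exp (C * t) * \<phi> x)" by (simp add: ennreal_mult \<phi>_nonneg)
  finally show ?thesis .
qed

text \<open>Here moments become finite in the direction from the generator. The exponent is the
  constant with which \<open>\<phi>\<close> dominates g.\<close>

lemma weight_expectation_bound:
  assumes gph: "(\<phi>, g) \<in> generator_graph S F P" and g: "g \<in> poly_space S m"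
  shows "moments_bounded" and "\<exists>C\<ge>0. \<forall>x\<in>states S. \<forall>t\<ge>0. semigroup_op S p t \<phi> x \<le> exp (C * t) * \<phi> x"
proof -
  obtain C where C: "C \<ge> 0" "\<And>z. z \<in> states S \<Longrightarrow> \<bar>g z\<bar> \<le> C * \<phi> z" using poly_bound[OF g] by blast
  have le: "g z \<le> C * \<phi> z" if "z \<in> states S" for z using C(2)[OF that] by simp
  have main: "integrable (P x) (\<lambda>\<omega>. \<phi> (\<omega> t)) \<and> (\<integral>\<omega>. \<phi> (\<omega> t) \<partial>P x) \<le> exp (C * t) * \<phi> x"
    if x: "x \<in> states S" and t: "0 \<le> t" for x t
  proof -
    note bound = weight_bound[OF gph g C(1) le x t]
    have meas: "(\<lambda>\<omega>. \<phi> (\<omega> t)) \<in> borel_measurable (P x)"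
      by (rule observable_measurable[OF poly_space_borel[OF \<phi>_poly] x t])
    have int: "integrable (P x) (\<lambda>\<omega>. \<phi> (\<omega> t))"
    proof (rule integrableI_bounded[OF meas])
      show "(\<integral>\<^sup>+\<omega>. ennreal (norm (\<phi> (\<omega> t))) \<partial>P x) < \<infinity>"
        using le_less_trans[OF bound ennreal_less_top] by (simp add: \<phi>_nonneg)
    qed
    have "ennreal (\<integral>\<omega>. \<phi> (\<omega> t) \<partial>P x) \<le> ennreal (exp (C * t) * \<phi> x)"
      using bound nn_integral_eq_integral[OF int] \<phi>_nonneg by simp
    then show ?thesis using int \<phi>_nonneg by (simp add: ennreal_le_iff)
  qed
  show "moments_bounded"
    unfolding moments_bounded_def
  proof (intro ballI allI)
    fix x and t :: real assume x: "x \<in> states S"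
    show "\<exists>B. \<forall>s\<in>{0..t}. integrable (P x) (\<lambda>\<omega>. \<phi> (\<omega> s)) \<and> (\<integral>\<omega>. \<phi> (\<omega> s) \<partial>P x) \<le> B"
    proof (intro exI ballI conjI)
      fix s assume s: "s \<in> {0..t}"
      then show "integrable (P x) (\<lambda>\<omega>. \<phi> (\<omega> s))" using main x by simp
      have "(\<integral>\<omega>. \<phi> (\<omega> s) \<partial>P x) \<le> exp (C * s) * \<phi> x" using main x s by simp
      also have "\<dots> \<le> exp (C * t) * \<phi> x"
        using s C(1) by (intro mult_right_mono \<phi>_nonneg) (simp add: mult_left_mono)
      finally show "(\<integral>\<omega>. \<phi> (\<omega> s) \<partial>P x) \<le> exp (C * t) * \<phi> x" .
    qed
  qed
  show "\<exists>C\<ge>0. \<forall>x\<in>states S. \<forall>t\<ge>0. semigroup_op S p t \<phi> x \<le> exp (C * t) * \<phi> x"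
    using main C(1) by (intro exI[of _ C]) (auto simp: semigroup_op_poly[OF \<phi>_poly])
qed

end

section \<open>Optional stopping on grids\<close>

lemma tendsto_zero_ennrealI:
  fixes f :: "nat \<Rightarrow> ennreal"
  assumes "\<And>e. 0 < e \<Longrightarrow> eventually (\<lambda>n. f n \<le> ennreal e) sequentially"
  shows "f \<longlonglongrightarrow> 0"
proof (rule order_tendstoI)
  fix a :: ennreal assume "0 < a"
  then obtain b where b: "0 < b" "b < a" using dense by blast
  then obtain e where e: "b = ennreal e" "0 \<le> e" by (cases b) auto
  have "eventually (\<lambda>n. f n \<le> ennreal e) sequentially"
    using b e by (intro assms) (auto simp: ennreal_less_zero_iff)
  then show "eventually (\<lambda>n. f n < a) sequentially"
    by eventually_elim (use b e in auto)
qed simp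

section \<open>Rounding stopping times to a grid\<close>

context markov_process
begin

text \<open>The event that \<sigma>, rounded up to the grid \<theta>, takes the value
  \<open>\<theta> i\<close>.\<close>

definition cell :: "('n path \<Rightarrow> ennreal) \<Rightarrow> (nat \<Rightarrow> real) \<Rightarrow> nat \<Rightarrow> 'n path set" where
  "cell \<sigma> \<theta> i = {\<omega> \<in> path_space S. \<sigma> \<omega> \<le> ennreal (\<theta> i) \<and> (\<forall>j<i. \<not> \<sigma> \<omega> \<le> ennreal (\<theta> j))}"

lemma stopping_sets:
  assumes "stopping \<sigma>" "0 \<le> s" "s \<le> t"
  shows "{\<omega> \<in> path_space S. \<sigma> \<omega> \<le> ennreal s} \<in> sets (F t)"
    and "{\<omega> \<in> path_space S. \<not> \<sigma> \<omega> \<le> ennreal s} \<in> sets (F t)"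
proof -
  have "Measurable.pred (F s) (\<lambda>\<omega>. \<sigma> \<omega> \<le> ennreal s)" using assms by (simp add: stopping_def)
  then have *: "{\<omega> \<in> path_space S. \<sigma> \<omega> \<le> ennreal s} \<in> sets (F t)"
    using sets_F_mono[OF assms(3)] by (auto simp: pred_def space_F)
  then show "{\<omega> \<in> path_space S. \<sigma> \<omega> \<le> ennreal s} \<in> sets (F t)" .
  have "space (F t) - {\<omega> \<in> path_space S. \<sigma> \<omega> \<le> ennreal s} \<in> sets (F t)" using * by (rule sets.compl_sets)
  moreover have "space (F t) - {\<omega> \<in> path_space S. \<sigma> \<omega> \<le> ennreal s} = {\<omega> \<in> path_space S. \<not> \<sigma> \<omega> \<le> ennreal s}"
    by (auto simp: space_F)
  ultimately show "{\<omega> \<in> path_space S. \<not> \<sigma> \<omega> \<le> ennreal s} \<in> sets (F t)" by simp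
qed

lemma cell_sets:
  assumes \<sigma>: "stopping \<sigma>" and \<theta>: "\<And>i. 0 \<le> \<theta> i" "mono \<theta>"
  shows "cell \<sigma> \<theta> i \<in> sets (F (\<theta> i))"
proof -
  have eq: "cell \<sigma> \<theta> i = {\<omega> \<in> path_space S. \<sigma> \<omega> \<le> ennreal (\<theta> i)} \<inter>
      {\<omega> \<in> space (F (\<theta> i)). \<forall>j\<in>{..<i}. \<not> \<sigma> \<omega> \<le> ennreal (\<theta> j)}"
    by (auto simp: cell_def space_F)
  have "{\<omega> \<in> space (F (\<theta> i)). \<not> \<sigma> \<omega> \<le> ennreal (\<theta> j)} \<in> sets (F (\<theta> i))" if "j \<in> {..<i}" for j
    using stopping_sets(2)[OF \<sigma> \<theta>(1)[of j] monoD[OF \<theta>(2), of j i]] that by (simp add: space_F)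
  then have "{\<omega> \<in> space (F (\<theta> i)). \<forall>j\<in>{..<i}. \<not> \<sigma> \<omega> \<le> ennreal (\<theta> j)} \<in> sets (F (\<theta> i))"
    by (rule sets.sets_Collect_finite_All[OF _ finite_lessThan])
  then show ?thesis unfolding eq by (rule sets.Int[OF stopping_sets(1)[OF \<sigma> \<theta>(1) order_refl]])
qed

lemma cell_indicator:
  assumes "\<omega> \<in> cell \<sigma> \<theta> i"
  shows "indicator (cell \<sigma> \<theta> j) \<omega> = (if j = i then 1 else (0 :: real))"
proof (cases j i rule: linorder_cases)
  case less
  then have "\<omega> \<notin> cell \<sigma> \<theta> j" using assms by (auto simp: cell_def)
  then show ?thesis using less by simp
next
  case greater
  then have "\<omega> \<notin> cell \<sigma> \<theta> j" using assms by (auto simp: cell_def)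
  then show ?thesis using greater by simp
qed (use assms in simp)

text \<open>There are \<open>Suc N\<close> steps, so the indices run from 0 to \<open>Suc N\<close>
  and the last one is the endpoint t.\<close>

definition grid :: "real \<Rightarrow> nat \<Rightarrow> nat \<Rightarrow> real" where
  "grid t N i = t * real i / real (Suc N)"

lemma grid_simps: "grid t N 0 = 0" "grid t N (Suc N) = t" "grid t N (Suc i) = grid t N i + t / real (Suc N)"
  by (auto simp: grid_def field_simps simp del: of_nat_Suc) (simp add: algebra_simps)

lemma grid_nonneg: "0 \<le> t \<Longrightarrow> 0 \<le> grid t N i"
  by (simp add: grid_def)

lemma grid_mono: "0 \<le> t \<Longrightarrow> mono (grid t N)"
  by (auto simp: grid_def intro!: monoI divide_right_mono mult_left_mono)

lemma grid_le: "0 \<le> t \<Longrightarrow> i \<le> Suc N \<Longrightarrow> grid t N i \<le> t"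
  using monoD[OF grid_mono, of t i "Suc N" N] by (simp add: grid_simps)

end

section \<open>Optional stopping for the weight\<close>

context polynomial_setting
begin

text \<open>Exactly one cell contains the path, and the rounded time approaches \<sigma> from the
  right, where the path is continuous.\<close>

lemma grid_limit:
  assumes w: "\<omega> \<in> path_space S" and t: "0 < t" and \<sigma>: "\<sigma> \<omega> \<le> ennreal t"
  shows "(\<lambda>N. \<Sum>i\<le>Suc N. indicator (cell \<sigma> (grid t N) i) \<omega> * \<phi> (\<omega> (grid t N i))) \<longlonglongrightarrow> \<phi> (\<omega> (truncated \<sigma> t \<omega>))"
proof -
  define r where "r = truncated \<sigma> t \<omega>"
  have r: "0 \<le> r" "r \<le> t" unfolding r_def using truncated_bounds[of t] t by auto
  have r_eq: "\<sigma> \<omega> = ennreal r"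
    using \<sigma> t unfolding r_def truncated_def by (cases "\<sigma> \<omega>") (auto simp: min_absorb2 top_unique)
  define k where "k N = (LEAST i. r \<le> grid t N i)" for N
  have k: "r \<le> grid t N (k N)" "k N \<le> Suc N" "\<And>j. j < k N \<Longrightarrow> \<not> r \<le> grid t N j" for N
  proof -
    have ex: "r \<le> grid t N (Suc N)" using r by (simp add: grid_simps)
    show "r \<le> grid t N (k N)" unfolding k_def using ex by (rule LeastI)
    show "k N \<le> Suc N" unfolding k_def using ex by (rule Least_le)
    show "\<not> r \<le> grid t N j" if "j < k N" for j using that unfolding k_def by (rule not_less_Least)
  qed
  \<comment> \<open>By minimality the previous grid point lies before r, so rounding costs at most
    one step.\<close>
  have up: "grid t N (k N) \<le> r + t / real (Suc N)" for N
  proof (cases "k N")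
    case 0
    then show ?thesis using r t by (simp add: grid_simps)
  next
    case (Suc j)
    then have "\<not> r \<le> grid t N j" using k(3)[of j N] by simp
    then show ?thesis unfolding Suc grid_simps by simp
  qed
  have in_cell: "\<omega> \<in> cell \<sigma> (grid t N) (k N)" for N
    using w k(1)[of N] k(3)[of _ N] t r by (auto simp: cell_def r_eq ennreal_le_iff grid_nonneg)
  have "(\<Sum>i\<le>Suc N. indicator (cell \<sigma> (grid t N) i) \<omega> * \<phi> (\<omega> (grid t N i))) = \<phi> (\<omega> (grid t N (k N)))" for N
  proof -
    have "(\<Sum>i\<le>Suc N. indicator (cell \<sigma> (grid t N) i) \<omega> * \<phi> (\<omega> (grid t N i)))
        = (\<Sum>i\<le>Suc N. if i = k N then \<phi> (\<omega> (grid t N i)) else 0)"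
      by (intro sum.cong refl) (simp add: cell_indicator[OF in_cell])
    also have "\<dots> = \<phi> (\<omega> (grid t N (k N)))"
      using k(2)[of N] by (subst sum.delta) (simp_all del: sum.atMost_Suc)
    finally show ?thesis .
  qed
  moreover have "(\<lambda>N. \<phi> (\<omega> (grid t N (k N)))) \<longlonglongrightarrow> \<phi> (\<omega> r)"
  proof -
    have "(\<lambda>N. grid t N (k N)) \<longlonglongrightarrow> r"
    proof (rule tendsto_sandwich)
      show "eventually (\<lambda>N. r \<le> grid t N (k N)) sequentially" using k(1) by simp
      show "eventually (\<lambda>N. grid t N (k N) \<le> r + t / real (Suc N)) sequentially" using up by simp
      have "(\<lambda>N. r + t * inverse (real (Suc N))) \<longlonglongrightarrow> r + t * 0"
        by (intro tendsto_intros LIMSEQ_inverse_real_of_nat)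
      then show "(\<lambda>N. r + t / real (Suc N)) \<longlonglongrightarrow> r" by (simp add: divide_inverse)
    qed simp
    moreover have "continuous (at r within {r..}) (\<lambda>s. \<phi> (\<omega> s))"
      using path_right_continuous[OF w r(1) \<phi>_poly] by (simp add: continuous_within at_within_Ici_at_right)
    ultimately show ?thesis
      using k(1) unfolding continuous_within_sequentially comp_def by (auto simp: atLeast_iff)
  qed
  ultimately show ?thesis by (simp add: r_def)
qed

text \<open>Reduces a bound at a stopping time to bounds at deterministic grid times, for which the
  simple Markov property is enough.\<close>

lemma grid_fatou:
  assumes MB: "moments_bounded" and x: "x \<in> states S" and t: "0 < t" and \<sigma>: "stopping \<sigma>"
    and bound: "\<And>N. (\<Sum>i\<le>Suc N. \<integral>\<omega>. indicator (cell \<sigma> (grid t N) i) \<omega> * \<phi> (\<omega> (grid t N i)) \<partial>P x) \<le> B"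
  shows "(\<integral>\<^sup>+\<omega>. indicator {\<omega>. \<sigma> \<omega> \<le> ennreal t} \<omega> * ennreal (\<phi> (\<omega> (truncated \<sigma> t \<omega>))) \<partial>P x) \<le> ennreal B"
proof -
  have t0: "0 \<le> t" using t by simp
  let ?Y = "\<lambda>N \<omega>. \<Sum>i\<le>Suc N. indicator (cell \<sigma> (grid t N) i) \<omega> * \<phi> (\<omega> (grid t N i))"
  have cP: "cell \<sigma> (grid t N) i \<in> sets (P x)" for N i
    by (rule sets_F_subset[OF x grid_nonneg[OF t0] cell_sets[OF \<sigma> grid_nonneg[OF t0] grid_mono[OF t0]]])
  have int: "integrable (P x) (\<lambda>\<omega>. indicator (cell \<sigma> (grid t N) i) \<omega> * \<phi> (\<omega> (grid t N i)))" for N i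
    using integrable_mult_indicator[OF cP poly_moment[OF MB \<phi>_poly x grid_nonneg[OF t0]]] by simp
  have Y_int: "integrable (P x) (?Y N)" for N by (intro Bochner_Integration.integrable_sum int)
  have Y_nonneg: "0 \<le> ?Y N \<omega>" for N \<omega> by (intro sum_nonneg mult_nonneg_nonneg \<phi>_nonneg) simp
  have "(\<integral>\<^sup>+\<omega>. indicator {\<omega>. \<sigma> \<omega> \<le> ennreal t} \<omega> * ennreal (\<phi> (\<omega> (truncated \<sigma> t \<omega>))) \<partial>P x)
      \<le> (\<integral>\<^sup>+\<omega>. liminf (\<lambda>N. ennreal (?Y N \<omega>)) \<partial>P x)"
  proof (rule nn_integral_mono)
    fix \<omega> assume "\<omega> \<in> space (P x)"
    then have w: "\<omega> \<in> path_space S" by (simp add: space_P[OF x])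
    show "indicator {\<omega>. \<sigma> \<omega> \<le> ennreal t} \<omega> * ennreal (\<phi> (\<omega> (truncated \<sigma> t \<omega>))) \<le> liminf (\<lambda>N. ennreal (?Y N \<omega>))"
    proof (cases "\<sigma> \<omega> \<le> ennreal t")
      case True
      have "liminf (\<lambda>N. ennreal (?Y N \<omega>)) = ennreal (\<phi> (\<omega> (truncated \<sigma> t \<omega>)))"
        by (intro lim_imp_Liminf[OF sequentially_bot] tendsto_ennrealI grid_limit[OF w t] True)
      then show ?thesis using True by simp
    qed simp
  qed
  also have "\<dots> \<le> liminf (\<lambda>N. \<integral>\<^sup>+\<omega>. ennreal (?Y N \<omega>) \<partial>P x)"
    using Y_int by (intro nn_integral_liminf measurable_compose[OF _ measurable_ennreal] borel_measurable_integrable)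
  also have "\<dots> \<le> liminf (\<lambda>N. ennreal B)"
  proof (intro Liminf_mono always_eventually allI)
    fix N
    have "(\<integral>\<^sup>+\<omega>. ennreal (?Y N \<omega>) \<partial>P x) = ennreal (\<integral>\<omega>. ?Y N \<omega> \<partial>P x)"
      by (intro nn_integral_eq_integral Y_int AE_I2 Y_nonneg)
    also have "(\<integral>\<omega>. ?Y N \<omega> \<partial>P x) = (\<Sum>i\<le>Suc N. \<integral>\<omega>. indicator (cell \<sigma> (grid t N) i) \<omega> * \<phi> (\<omega> (grid t N i)) \<partial>P x)"
      by (rule Bochner_Integration.integral_sum[OF int])
    finally show "(\<integral>\<^sup>+\<omega>. ennreal (?Y N \<omega>) \<partial>P x) \<le> ennreal B" using bound[of N] by (simp add: ennreal_leI)
  qed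
  finally show ?thesis by (simp add: Liminf_const)
qed

text \<open>The discounted weight is a supermartingale. On the grid, the mass not yet stopped is
  split at each step into what stops now and what continues, and the total never grows.\<close>

lemma stopped_supermartingale_bound:
  assumes MB: "moments_bounded" and x: "x \<in> states S" and t: "0 < t" and \<sigma>: "stopping \<sigma>" and C: "0 \<le> C"
    and super: "\<And>r z. 0 \<le> r \<Longrightarrow> z \<in> states S \<Longrightarrow> semigroup_op S p r \<phi> z \<le> exp (C * r) * \<phi> z"
  shows "(\<integral>\<^sup>+\<omega>. indicator {\<omega>. \<sigma> \<omega> \<le> ennreal t} \<omega> * ennreal (\<phi> (\<omega> (truncated \<sigma> t \<omega>))) \<partial>P x) \<le> ennreal (exp (C * t) * \<phi> x)"
proof (rule grid_fatou[OF MB x t \<sigma>])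
  fix N
  have t0: "0 \<le> t" using t by simp
  let ?\<theta> = "grid t N" and ?A = "cell \<sigma> (grid t N)"
  \<comment> \<open>Not stopped up to the i-th grid time. This event of the i-th time is the
    disjoint union of the next cell and the next such event.\<close>
  let ?B = "\<lambda>i. {\<omega> \<in> path_space S. \<forall>j\<in>{..i}. \<not> \<sigma> \<omega> \<le> ennreal (grid t N j)}"
  let ?E = "\<lambda>D i. \<integral>\<omega>. indicator D \<omega> * \<phi> (\<omega> (grid t N i)) \<partial>P x"
  have \<theta>0: "0 \<le> ?\<theta> i" for i by (rule grid_nonneg[OF t0])
  have AP: "?A i \<in> sets (P x)" for i
    by (rule sets_F_subset[OF x \<theta>0 cell_sets[OF \<sigma> \<theta>0 grid_mono[OF t0]]])
  have BF: "?B i \<in> sets (F (?\<theta> i))" for i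
  proof -
    have "{\<omega> \<in> space (F (?\<theta> i)). \<not> \<sigma> \<omega> \<le> ennreal (?\<theta> j)} \<in> sets (F (?\<theta> i))" if "j \<in> {..i}" for j
      using stopping_sets(2)[OF \<sigma> \<theta>0[of j] monoD[OF grid_mono[OF t0], of j i]] that by (simp add: space_F)
    then have "{\<omega> \<in> space (F (?\<theta> i)). \<forall>j\<in>{..i}. \<not> \<sigma> \<omega> \<le> ennreal (?\<theta> j)} \<in> sets (F (?\<theta> i))"
      by (rule sets.sets_Collect_finite_All[OF _ finite_atMost])
    then show ?thesis by (simp add: space_F)
  qed
  have BP: "?B i \<in> sets (P x)" for i by (rule sets_F_subset[OF x \<theta>0 BF])
  have int: "integrable (P x) (\<lambda>\<omega>. indicator D \<omega> * \<phi> (\<omega> (?\<theta> i)))" if "D \<in> sets (P x)" for D i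
    using integrable_mult_indicator[OF that poly_moment[OF MB \<phi>_poly x \<theta>0]] by simp
  have E_nonneg: "0 \<le> ?E D i" for D i by (intro integral_nonneg_AE AE_I2 mult_nonneg_nonneg \<phi>_nonneg) simp
  have step: "exp (- C * ?\<theta> (Suc i)) * (?E (?A (Suc i)) (Suc i) + ?E (?B (Suc i)) (Suc i)) \<le> exp (- C * ?\<theta> i) * ?E (?B i) i" for i
  proof -
    define h where "h = t / real (Suc N)"
    have h: "0 \<le> h" "?\<theta> (Suc i) = ?\<theta> i + h" using t0 by (auto simp: h_def grid_simps)
    have "?E (?A (Suc i)) (Suc i) + ?E (?B (Suc i)) (Suc i)
        = (\<integral>\<omega>. indicator (?A (Suc i)) \<omega> * \<phi> (\<omega> (?\<theta> (Suc i))) + indicator (?B (Suc i)) \<omega> * \<phi> (\<omega> (?\<theta> (Suc i))) \<partial>P x)"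
      by (rule Bochner_Integration.integral_add[OF int[OF AP] int[OF BP], symmetric])
    also have "\<dots> = (\<integral>\<omega>. indicator (?B i) \<omega> * \<phi> (\<omega> (?\<theta> i + h)) \<partial>P x)"
    proof -
      have "?B (Suc i) = {\<omega> \<in> ?B i. \<not> \<sigma> \<omega> \<le> ennreal (?\<theta> (Suc i))}" by (auto simp: atMost_Suc)
      moreover have "?A (Suc i) = {\<omega> \<in> ?B i. \<sigma> \<omega> \<le> ennreal (?\<theta> (Suc i))}"
        by (auto simp: cell_def less_Suc_eq_le)
      ultimately have "indicator (?A (Suc i)) \<omega> + indicator (?B (Suc i)) \<omega> = (indicator (?B i) \<omega> :: real)" for \<omega>
        by (simp only: indicator_def mem_Collect_eq) simp
      then show ?thesis unfolding h(2)[symmetric] distrib_right[symmetric] by simp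
    qed
    also have "\<dots> = (\<integral>\<omega>. indicator (?B i) \<omega> * semigroup_op S p h \<phi> (\<omega> (?\<theta> i)) \<partial>P x)"
      by (rule markov_integral(2)[OF poly_moment_function[OF MB \<phi>_poly] x \<theta>0 h(1) BF])
    also have "\<dots> \<le> (\<integral>\<omega>. exp (C * h) * (indicator (?B i) \<omega> * \<phi> (\<omega> (?\<theta> i))) \<partial>P x)"
    proof (rule integral_mono)
      show "integrable (P x) (\<lambda>\<omega>. indicator (?B i) \<omega> * semigroup_op S p h \<phi> (\<omega> (?\<theta> i)))"
        using integrable_mult_indicator[OF BP markov_integral(1)[OF poly_moment_function[OF MB \<phi>_poly] x \<theta>0 h(1)]] by simp
      show "integrable (P x) (\<lambda>\<omega>. exp (C * h) * (indicator (?B i) \<omega> * \<phi> (\<omega> (?\<theta> i))))"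
        by (rule integrable_mult_right[OF int[OF BP]])
      fix \<omega> assume "\<omega> \<in> space (P x)"
      then show "indicator (?B i) \<omega> * semigroup_op S p h \<phi> (\<omega> (?\<theta> i)) \<le> exp (C * h) * (indicator (?B i) \<omega> * \<phi> (\<omega> (?\<theta> i)))"
        using super[OF h(1) path_P[OF x _ \<theta>0]] by (auto simp: indicator_def)
    qed
    also have "\<dots> = exp (C * h) * ?E (?B i) i" by simp
    finally have "exp (- C * ?\<theta> (Suc i)) * (?E (?A (Suc i)) (Suc i) + ?E (?B (Suc i)) (Suc i))
        \<le> exp (- C * ?\<theta> (Suc i)) * (exp (C * h) * ?E (?B i) i)"
      by (rule mult_left_mono) simp
    also have "\<dots> = exp (- C * ?\<theta> i) * ?E (?B i) i"
      unfolding h(2) by (simp add: mult.assoc[symmetric] exp_add[symmetric] algebra_simps)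
    finally show ?thesis .
  qed
  \<comment> \<open>Discounted mass already stopped plus discounted mass still running; at time 0
    the total is \<open>\<phi> x\<close>.\<close>
  have "(\<Sum>j\<le>i. exp (- C * ?\<theta> j) * ?E (?A j) j) + exp (- C * ?\<theta> i) * ?E (?B i) i \<le> \<phi> x" for i
  proof (induction i)
    case 0
    have "?E (?A 0) 0 + ?E (?B 0) 0 = (\<integral>\<omega>. indicator (?A 0) \<omega> * \<phi> (\<omega> (?\<theta> 0)) + indicator (?B 0) \<omega> * \<phi> (\<omega> (?\<theta> 0)) \<partial>P x)"
      by (rule Bochner_Integration.integral_add[OF int[OF AP] int[OF BP], symmetric])
    also have "\<dots> = (\<integral>\<omega>. \<phi> (\<omega> 0) \<partial>P x)"
      by (intro Bochner_Integration.integral_cong refl) (auto simp: indicator_def cell_def grid_simps space_P[OF x])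
    also have "\<dots> = \<phi> x" using semigroup_zero[OF \<phi>_poly x] semigroup_op_poly[OF \<phi>_poly x order_refl] by simp
    finally show ?case by (simp add: grid_simps)
  next
    case (Suc i)
    then show ?case using step[of i] by (simp add: distrib_left)
  qed
  from this[of "Suc N"] have "(\<Sum>j\<le>Suc N. exp (- C * ?\<theta> j) * ?E (?A j) j) \<le> \<phi> x"
    using mult_nonneg_nonneg[OF exp_ge_zero[of "- C * ?\<theta> (Suc N)"] E_nonneg[of "?B (Suc N)" "Suc N"]] by linarith
  moreover have "exp (- C * t) * (\<Sum>j\<le>Suc N. ?E (?A j) j) \<le> (\<Sum>j\<le>Suc N. exp (- C * ?\<theta> j) * ?E (?A j) j)"
    unfolding sum_distrib_left
  proof (intro sum_mono mult_right_mono E_nonneg)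
    fix j assume "j \<in> {..Suc N}"
    then show "exp (- C * t) \<le> exp (- C * ?\<theta> j)" using grid_le[OF t0, of j N] C by (auto intro!: mult_left_mono)
  qed
  ultimately have "exp (- C * t) * (\<Sum>j\<le>Suc N. ?E (?A j) j) \<le> \<phi> x" by linarith
  then have "exp (C * t) * (exp (- C * t) * (\<Sum>j\<le>Suc N. ?E (?A j) j)) \<le> exp (C * t) * \<phi> x"
    by (rule mult_left_mono) simp
  then show "(\<Sum>j\<le>Suc N. ?E (?A j) j) \<le> exp (C * t) * \<phi> x"
    by (simp add: mult.assoc[symmetric] exp_add[symmetric] del: sum.atMost_Suc)
qed

text \<open>On each cell the weight at the grid time is compared with the weight at t, and the cells
  are disjoint parts of the event \<sigma> \<le> t. Keeping this event on the right is the point: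
  its probability tends to 0 along a localizing sequence.\<close>

lemma stopped_submartingale_bound:
  assumes MB: "moments_bounded" and x: "x \<in> states S" and t: "0 < t" and \<sigma>: "stopping \<sigma>" and K: "0 \<le> K"
    and lower: "\<And>r z. r \<in> {0..t} \<Longrightarrow> z \<in> states S \<Longrightarrow> \<phi> z \<le> K * semigroup_op S p r \<phi> z"
  shows "(\<integral>\<^sup>+\<omega>. indicator {\<omega>. \<sigma> \<omega> \<le> ennreal t} \<omega> * ennreal (\<phi> (\<omega> (truncated \<sigma> t \<omega>))) \<partial>P x)
    \<le> ennreal (K * (\<integral>\<omega>. indicator {\<omega> \<in> path_space S. \<sigma> \<omega> \<le> ennreal t} \<omega> * \<phi> (\<omega> t) \<partial>P x))"
proof (rule grid_fatou[OF MB x t \<sigma>])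
  fix N
  have t0: "0 \<le> t" using t by simp
  let ?A = "cell \<sigma> (grid t N)"
  let ?D = "{\<omega> \<in> path_space S. \<sigma> \<omega> \<le> ennreal t}"
  have \<theta>0: "0 \<le> grid t N i" for i by (rule grid_nonneg[OF t0])
  have AF: "?A i \<in> sets (F (grid t N i))" for i by (rule cell_sets[OF \<sigma> \<theta>0 grid_mono[OF t0]])
  have AP: "?A i \<in> sets (P x)" for i by (rule sets_F_subset[OF x \<theta>0 AF])
  have DP: "?D \<in> sets (P x)" by (rule sets_F_subset[OF x t0 stopping_sets(1)[OF \<sigma> t0 order_refl]])
  have int: "integrable (P x) (\<lambda>\<omega>. indicator D \<omega> * \<phi> (\<omega> t))" if "D \<in> sets (P x)" for D
    using integrable_mult_indicator[OF that poly_moment[OF MB \<phi>_poly x t0]] by simp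
  have "(\<Sum>i\<le>Suc N. \<integral>\<omega>. indicator (?A i) \<omega> * \<phi> (\<omega> (grid t N i)) \<partial>P x)
      \<le> (\<Sum>i\<le>Suc N. K * (\<integral>\<omega>. indicator (?A i) \<omega> * \<phi> (\<omega> t) \<partial>P x))"
  proof (rule sum_mono)
    fix i assume "i \<in> {..Suc N}"
    then have "grid t N i \<le> t" by (intro grid_le[OF t0]) simp
    then show "(\<integral>\<omega>. indicator (?A i) \<omega> * \<phi> (\<omega> (grid t N i)) \<partial>P x) \<le> K * (\<integral>\<omega>. indicator (?A i) \<omega> * \<phi> (\<omega> t) \<partial>P x)"
      using \<theta>0[of i] by (intro \<phi>_conditional_lower[OF poly_moment_function[OF MB \<phi>_poly] x \<theta>0 _ lower AF]) auto
  qed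
  also have "\<dots> = K * (\<integral>\<omega>. (\<Sum>i\<le>Suc N. indicator (?A i) \<omega> * \<phi> (\<omega> t)) \<partial>P x)"
    unfolding sum_distrib_left[symmetric] by (subst Bochner_Integration.integral_sum[OF int[OF AP]]) simp
  also have "\<dots> \<le> K * (\<integral>\<omega>. indicator ?D \<omega> * \<phi> (\<omega> t) \<partial>P x)"
  proof (intro mult_left_mono K integral_mono Bochner_Integration.integrable_sum int AP DP)
    fix \<omega>
    have "(\<Sum>i\<le>Suc N. indicator (?A i) \<omega>) \<le> (indicator ?D \<omega> :: real)"
    proof (cases "\<exists>i\<in>{..Suc N}. \<omega> \<in> ?A i")
      case True
      then obtain i where i: "i \<le> Suc N" "\<omega> \<in> ?A i" by blast
      have "\<sigma> \<omega> \<le> ennreal (grid t N i)" "\<omega> \<in> path_space S" using i by (auto simp: cell_def)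
      then have "\<omega> \<in> ?D" using grid_le[OF t0 i(1)] by (auto intro: order_trans ennreal_leI)
      moreover have "(\<Sum>j\<le>Suc N. indicator (?A j) \<omega>) = (1 :: real)"
        unfolding cell_indicator[OF i(2)] using i(1) by (subst sum.delta) (simp_all del: sum.atMost_Suc)
      ultimately show ?thesis by simp
    next
      case False
      then have "(\<Sum>i\<le>Suc N. indicator (?A i) \<omega>) = (0 :: real)" by (intro sum.neutral) auto
      then show ?thesis by simp
    qed
    then show "(\<Sum>i\<le>Suc N. indicator (?A i) \<omega> * \<phi> (\<omega> t)) \<le> indicator ?D \<omega> * \<phi> (\<omega> t)"
      unfolding sum_distrib_right[symmetric] by (intro mult_right_mono \<phi>_nonneg)
  qed
  finally show "(\<Sum>i\<le>Suc N. \<integral>\<omega>. indicator (?A i) \<omega> * \<phi> (\<omega> (grid t N i)) \<partial>P x)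
      \<le> K * (\<integral>\<omega>. indicator ?D \<omega> * \<phi> (\<omega> t) \<partial>P x)" .
qed

section \<open>From the generator to polynomial processes\<close>

text \<open>The part of a localizing sequence that enters the limit arguments.\<close>

definition exhausting :: "'n state \<Rightarrow> (nat \<Rightarrow> 'n path \<Rightarrow> ennreal) \<Rightarrow> bool" where
  "exhausting x \<tau> \<longleftrightarrow> (\<forall>n. stopping (\<tau> n)) \<and> (AE \<omega> in P x. (\<lambda>n. \<tau> n \<omega>) \<longlonglongrightarrow> \<infinity>)"

text \<open>The expectation of |f| at \<sigma> on the event \<sigma> \<le> t, with values in
  \<open>ennreal\<close> so that it makes sense before integrability is known.\<close>

definition stopped_mass :: "('n state \<Rightarrow> real) \<Rightarrow> 'n state \<Rightarrow> real \<Rightarrow> ('n path \<Rightarrow> ennreal) \<Rightarrow> ennreal" where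
  "stopped_mass f x t \<sigma> =
    (\<integral>\<^sup>+\<omega>. indicator {\<omega>. \<sigma> \<omega> \<le> ennreal t} \<omega> * ennreal \<bar>f (\<omega> (truncated \<sigma> t \<omega>))\<bar> \<partial>P x)"

lemma exhausting_tendsto_zero:
  fixes Y :: "'n path \<Rightarrow> real"
  assumes x: "x \<in> states S" and \<tau>: "exhausting x \<tau>" and t: "0 \<le> t" and Y: "integrable (P x) Y"
  shows "(\<lambda>n. \<integral>\<omega>. indicator {\<omega> \<in> path_space S. \<tau> n \<omega> \<le> ennreal t} \<omega> * Y \<omega> \<partial>P x) \<longlonglongrightarrow> 0"
proof -
  have st: "stopping (\<tau> n)" for n using \<tau> by (simp add: exhausting_def)
  have DP [measurable]: "{\<omega> \<in> path_space S. \<tau> n \<omega> \<le> ennreal t} \<in> sets (P x)" for n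
    by (rule sets_F_subset[OF x t stopping_sets(1)[OF st t order_refl]])
  note [measurable] = borel_measurable_integrable[OF Y]
  have "(\<lambda>n. \<integral>\<omega>. indicator {\<omega> \<in> path_space S. \<tau> n \<omega> \<le> ennreal t} \<omega> * Y \<omega> \<partial>P x) \<longlonglongrightarrow> (\<integral>\<omega>. 0 \<partial>P x)"
  proof (rule integral_dominated_convergence[where w = "\<lambda>\<omega>. \<bar>Y \<omega>\<bar>"])
    have "AE \<omega> in P x. (\<lambda>n. \<tau> n \<omega>) \<longlonglongrightarrow> \<infinity>" using \<tau> by (simp add: exhausting_def)
    then show "AE \<omega> in P x. (\<lambda>n. indicator {\<omega> \<in> path_space S. \<tau> n \<omega> \<le> ennreal t} \<omega> * Y \<omega>) \<longlonglongrightarrow> 0"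
    proof eventually_elim
      case (elim \<omega>)
      have "eventually (\<lambda>n. ennreal t < \<tau> n \<omega>) sequentially"
        by (rule order_tendstoD(1)[OF elim]) simp
      then have "eventually (\<lambda>n. indicator {\<omega> \<in> path_space S. \<tau> n \<omega> \<le> ennreal t} \<omega> * Y \<omega> = 0) sequentially"
        by eventually_elim (simp add: not_le[symmetric])
      then show ?case by (rule tendsto_eventually)
    qed
    show "integrable (P x) (\<lambda>\<omega>. \<bar>Y \<omega>\<bar>)" using Y by simp
    show "AE \<omega> in P x. norm (indicator {\<omega> \<in> path_space S. \<tau> n \<omega> \<le> ennreal t} \<omega> * Y \<omega>) \<le> \<bar>Y \<omega>\<bar>" for n
      by (intro AE_I2) (simp add: indicator_def)
  qed measurable
  then show ?thesis by simp
qed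

text \<open>
  A local martingale has constant expectation as soon as the mass picked up at the localizing
  times vanishes in the limit.
\<close>

lemma dynkin_of_vanishing_mass:
  assumes MB: "moments_bounded" and f: "f \<in> poly_space S m" and g: "g \<in> poly_space S m"
    and gph: "(f, g) \<in> generator_graph S F P"
    and vanish: "\<And>x t \<tau>. x \<in> states S \<Longrightarrow> 0 < t \<Longrightarrow> exhausting x \<tau> \<Longrightarrow> (\<lambda>n. stopped_mass f x t (\<tau> n)) \<longlonglongrightarrow> 0"
  shows "dynkin f g"
  unfolding dynkin_def
proof (intro ballI allI impI)
  fix x t assume x: "x \<in> states S" and t0: "0 \<le> (t :: real)"
  interpret prob_space "P x" using prob[OF x] .
  show "semigroup_op S p t f x = f x + (LINT s:{0..t}|lborel. semigroup_op S p s g x)"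
  proof (cases "t = 0")
    case True
    then show ?thesis
      using semigroup_zero[OF f x] set_integral_at_point[of lborel "0 :: real" "\<lambda>s. semigroup_op S p s g x"] by simp
  next
    case False
    then have t: "0 < t" using t0 by simp
    from gph x have lm: "local_martingale (P x) F (generator_process f g x)"
      and int_g: "AE \<omega> in P x. \<forall>t\<ge>0. set_integrable lborel {0..t} (\<lambda>s. g (\<omega> s))"
      by (auto simp: generator_graph_def)
    from lm obtain \<tau> :: "nat \<Rightarrow> 'n path \<Rightarrow> ennreal" where
      st: "\<And>n. stopping (\<tau> n)" and lim: "AE \<omega> in P x. (\<lambda>n. \<tau> n \<omega>) \<longlonglongrightarrow> \<infinity>"
      and mart: "\<And>n. martingale (P x) F (\<lambda>t \<omega>. generator_process f g x (truncated (\<tau> n) t \<omega>) \<omega>)"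
      unfolding local_martingale_def stopping_def truncated_def by (auto elim!: eventually_mono)
    have ex: "exhausting x \<tau>" using st lim by (simp add: exhausting_def)
    obtain C where C: "C \<ge> 0" "\<And>z. z \<in> states S \<Longrightarrow> \<bar>g z\<bar> \<le> C * \<phi> z" using poly_bound[OF g] by blast
    let ?M = "generator_process f g x t"
    let ?N = "\<lambda>n \<omega>. generator_process f g x (truncated (\<tau> n) t \<omega>) \<omega>"
    let ?D = "\<lambda>n. {\<omega> \<in> path_space S. \<tau> n \<omega> \<le> ennreal t}"
    \<comment> \<open>Bounds the difference between the process at t and the stopped process, apart
      from the value of f at the stopping time: the terminal value, and the integral of g over the
      remaining time estimated through \<open>\<phi>\<close>.\<close>
    define Y where "Y \<omega> = \<bar>f (\<omega> t)\<bar> + C * (LINT s:{0..t}|lborel. \<phi> (\<omega> s))" for \<omega>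
    have Y_int: "integrable (P x) Y"
      unfolding Y_def[abs_def]
      by (intro Bochner_Integration.integrable_add integrable_abs poly_moment[OF MB f x t0]
          integrable_mult_right time_integral_integrable[OF MB \<phi>_poly x t0])
    have Y_nonneg: "0 \<le> Y \<omega>" for \<omega>
      unfolding Y_def set_lebesgue_integral_def using C(1) \<phi>_nonneg
      by (intro add_nonneg_nonneg mult_nonneg_nonneg integral_nonneg_AE AE_I2) auto
    have M_int: "integrable (P x) ?M"
      unfolding generator_process_def[abs_def]
      by (intro Bochner_Integration.integrable_diff poly_moment[OF MB f x t0] time_integral_integrable[OF MB g x t0]) simp
    have N_int: "integrable (P x) (?N n)" for n using mart[of n] t0 by (simp add: martingale_def)
    have DP: "?D n \<in> sets (P x)" for n by (rule sets_F_subset[OF x t0 stopping_sets(1)[OF st t0 order_refl]])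
    have DY_int: "integrable (P x) (\<lambda>\<omega>. indicator (?D n) \<omega> * Y \<omega>)" for n
      using integrable_mult_indicator[OF DP Y_int] by simp
    \<comment> \<open>Where \<open>\<tau> n\<close> exceeds t the two processes agree, so everything
      lives on the event that \<open>\<tau> n\<close> is at most t.\<close>
    have pointwise: "AE \<omega> in P x. ennreal \<bar>?M \<omega> - ?N n \<omega>\<bar> \<le> ennreal (indicator (?D n) \<omega> * Y \<omega>)
        + indicator {\<omega>. \<tau> n \<omega> \<le> ennreal t} \<omega> * ennreal \<bar>f (\<omega> (truncated (\<tau> n) t \<omega>))\<bar>" for n
      using int_g time_path_integrable[OF MB \<phi>_poly x t0] AE_space
    proof eventually_elim
      case (elim \<omega>)
      have w: "\<omega> \<in> path_space S" using elim(3) by (simp add: space_P[OF x])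
      show ?case
      proof (cases "\<tau> n \<omega> \<le> ennreal t")
        case False
        then show ?thesis using truncated_eq(1)[OF t0, of "\<tau> n" \<omega>] by simp
      next
        case True
        define u where "u = truncated (\<tau> n) t \<omega>"
        have u: "0 \<le> u" "u \<le> t" unfolding u_def using truncated_bounds[OF t0] by auto
        have gi: "set_integrable lborel {0..t} (\<lambda>s. g (\<omega> s))" using elim(1) t0 by blast
        have gu: "set_integrable lborel {0..u} (\<lambda>s. g (\<omega> s))" using elim(1) u by blast
        have "(LINT s:{0..t}|lborel. g (\<omega> s)) - (LINT s:{0..u}|lborel. g (\<omega> s))
            = (\<integral>s. indicator {0..t} s * g (\<omega> s) - indicator {0..u} s * g (\<omega> s) \<partial>lborel)"
          using gi gu unfolding set_lebesgue_integral_def set_integrable_def by simp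
        also have "\<bar>\<dots>\<bar> \<le> (\<integral>s. indicator {0..t} s * (C * \<phi> (\<omega> s)) \<partial>lborel)"
        proof (rule order_trans[OF integral_abs_bound integral_mono])
          show "integrable lborel (\<lambda>s. \<bar>indicator {0..t} s * g (\<omega> s) - indicator {0..u} s * g (\<omega> s)\<bar>)"
            using gi gu unfolding set_integrable_def by simp
          show "integrable lborel (\<lambda>s. indicator {0..t} s * (C * \<phi> (\<omega> s)))"
            using elim(2) unfolding set_integrable_def by (simp add: mult.left_commute)
          show "\<bar>indicator {0..t} s * g (\<omega> s) - indicator {0..u} s * g (\<omega> s)\<bar> \<le> indicator {0..t} s * (C * \<phi> (\<omega> s))" for s
            using C(2)[OF path_in_states[OF w], of s] C(1) \<phi>_nonneg[of "\<omega> s"] u by (auto simp: indicator_def)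
        qed
        also have "\<dots> = C * (LINT s:{0..t}|lborel. \<phi> (\<omega> s))"
          by (simp add: set_lebesgue_integral_def mult.left_commute)
        finally have "\<bar>?M \<omega> - ?N n \<omega>\<bar> \<le> Y \<omega> + \<bar>f (\<omega> u)\<bar>"
          unfolding generator_process_def Y_def u_def[symmetric] by linarith
        then have "ennreal \<bar>?M \<omega> - ?N n \<omega>\<bar> \<le> ennreal (Y \<omega>) + ennreal \<bar>f (\<omega> u)\<bar>"
          using Y_nonneg by (simp add: ennreal_leI flip: ennreal_plus)
        then show ?thesis using True w by (simp add: u_def)
      qed
    qed
    have f_meas: "(\<lambda>\<omega>. f (\<omega> (truncated (\<tau> n) t \<omega>))) \<in> borel_measurable (P x)" for n
      by (rule observable_at_truncated[OF f st t0 x])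
    have meas: "(\<lambda>\<omega>. ennreal (indicator E \<omega> * Y \<omega>)) \<in> borel_measurable (P x)"
      "(\<lambda>\<omega>. indicator E \<omega> * ennreal \<bar>f (\<omega> (truncated (\<tau> n) t \<omega>))\<bar>) \<in> borel_measurable (P x)"
      if "E \<in> sets (P x)" for E n
      using that f_meas[of n] borel_measurable_integrable[OF Y_int] by measurable
    have bound: "ennreal \<bar>\<integral>\<omega>. ?M \<omega> \<partial>P x\<bar> \<le> ennreal (\<integral>\<omega>. indicator (?D n) \<omega> * Y \<omega> \<partial>P x) + stopped_mass f x t (\<tau> n)" for n
    proof -
      have "(\<integral>\<omega>. ?M \<omega> \<partial>P x) = (\<integral>\<omega>. ?M \<omega> - ?N n \<omega> \<partial>P x)"
        using Bochner_Integration.integral_diff[OF M_int N_int] stopped_mean_zero[OF x mart t0] by simp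
      then have "ennreal \<bar>\<integral>\<omega>. ?M \<omega> \<partial>P x\<bar> \<le> ennreal (\<integral>\<omega>. \<bar>?M \<omega> - ?N n \<omega>\<bar> \<partial>P x)"
        by (simp add: ennreal_leI)
      also have "\<dots> = (\<integral>\<^sup>+\<omega>. ennreal \<bar>?M \<omega> - ?N n \<omega>\<bar> \<partial>P x)"
        using M_int N_int by (intro nn_integral_eq_integral[symmetric] integrable_abs Bochner_Integration.integrable_diff) auto
      also have "\<dots> \<le> (\<integral>\<^sup>+\<omega>. ennreal (indicator (?D n) \<omega> * Y \<omega>)
          + indicator {\<omega>. \<tau> n \<omega> \<le> ennreal t} \<omega> * ennreal \<bar>f (\<omega> (truncated (\<tau> n) t \<omega>))\<bar> \<partial>P x)"
        by (rule nn_integral_mono_AE[OF pointwise])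
      also have "\<dots> = (\<integral>\<^sup>+\<omega>. ennreal (indicator (?D n) \<omega> * Y \<omega>)
          + indicator (?D n) \<omega> * ennreal \<bar>f (\<omega> (truncated (\<tau> n) t \<omega>))\<bar> \<partial>P x)"
        by (intro nn_integral_cong) (auto simp: indicator_def space_P[OF x])
      also have "\<dots> = (\<integral>\<^sup>+\<omega>. ennreal (indicator (?D n) \<omega> * Y \<omega>) \<partial>P x)
          + (\<integral>\<^sup>+\<omega>. indicator (?D n) \<omega> * ennreal \<bar>f (\<omega> (truncated (\<tau> n) t \<omega>))\<bar> \<partial>P x)"
        by (intro nn_integral_add meas DP)
      also have "(\<integral>\<^sup>+\<omega>. indicator (?D n) \<omega> * ennreal \<bar>f (\<omega> (truncated (\<tau> n) t \<omega>))\<bar> \<partial>P x) = stopped_mass f x t (\<tau> n)"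
        unfolding stopped_mass_def by (intro nn_integral_cong) (auto simp: indicator_def space_P[OF x])
      also have "(\<integral>\<^sup>+\<omega>. ennreal (indicator (?D n) \<omega> * Y \<omega>) \<partial>P x) = ennreal (\<integral>\<omega>. indicator (?D n) \<omega> * Y \<omega> \<partial>P x)"
        by (intro nn_integral_eq_integral DY_int AE_I2 mult_nonneg_nonneg Y_nonneg) simp
      finally show ?thesis .
    qed
    have "(\<lambda>n. ennreal (\<integral>\<omega>. indicator (?D n) \<omega> * Y \<omega> \<partial>P x) + stopped_mass f x t (\<tau> n)) \<longlonglongrightarrow> ennreal 0 + 0"
      by (intro tendsto_add tendsto_ennrealI exhausting_tendsto_zero[OF x ex t0 Y_int] vanish x t ex)
    then have "ennreal \<bar>\<integral>\<omega>. ?M \<omega> \<partial>P x\<bar> \<le> ennreal 0 + 0"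
      by (rule LIMSEQ_le_const) (use bound in blast)
    then have zero: "(\<integral>\<omega>. ?M \<omega> \<partial>P x) = 0" by simp
    have "(\<integral>\<omega>. ?M \<omega> \<partial>P x) = (\<integral>\<omega>. f (\<omega> t) \<partial>P x) - f x - (\<integral>\<omega>. (LINT s:{0..t}|lborel. g (\<omega> s)) \<partial>P x)"
      unfolding generator_process_def
      using poly_moment[OF MB f x t0] time_integral_integrable[OF MB g x t0] by (simp add: prob_space)
    then show ?thesis
      using zero semigroup_op_poly[OF f x t0] expectation_time_integral[OF MB g x t0] by simp
  qed
qed

text \<open>An affine bound serves both degrees: a small multiple of \<open>\<phi>\<close> plus a
  large constant in half degree, no constant in degree \<open>m\<close>.\<close>

lemma stopped_mass_le:
  assumes x: "x \<in> states S" and t: "0 \<le> t" and \<sigma>: "stopping \<sigma>" and C: "0 \<le> C" and D: "0 \<le> D"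
    and le: "\<And>z. z \<in> states S \<Longrightarrow> \<bar>f z\<bar> \<le> C * \<phi> z + D"
  shows "stopped_mass f x t \<sigma> \<le> ennreal C * stopped_mass \<phi> x t \<sigma>
    + ennreal (D * (\<integral>\<omega>. indicator {\<omega> \<in> path_space S. \<sigma> \<omega> \<le> ennreal t} \<omega> \<partial>P x))"
proof -
  interpret prob_space "P x" using prob[OF x] .
  let ?D = "{\<omega> \<in> path_space S. \<sigma> \<omega> \<le> ennreal t}"
  let ?u = "truncated \<sigma> t"
  have DP: "?D \<in> sets (P x)" by (rule sets_F_subset[OF x t stopping_sets(1)[OF \<sigma> t order_refl]])
  have m: "(\<lambda>\<omega>. \<phi> (\<omega> (?u \<omega>))) \<in> borel_measurable (P x)" by (rule observable_at_truncated[OF \<phi>_poly \<sigma> t x])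
  have "stopped_mass f x t \<sigma> \<le> (\<integral>\<^sup>+\<omega>. ennreal C * (indicator ?D \<omega> * ennreal \<bar>\<phi> (\<omega> (?u \<omega>))\<bar>) + ennreal D * indicator ?D \<omega> \<partial>P x)"
    unfolding stopped_mass_def
  proof (rule nn_integral_mono)
    fix \<omega> assume w: "\<omega> \<in> space (P x)"
    have "\<omega> (?u \<omega>) \<in> states S" using truncated_bounds(1)[OF t] by (intro path_P[OF x w])
    then have "ennreal \<bar>f (\<omega> (?u \<omega>))\<bar> \<le> ennreal (C * \<bar>\<phi> (\<omega> (?u \<omega>))\<bar> + D)"
      using le \<phi>_nonneg by (simp add: ennreal_leI)
    also have "\<dots> = ennreal C * ennreal \<bar>\<phi> (\<omega> (?u \<omega>))\<bar> + ennreal D"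
      using C D by (simp add: ennreal_mult ennreal_plus)
    finally show "indicator {\<omega>. \<sigma> \<omega> \<le> ennreal t} \<omega> * ennreal \<bar>f (\<omega> (?u \<omega>))\<bar>
        \<le> ennreal C * (indicator ?D \<omega> * ennreal \<bar>\<phi> (\<omega> (?u \<omega>))\<bar>) + ennreal D * indicator ?D \<omega>"
      using w by (auto simp: indicator_def space_P[OF x])
  qed
  also have "\<dots> = ennreal C * (\<integral>\<^sup>+\<omega>. indicator ?D \<omega> * ennreal \<bar>\<phi> (\<omega> (?u \<omega>))\<bar> \<partial>P x) + ennreal D * emeasure (P x) ?D"
    using DP m by (simp add: nn_integral_add nn_integral_cmult)
  also have "(\<integral>\<^sup>+\<omega>. indicator ?D \<omega> * ennreal \<bar>\<phi> (\<omega> (?u \<omega>))\<bar> \<partial>P x) = stopped_mass \<phi> x t \<sigma>"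
    unfolding stopped_mass_def by (intro nn_integral_cong) (auto simp: indicator_def space_P[OF x])
  also have "ennreal D * emeasure (P x) ?D = ennreal (D * (\<integral>\<omega>. indicator ?D \<omega> \<partial>P x))"
    using DP D by (simp add: emeasure_eq_measure ennreal_mult)
  finally show ?thesis .
qed

text \<open>Uniform integrability from bounded second moments: f is at most a small multiple of
  \<open>\<phi>\<close>, whose stopped mass is bounded, plus a constant, which is charged only on an
  event of vanishing probability.\<close>

lemma vanishing_mass_half_degree:
  assumes f: "f \<in> poly_space S k" and k: "2 * k \<le> m"
    and bounded: "\<And>\<sigma>. stopping \<sigma> \<Longrightarrow> stopped_mass \<phi> x t \<sigma> \<le> ennreal B"
    and x: "x \<in> states S" and t: "0 < t" and \<tau>: "exhausting x \<tau>"
  shows "(\<lambda>n. stopped_mass f x t (\<tau> n)) \<longlonglongrightarrow> 0"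
proof (rule tendsto_zero_ennrealI)
  fix e :: real assume e: "0 < e"
  interpret prob_space "P x" using prob[OF x] .
  have t0: "0 \<le> t" using t by simp
  obtain C where C: "C \<ge> 0" "\<And>z. z \<in> states S \<Longrightarrow> (f z)\<^sup>2 \<le> C * \<phi> z"
    using poly_space_square_le_power_weight[OF f k even_m] by blast
  \<comment> \<open>Makes \<open>d * C * \<bar>B\<bar>\<close> at most \<open>e / 2\<close>; the 1
    keeps the denominator positive.\<close>
  define d where "d = e / (2 * (C * \<bar>B\<bar> + 1))"
  have CB: "0 \<le> C * \<bar>B\<bar>" using C by simp
  have d: "0 < d" using e CB by (simp add: d_def add_nonneg_pos)
  have dB: "d * C * \<bar>B\<bar> \<le> e / 2"
  proof -
    have "d * (C * \<bar>B\<bar>) \<le> d * (C * \<bar>B\<bar> + 1)" using d by simp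
    also have "\<dots> = e / 2" using CB by (simp add: d_def field_simps)
    finally show ?thesis by (simp add: mult.assoc)
  qed
  \<comment> \<open>Young's inequality, from the square of \<open>d * \<bar>f z\<bar> - 1\<close>
    with a factor 2 given away.\<close>
  have young: "\<bar>f z\<bar> \<le> d * C * \<phi> z + 1 / d" if "z \<in> states S" for z
  proof -
    have "0 \<le> (d * \<bar>f z\<bar> - 1)\<^sup>2" by simp
    then have "2 * d * \<bar>f z\<bar> \<le> d\<^sup>2 * (f z)\<^sup>2 + 1" by (simp add: power2_diff power_mult_distrib)
    moreover have "d * \<bar>f z\<bar> \<ge> 0" using d by simp
    ultimately have "d * \<bar>f z\<bar> \<le> d\<^sup>2 * (f z)\<^sup>2 + 1" by linarith
    also have "\<dots> \<le> d\<^sup>2 * (C * \<phi> z) + 1" using C(2)[OF that] by (simp add: mult_left_mono)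
    finally have "d * \<bar>f z\<bar> \<le> d * (d * C * \<phi> z + 1 / d)" using d by (simp add: power2_eq_square algebra_simps)
    then show ?thesis using d by simp
  qed
  let ?p = "\<lambda>n. \<integral>\<omega>. indicator {\<omega> \<in> path_space S. \<tau> n \<omega> \<le> ennreal t} \<omega> \<partial>P x"
  have "(\<lambda>n. \<integral>\<omega>. indicator {\<omega> \<in> path_space S. \<tau> n \<omega> \<le> ennreal t} \<omega> * (1 :: real) \<partial>P x) \<longlonglongrightarrow> 0"
    by (rule exhausting_tendsto_zero[OF x \<tau> t0]) simp
  then have "(\<lambda>n. 1 / d * ?p n) \<longlonglongrightarrow> 1 / d * 0"
    by (intro tendsto_mult_left) (simp only: mult_1_right)
  then have "eventually (\<lambda>n. 1 / d * ?p n < e / 2) sequentially"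
    using e by (intro order_tendstoD(2)[where y = "1 / d * 0"]) auto
  then show "eventually (\<lambda>n. stopped_mass f x t (\<tau> n) \<le> ennreal e) sequentially"
  proof eventually_elim
    case (elim n)
    have st: "stopping (\<tau> n)" using \<tau> by (simp add: exhausting_def)
    have "stopped_mass f x t (\<tau> n) \<le> ennreal (d * C) * stopped_mass \<phi> x t (\<tau> n) + ennreal (1 / d * ?p n)"
      using d C by (intro stopped_mass_le[OF x t0 st] young) auto
    also have "\<dots> \<le> ennreal (d * C) * ennreal \<bar>B\<bar> + ennreal (e / 2)"
      using elim by (intro add_mono mult_left_mono order_trans[OF bounded[OF st]] ennreal_leI) auto
    also have "\<dots> = ennreal (d * C * \<bar>B\<bar> + e / 2)"
      using d C e by (simp add: ennreal_mult ennreal_plus)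
    also have "\<dots> \<le> ennreal e" using dB by (intro ennreal_leI) simp
    finally show ?case .
  qed
qed

text \<open>The dominating variable is the weight at the fixed time t, integrable and independent of
  n; dominated convergence then needs no moment beyond degree \<open>m\<close>.\<close>

lemma vanishing_mass_of_lower_bound:
  assumes MB: "moments_bounded" and f: "f \<in> poly_space S m" and K: "0 \<le> K"
    and lower: "\<And>r z. r \<in> {0..t} \<Longrightarrow> z \<in> states S \<Longrightarrow> \<phi> z \<le> K * semigroup_op S p r \<phi> z"
    and x: "x \<in> states S" and t: "0 < t" and \<tau>: "exhausting x \<tau>"
  shows "(\<lambda>n. stopped_mass f x t (\<tau> n)) \<longlonglongrightarrow> 0"
proof -
  have t0: "0 \<le> t" using t by simp
  obtain C where C: "C \<ge> 0" "\<And>z. z \<in> states S \<Longrightarrow> \<bar>f z\<bar> \<le> C * \<phi> z" using poly_bound[OF f] by blast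
  let ?q = "\<lambda>n. K * (\<integral>\<omega>. indicator {\<omega> \<in> path_space S. \<tau> n \<omega> \<le> ennreal t} \<omega> * \<phi> (\<omega> t) \<partial>P x)"
  have le: "stopped_mass f x t (\<tau> n) \<le> ennreal C * ennreal (?q n)" for n
  proof -
    have st: "stopping (\<tau> n)" using \<tau> by (simp add: exhausting_def)
    have "stopped_mass f x t (\<tau> n) \<le> ennreal C * stopped_mass \<phi> x t (\<tau> n) + ennreal (0 * (\<integral>\<omega>. indicator {\<omega> \<in> path_space S. \<tau> n \<omega> \<le> ennreal t} \<omega> \<partial>P x))"
      using C by (intro stopped_mass_le[OF x t0 st]) auto
    also have "\<dots> \<le> ennreal C * ennreal (?q n)"
      using stopped_submartingale_bound[OF MB x t st K lower]
      by (simp add: stopped_mass_def \<phi>_nonneg mult_left_mono)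
    finally show ?thesis .
  qed
  have "(\<lambda>n. ennreal (C * ?q n)) \<longlonglongrightarrow> ennreal (C * (K * 0))"
    by (intro tendsto_ennrealI tendsto_mult_left exhausting_tendsto_zero[OF x \<tau> t0] poly_moment[OF MB \<phi>_poly x t0])
  moreover have "0 \<le> ?q n" for n using K \<phi>_nonneg by (intro mult_nonneg_nonneg integral_nonneg_AE AE_I2) auto
  ultimately have lim: "(\<lambda>n. ennreal C * ennreal (?q n)) \<longlonglongrightarrow> 0"
    using C(1) by (simp add: ennreal_mult)
  show ?thesis
    by (rule tendsto_sandwich[OF _ _ tendsto_const lim]) (auto intro!: always_eventually le)
qed

section \<open>Lower bounds for the semigroup on the weight\<close>

text \<open>Nonnegativity of the variance under \<open>P x\<close>. The killed mass sits at the
  cemetery, where f is 0, so the total mass stays 1.\<close>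

lemma semigroup_square_le:
  assumes MB: "moments_bounded" and f: "f \<in> poly_space S m" and f2: "(\<lambda>z. (f z)\<^sup>2) \<in> poly_space S m"
    and x: "x \<in> states S" and t: "0 \<le> t"
  shows "(semigroup_op S p t f x)\<^sup>2 \<le> semigroup_op S p t (\<lambda>z. (f z)\<^sup>2) x"
proof -
  interpret prob_space "P x" using prob[OF x] .
  have "variance (\<lambda>\<omega>. f (\<omega> t)) = expectation (\<lambda>\<omega>. (f (\<omega> t))\<^sup>2) - (expectation (\<lambda>\<omega>. f (\<omega> t)))\<^sup>2"
    by (intro variance_eq poly_moment[OF MB f x t] poly_moment[OF MB f2 x t])
  moreover have "0 \<le> variance (\<lambda>\<omega>. f (\<omega> t))" by (rule variance_positive)
  ultimately show ?thesis by (simp add: semigroup_op_poly[OF f x t] semigroup_op_poly[OF f2 x t])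
qed

text \<open>
  Since \<open>\<phi>\<close> is a sum of squares \<open>q\<^sup>2\<close> with \<open>P\<^sub>r q\<close> close to \<open>q\<close> for small \<open>r\<close>, Jensen's inequality
  bounds \<open>P\<^sub>r \<phi>\<close> from below.
\<close>

lemma lower_bound_of_dynkin:
  assumes MB: "moments_bounded" and C: "0 \<le> C"
    and upper: "\<And>r z. 0 \<le> r \<Longrightarrow> z \<in> states S \<Longrightarrow> semigroup_op S p r \<phi> z \<le> exp (C * r) * \<phi> z"
    and gen: "\<And>q. q \<in> poly_space S (m div 2) \<Longrightarrow> \<exists>g\<in>poly_space S (m div 2). dynkin q g"
  shows "\<exists>h>0. \<forall>r\<in>{0..h}. \<forall>z\<in>states S. \<phi> z \<le> 4 * semigroup_op S p r \<phi> z"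
proof -
  define k where "k = m div 2"
  have mk: "m = 2 * k" using even_m by (simp add: k_def)
  have sub: "q \<in> poly_space S m" if "q \<in> poly_space S k" for q
    using that poly_space_mono[of k m S] by (auto simp: mk)
  have sqP: "(\<lambda>z. (coord_power k j z)\<^sup>2) \<in> poly_space S m" for j
    unfolding coord_power_square mk by (rule coord_power_in_poly_space)
  have qk: "coord_power k j \<in> poly_space S k" for j by (rule coord_power_in_poly_space)
  \<comment> \<open>By Dynkin's formula P_r q - q is a time integral of P_s g, and Jensen with
    \<open>upper\<close> bounds the square of P_s g by a multiple of \<phi>. The difference is thus
    of order r times the square root of \<phi>, the size of q itself.\<close>
  have close: "\<exists>A\<ge>0. \<forall>r\<in>{0..1}. \<forall>z\<in>states S. (semigroup_op S p r (coord_power k j) z - coord_power k j z)\<^sup>2 \<le> r\<^sup>2 * A * \<phi> z" for j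
  proof -
    obtain g where g: "g \<in> poly_space S k" "dynkin (coord_power k j) g"
      using gen[of "coord_power k j"] qk by (auto simp: k_def)
    obtain D where D: "D \<ge> 0" "\<And>z. z \<in> states S \<Longrightarrow> (g z)\<^sup>2 \<le> D * \<phi> z"
      using poly_space_square_le_power_weight[OF g(1) _ even_m] by (auto simp: mk)
    let ?A = "D * exp C"
    have gr: "\<bar>semigroup_op S p s g z\<bar> \<le> sqrt (?A * \<phi> z)" if s: "s \<in> {0..1}" and z: "z \<in> states S" for s z
    proof -
      interpret prob_space "P z" using prob[OF z] .
      have s0: "0 \<le> s" using s by simp
      have gi: "integrable (P z) (\<lambda>\<omega>. g (\<omega> s))" by (rule poly_moment[OF MB sub[OF g(1)] z s0])
      have pi: "integrable (P z) (\<lambda>\<omega>. D * \<phi> (\<omega> s))" by (intro integrable_mult_right poly_moment[OF MB \<phi>_poly z s0])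
      have le: "(g (\<omega> s))\<^sup>2 \<le> D * \<phi> (\<omega> s)" if "\<omega> \<in> space (P z)" for \<omega> by (rule D(2)[OF path_P[OF z that s0]])
      have g2i: "integrable (P z) (\<lambda>\<omega>. (g (\<omega> s))\<^sup>2)"
        by (rule Bochner_Integration.integrable_bound[OF pi])
          (use borel_measurable_integrable[OF gi] le D(1) \<phi>_nonneg in \<open>auto intro!: AE_I2\<close>)
      have "(expectation (\<lambda>\<omega>. g (\<omega> s)))\<^sup>2 \<le> expectation (\<lambda>\<omega>. (g (\<omega> s))\<^sup>2)"
        using variance_eq[OF gi g2i] variance_positive[of "\<lambda>\<omega>. g (\<omega> s)"] by linarith
      also have "\<dots> \<le> expectation (\<lambda>\<omega>. D * \<phi> (\<omega> s))" by (intro integral_mono g2i pi le)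
      also have "\<dots> = D * semigroup_op S p s \<phi> z" by (simp add: semigroup_op_poly[OF \<phi>_poly z s0])
      also have "\<dots> \<le> D * (exp (C * s) * \<phi> z)" by (intro mult_left_mono upper s0 z D)
      also have "\<dots> \<le> D * (exp C * \<phi> z)"
        using s C D(1) by (intro mult_left_mono mult_right_mono \<phi>_nonneg) (auto simp: mult_left_le)
      finally have "(semigroup_op S p s g z)\<^sup>2 \<le> ?A * \<phi> z"
        by (simp add: semigroup_op_poly[OF sub[OF g(1)] z s0] mult.assoc)
      then show ?thesis by (rule real_le_rsqrt[of "\<bar>_\<bar>", simplified])
    qed
    have "(semigroup_op S p r (coord_power k j) z - coord_power k j z)\<^sup>2 \<le> r\<^sup>2 * ?A * \<phi> z"
      if r: "r \<in> {0..1}" and z: "z \<in> states S" for r z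
    proof -
      have r0: "0 \<le> r" using r by simp
      note gi = semigroup_time_integrable[OF MB sub[OF g(1)] z]
      have "semigroup_op S p r (coord_power k j) z - coord_power k j z = (LINT s:{0..r}|lborel. semigroup_op S p s g z)"
        using g(2) r0 z by (simp add: dynkin_def)
      also have "\<bar>\<dots>\<bar> \<le> (LINT s:{0..r}|lborel. \<bar>semigroup_op S p s g z\<bar>)"
        using set_integral_norm_bound[OF gi] by simp
      also have "\<dots> \<le> (LINT s:{0..r}|lborel. sqrt (?A * \<phi> z) * s ^ 0)"
        using set_integral_power(2)[OF r0, of "sqrt (?A * \<phi> z)" 0] gr[OF _ z] r
        by (intro set_integral_mono set_integrable_abs gi) auto
      also have "\<dots> = r * sqrt (?A * \<phi> z)" using set_integral_power(1)[OF r0, of "sqrt (?A * \<phi> z)" 0] by simp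
      finally have "(semigroup_op S p r (coord_power k j) z - coord_power k j z)\<^sup>2 \<le> (r * sqrt (?A * \<phi> z))\<^sup>2"
        by (intro abs_le_square_iff[THEN iffD1]) simp
      also have "\<dots> = r\<^sup>2 * ?A * \<phi> z" using D(1) \<phi>_nonneg[of z] by (simp add: power_mult_distrib)
      finally show ?thesis .
    qed
    then show ?thesis using D(1) by (intro exI[of _ ?A]) auto
  qed
  have "\<forall>j. \<exists>A. A \<ge> 0 \<and> (\<forall>r\<in>{0..1}. \<forall>z\<in>states S. (semigroup_op S p r (coord_power k j) z - coord_power k j z)\<^sup>2 \<le> r\<^sup>2 * A * \<phi> z)"
    using close by blast
  then obtain A where A: "\<forall>j. A j \<ge> 0 \<and> (\<forall>r\<in>{0..1}. \<forall>z\<in>states S. (semigroup_op S p r (coord_power k j) z - coord_power k j z)\<^sup>2 \<le> r\<^sup>2 * A j * \<phi> z)"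
    by (elim choice[elim_format] exE) (rule that)
  define B where "B = (\<Sum>j\<in>(UNIV :: 'n option set). A j)"
  have B: "0 \<le> B" unfolding B_def using A by (intro sum_nonneg) simp
  \<comment> \<open>Chosen so that the error \<open>2 * h\<^sup>2 * B\<close> is at most 1 /
    2.\<close>
  define h where "h = 1 / (4 * B + 1)"
  have h: "0 < h" "h \<le> 1" "2 * h\<^sup>2 * B \<le> 1 / 2"
  proof -
    show h0: "0 < h" and h1: "h \<le> 1" using B by (auto simp: h_def)
    have "h\<^sup>2 * B \<le> h * B" using h0 h1 B by (intro mult_right_mono) (auto simp: power2_eq_square mult_left_le)
    also have "\<dots> \<le> 1 / 4" using B by (simp add: h_def field_simps)
    finally show "2 * h\<^sup>2 * B \<le> 1 / 2" by simp
  qed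
  have "\<phi> z \<le> 4 * semigroup_op S p r \<phi> z" if r: "r \<in> {0..h}" and z: "z \<in> states S" for r z
  proof -
    have r0: "0 \<le> r" and r1: "r \<in> {0..1}" using r h by auto
    have each: "(coord_power k j z)\<^sup>2 \<le> 2 * semigroup_op S p r (\<lambda>z. (coord_power k j z)\<^sup>2) z + 2 * (r\<^sup>2 * A j * \<phi> z)" for j
    proof -
      let ?a = "coord_power k j z" and ?b = "semigroup_op S p r (coord_power k j) z"
      \<comment> \<open>The inequality a^2 \<le> 2 b^2 + 2 (b - a)^2 is the nonnegativity of this
        square.\<close>
      have "0 \<le> (2 * ?b - ?a)\<^sup>2" by simp
      then have "?a\<^sup>2 \<le> 2 * ?b\<^sup>2 + 2 * (?b - ?a)\<^sup>2" by (simp add: power2_eq_square algebra_simps)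
      also have "?b\<^sup>2 \<le> semigroup_op S p r (\<lambda>z. (coord_power k j z)\<^sup>2) z"
        by (rule semigroup_square_le[OF MB sub[OF qk] sqP z r0])
      also have "(?b - ?a)\<^sup>2 \<le> r\<^sup>2 * A j * \<phi> z" using A r1 z by blast
      finally show ?thesis by simp
    qed
    have "\<phi> z = (\<Sum>j\<in>UNIV. (coord_power k j z)\<^sup>2)" unfolding mk by (rule power_weight_squares)
    also have "\<dots> \<le> (\<Sum>j\<in>UNIV. 2 * semigroup_op S p r (\<lambda>z. (coord_power k j z)\<^sup>2) z + 2 * (r\<^sup>2 * A j * \<phi> z))"
      by (intro sum_mono each)
    also have "\<dots> = 2 * (\<Sum>j\<in>UNIV. 1 * semigroup_op S p r (\<lambda>z. (coord_power k j z)\<^sup>2) z) + 2 * r\<^sup>2 * B * \<phi> z"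
      by (simp add: sum.distrib sum_distrib_left sum_distrib_right B_def algebra_simps)
    also have "(\<Sum>j\<in>UNIV. 1 * semigroup_op S p r (\<lambda>z. (coord_power k j z)\<^sup>2) z) = semigroup_op S p r \<phi> z"
      by (rule semigroup_linear[OF MB sqP z r0, symmetric]) (simp add: mk power_weight_squares)
    also have "2 * r\<^sup>2 * B * \<phi> z \<le> 1 / 2 * \<phi> z"
    proof (intro mult_right_mono \<phi>_nonneg)
      have "r\<^sup>2 \<le> h\<^sup>2" using r by (intro power_mono) auto
      then have "2 * r\<^sup>2 * B \<le> 2 * h\<^sup>2 * B" using B by (intro mult_right_mono) auto
      then show "2 * r\<^sup>2 * B \<le> 1 / 2" using h(3) by linarith
    qed
    \<comment> \<open>At most half of \<phi> is error and is absorbed on the left, which turns the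
      factor 2 into 4.\<close>
    finally show ?thesis by simp
  qed
  then show ?thesis using h(1) by blast
qed

text \<open>Each further step of length h costs a factor 4 through the semigroup property. The
  exponent \<open>Suc n\<close> leaves one factor for the remaining piece of length at most
  h.\<close>

lemma lower_bound_iterate:
  assumes MB: "moments_bounded" and h: "0 < h"
    and lower: "\<And>r z. r \<in> {0..h} \<Longrightarrow> z \<in> states S \<Longrightarrow> \<phi> z \<le> 4 * semigroup_op S p r \<phi> z"
  shows "\<exists>K\<ge>0. \<forall>r\<in>{0..T}. \<forall>z\<in>states S. \<phi> z \<le> K * semigroup_op S p r \<phi> z"
proof -
  have nonneg: "0 \<le> semigroup_op S p r \<phi> z" if "0 \<le> r" "z \<in> states S" for r z
    using that \<phi>_nonneg by (simp add: semigroup_op_poly[OF \<phi>_poly])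
  have iter: "\<phi> z \<le> 4 ^ Suc n * semigroup_op S p r \<phi> z" if "r \<in> {0..real n * h}" "z \<in> states S" for n r z
    using that
  proof (induction n arbitrary: r z)
    case 0
    then show ?case using lower[of 0 z] h by simp
  next
    case (Suc n)
    show ?case
    proof (cases "r \<le> h")
      case True
      have r0: "0 \<le> r" using Suc.prems by simp
      have "\<phi> z \<le> 4 * semigroup_op S p r \<phi> z" using lower[of r z] True Suc.prems by simp
      also have "\<dots> \<le> 4 ^ Suc (Suc n) * semigroup_op S p r \<phi> z"
        using nonneg[OF r0 Suc.prems(2)] power_increasing[of 1 "Suc (Suc n)" "4 :: real"]
        by (intro mult_right_mono) auto
      finally show ?thesis .
    next
      case False
      have r': "r - h \<in> {0..real n * h}" "0 \<le> r - h" using Suc.prems False by (auto simp: algebra_simps)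
      note z = Suc.prems(2)
      have h0: "0 \<le> h" using h by simp
      have mom: "moment_function \<phi>" by (rule poly_moment_function[OF MB \<phi>_poly])
      have "\<phi> z \<le> 4 * semigroup_op S p h \<phi> z" using lower[of h z] h z by simp
      also have "semigroup_op S p h \<phi> z \<le> (\<integral>\<omega>. 4 ^ Suc n * semigroup_op S p (r - h) \<phi> (\<omega> h) \<partial>P z)"
        unfolding semigroup_op_poly[OF \<phi>_poly z h0]
        by (intro integral_mono poly_moment[OF MB \<phi>_poly z h0] integrable_mult_right
            markov_integral(1)[OF mom z h0 r'(2)] Suc.IH[OF r'(1)] path_P[OF z _ h0])
      also have "\<dots> = 4 ^ Suc n * semigroup_op S p h (semigroup_op S p (r - h) \<phi>) z"
        using semigroup_op_expectation[OF z h0 semigroup_op_borel[OF poly_space_borel[OF \<phi>_poly] r'(2)]] by simp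
      also have "semigroup_op S p h (semigroup_op S p (r - h) \<phi>) z = semigroup_op S p r \<phi> z"
        using semigroup_op_add[OF mom z h0 r'(2)] by simp
      finally show ?thesis by simp
    qed
  qed
  obtain n where n: "T < real n * h" using reals_Archimedean3[OF h] by blast
  have "\<forall>r\<in>{0..T}. \<forall>z\<in>states S. \<phi> z \<le> 4 ^ Suc n * semigroup_op S p r \<phi> z"
  proof (intro ballI iter)
    fix r assume "r \<in> {0..T}"
    then show "r \<in> {0..real n * h}" using n by auto
  qed
  then show ?thesis by (intro exI[of _ "4 ^ Suc n"]) simp
qed

lemma generator_imp_polynomial_process:
  assumes dom: "poly_space S m \<subseteq> generator_domain S F P" and ext: "extended_generator S F P G"
    and G: "\<And>k. k \<le> m \<Longrightarrow> G ` poly_space S k \<subseteq> poly_space S k"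
  shows "polynomial_process m S p"
proof -
  have graph: "(f, G f) \<in> generator_graph S F P" if "f \<in> poly_space S m" for f
    using dom ext that by (auto simp: extended_generator_def)
  have GP: "G f \<in> poly_space S k" if "k \<le> m" "f \<in> poly_space S k" for f k using G that by blast
  have half: "m div 2 \<le> m" "2 * (m div 2) \<le> m" by auto
  have sub: "f \<in> poly_space S m" if "k \<le> m" "f \<in> poly_space S k" for f k
    using that poly_space_mono by blast
  note wb = weight_expectation_bound[OF graph[OF \<phi>_poly] GP[OF order_refl \<phi>_poly]]
  have MB: "moments_bounded" by (rule wb(1))
  obtain C where C: "C \<ge> 0" "\<And>r z. 0 \<le> r \<Longrightarrow> z \<in> states S \<Longrightarrow> semigroup_op S p r \<phi> z \<le> exp (C * r) * \<phi> z"
    using wb(2) by blast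
  have bounded: "stopped_mass \<phi> x t \<sigma> \<le> ennreal (exp (C * t) * \<phi> x)"
    if "x \<in> states S" "0 < t" "stopping \<sigma>" for x t \<sigma>
    using stopped_supermartingale_bound[OF MB that C] by (simp add: stopped_mass_def \<phi>_nonneg)
  \<comment> \<open>The bounded stopped mass of \<phi> acts here as a bound on second moments at the
    localizing times.\<close>
  have dynkin_half: "dynkin q (G q)" if q: "q \<in> poly_space S (m div 2)" for q
    by (rule dynkin_of_vanishing_mass[OF MB sub[OF half(1) q] sub[OF half(1) GP[OF half(1) q]] graph[OF sub[OF half(1) q]]])
      (rule vanishing_mass_half_degree[OF q half(2) bounded])
  obtain h where h: "0 < h" "\<And>r z. r \<in> {0..h} \<Longrightarrow> z \<in> states S \<Longrightarrow> \<phi> z \<le> 4 * semigroup_op S p r \<phi> z"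
    using lower_bound_of_dynkin[OF MB C] dynkin_half GP[OF half(1)] by blast
  \<comment> \<open>In degree \<open>m\<close> the lower bound is needed up to an arbitrary horizon
    t, so the one on \<open>{0..h}\<close> has to be iterated.\<close>
  have dynkin: "dynkin f (G f)" if f: "f \<in> poly_space S m" for f
  proof (rule dynkin_of_vanishing_mass[OF MB f GP[OF order_refl f] graph[OF f]])
    fix x t \<tau> assume x: "x \<in> states S" and t: "0 < (t :: real)" and \<tau>: "exhausting x \<tau>"
    obtain K where "K \<ge> 0" "\<And>r z. r \<in> {0..t} \<Longrightarrow> z \<in> states S \<Longrightarrow> \<phi> z \<le> K * semigroup_op S p r \<phi> z"
      using lower_bound_iterate[OF MB h, of t] by blast
    then show "(\<lambda>n. stopped_mass f x t (\<tau> n)) \<longlonglongrightarrow> 0"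
      by (rule vanishing_mass_of_lower_bound[OF MB f _ _ x t \<tau>])
  qed
  show ?thesis
    unfolding polynomial_process_def
  proof (intro conjI ballI allI impI)
    fix f x t assume f: "f \<in> poly_space S m" and x: "x \<in> states S" and t: "0 \<le> (t :: real)"
    have "(\<integral>\<^sup>+\<omega>. ennreal \<bar>f (\<omega> t)\<bar> \<partial>P x) < \<infinity>"
      using poly_moment[OF MB f x t] by (simp add: integrable_iff_bounded)
    then show "(\<integral>\<^sup>+\<xi>\<in>Some ` S. ennreal \<bar>f \<xi>\<bar> \<partial>p t x) < \<infinity>"
      unfolding nn_integral_kernel[OF x t poly_space_borel[OF f]] .
  next
    fix k f t assume "k \<in> {0..m}" and f: "f \<in> poly_space S k" and t: "0 \<le> (t :: real)"
    then have k: "k \<le> m" by simp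
    show "semigroup_op S p t f \<in> poly_space S k"
      using dynkin[OF sub[OF k]] GP[OF k] by (intro dynkin_invariant[OF MB k _ f t]) blast
  next
    fix f x assume f: "f \<in> poly_space S m" and x: "x \<in> states S"
    show "continuous (at 0 within {0..}) (\<lambda>t. semigroup_op S p t f x)"
      by (rule dynkin_continuous[OF MB GP[OF order_refl f] dynkin[OF f] x])
  qed
qed

end

theorem theorem2p10:
  fixes S :: "(real^'n) set"
    and p :: "real \<Rightarrow> 'n state \<Rightarrow> 'n state measure"
    and F :: "real \<Rightarrow> 'n path measure"
    and P :: "'n state \<Rightarrow> 'n path measure"
    and m :: nat
  assumes "markov_process S p F P"
    and "m \<ge> 2" and "even m"
  shows "polynomial_process m S p \<longleftrightarrow>
    poly_space S m \<subseteq> generator_domain S F P \<and>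
    (\<exists>G. extended_generator S F P G \<and>
         (\<forall>k\<in>{0..m}. G ` poly_space S k \<subseteq> poly_space S k))"
proof -
  interpret polynomial_setting S p F P m
    using assms by (simp add: polynomial_setting_def polynomial_setting_axioms_def)
  show ?thesis
    using polynomial_process_imp_generator generator_imp_polynomial_process by (metis atLeastAtMost_iff le0)
qed

end
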